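(* Let $\mathcal H$ be a regular unitarily invariant space with the Corona property, and let $\mathfrak a$ be a weak-$*$ closed ideal of $\mathcal M(\mathcal H)$. Let $u_1,\dots,u_s\in\mathcal M(\mathcal H)$ and $z\in\mathbb C^s$. Then $z\in\sigma_{\mathcal B_{\mathfrak a}}(u_1(Z^{(\mathfrak a)}),\dots,u_s(Z^{(\mathfrak a)}))$ if and only if \[ \sup_{f\in\mathfrak a}\ \inf_{w\in\mathbb B_d}\Big\{|f(w)|+\sum_{j=1}^s|u_j(w)-z_j|\Big\}=0. \]
   Context: A regular unitarily invariant space: a reproducing kernel Hilbert space $\mathcal H$ of holomorphic functions on $\mathbb B_d$ with kernel $K(z,w)=1+\sum_{n\ge1}a_n\langle z,w\rangle^n$, $a_n>0$, $a_n/a_{n+1}\to1$, having the complete Nevanlinna–Pick property. $\mathcal M(\mathcal H)$ is the multiplier algebra. Corona property: point evaluations at points of $\mathbb B_d$ are weak-$*$ dense in the character space of $\mathcal M(\mathcal H)$. $\mathcal H(\mathfrak a)=\mathcal H\ominus[\mathfrak a\mathcal H]$ ($[\mathfrak a\mathcal H]$ the closed span of $\{fh\}$), $f(Z^{(\mathfrak a)})=P_{\mathcal H(\mathfrak a)}M_f|_{\mathcal H(\mathfrak a)}$, and $\mathcal B_{\mathfrak a}=\{f(Z^{(\mathfrak a)}):f\in\mathcal M(\mathcal H)\}$, a commutative unital algebra. For commuting elements $A_1,\dots,A_s$ of $\mathcal B_{\mathfrak a}$, $\sigma_{\mathcal B_{\mathfrak a}}(A)=\{z\in\mathbb C^s: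 I\notin\sum_j(A_j-z_jI)\mathcal B_{\mathfrak a}\}$. *)

theory Defs
  imports "HOL-Analysis.Analysis"
begin

type_synonym 'd fn = "complex^'d \<Rightarrow> complex"

definition Bd :: "(complex^'d::finite) set" where
  "Bd = ball 0 1"

definition cinner :: "complex^'d::finite \<Rightarrow> complex^'d \<Rightarrow> complex" where
  "cinner z w = (\<Sum>i\<in>UNIV. z$i * cnj (w$i))"

definition ui_kernel :: "(nat \<Rightarrow> real) \<Rightarrow> complex^'d::finite \<Rightarrow> complex^'d \<Rightarrow> complex" where
  "ui_kernel a z w = 1 + (\<Sum>n. complex_of_real (a (Suc n)) * cinner z w ^ Suc n)"

definition psd_on :: "'a set \<Rightarrow> ('a \<Rightarrow> 'a \<Rightarrow> complex) \<Rightarrow> bool" where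
  "psd_on S k \<longleftrightarrow> (\<forall>(n::nat) (x::nat \<Rightarrow> 'a) (c::nat \<Rightarrow> complex). (\<forall>i<n. x i \<in> S) \<longrightarrow>
     (let q = (\<Sum>i<n. \<Sum>j<n. cnj (c i) * c j * k (x i) (x j)) in Im q = 0 \<and> Re q \<ge> 0))"

section \<open>The reproducing kernel Hilbert space H (Aronszajn description)\<close>

text \<open>Elements of H are functions on the ball; we normalise them to vanish off the ball.\<close>
definition Hspace :: "(nat \<Rightarrow> real) \<Rightarrow> ('d::finite) fn set" where
  "Hspace a = {f. (\<forall>z. z \<notin> Bd \<longrightarrow> f z = 0) \<and>
     (\<exists>C::real. psd_on Bd (\<lambda>z w. of_real (C\<^sup>2) * ui_kernel a z w - f z * cnj (f w)))}"

definition Hnorm :: "(nat \<Rightarrow> real) \<Rightarrow> ('d::finite) fn \<Rightarrow> real" where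
  "Hnorm a f = Inf {C. C \<ge> 0 \<and> psd_on Bd (\<lambda>z w. of_real (C\<^sup>2) * ui_kernel a z w - f z * cnj (f w))}"

text \<open>inner product (linear in the first argument) by polarization\<close>
definition Hinner :: "(nat \<Rightarrow> real) \<Rightarrow> ('d::finite) fn \<Rightarrow> 'd fn \<Rightarrow> complex" where
  "Hinner a f g = (1/4) * (\<Sum>k<(4::nat). \<i>^k * of_real ((Hnorm a (\<lambda>z. f z + \<i>^k * g z))\<^sup>2))"

definition regular_ui_cnp :: "(nat \<Rightarrow> real) \<Rightarrow> 'd::finite itself \<Rightarrow> bool" where
  "regular_ui_cnp a (_::'d itself) \<longleftrightarrow>
     (\<forall>n\<ge>1. a n > 0) \<and> ((\<lambda>n. a n / a (Suc n)) \<longlonglongrightarrow> 1) \<and>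
     psd_on (Bd :: (complex^'d) set) (\<lambda>z w. 1 - 1 / ui_kernel a z w)"

definition Mult :: "(nat \<Rightarrow> real) \<Rightarrow> ('d::finite) fn set" where
  "Mult a = {\<phi>. (\<forall>z. z \<notin> Bd \<longrightarrow> \<phi> z = 0) \<and> (\<forall>f\<in>Hspace a. (\<lambda>z. \<phi> z * f z) \<in> Hspace a)}"

definition is_character :: "(nat \<Rightarrow> real) \<Rightarrow> (('d::finite) fn \<Rightarrow> complex) \<Rightarrow> bool" where
  "is_character a chr \<longleftrightarrow>
     (\<exists>f\<in>Mult a. chr f \<noteq> 0) \<and>
     (\<forall>f\<in>Mult a. \<forall>g\<in>Mult a. \<forall>c. chr (\<lambda>z. c * f z + g z) = c * chr f + chr g) \<and>
     (\<forall>f\<in>Mult a. \<forall>g\<in>Mult a. chr (\<lambda>z. f z * g z) = chr f * chr g)"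

text \<open>Corona property: point evaluations are weak-* (pointwise) dense in the character space.\<close>
definition corona :: "(nat \<Rightarrow> real) \<Rightarrow> 'd::finite itself \<Rightarrow> bool" where
  "corona a (_::'d itself) \<longleftrightarrow>
     (\<forall>chr::'d fn \<Rightarrow> complex. is_character a chr \<longrightarrow>
        (\<forall>F \<epsilon>. finite F \<and> F \<subseteq> Mult a \<and> \<epsilon> > 0 \<longrightarrow>
           (\<exists>w\<in>Bd. \<forall>\<phi>\<in>F. cmod (\<phi> w - chr \<phi>) < \<epsilon>)))"

text \<open>sigma-weak functionals on B(H): T |-> sum_k <T x_k, y_k>, sum ||x_k||^2, sum ||y_k||^2 finite\<close>
definition wstar_pair :: "(nat \<Rightarrow> real) \<Rightarrow> (nat \<Rightarrow> ('d::finite) fn) \<Rightarrow> (nat \<Rightarrow> 'd fn) \<Rightarrow> bool" where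
  "wstar_pair a x y \<longleftrightarrow> (\<forall>k. x k \<in> Hspace a \<and> y k \<in> Hspace a) \<and>
     summable (\<lambda>k. (Hnorm a (x k))\<^sup>2) \<and> summable (\<lambda>k. (Hnorm a (y k))\<^sup>2)"

definition wstar_fun :: "(nat \<Rightarrow> real) \<Rightarrow> (nat \<Rightarrow> ('d::finite) fn) \<Rightarrow> (nat \<Rightarrow> 'd fn) \<Rightarrow> 'd fn \<Rightarrow> complex" where
  "wstar_fun a x y \<phi> = (\<Sum>k. Hinner a (\<lambda>z. \<phi> z * x k z) (y k))"

definition wstar_closed :: "(nat \<Rightarrow> real) \<Rightarrow> ('d::finite) fn set \<Rightarrow> bool" where
  "wstar_closed a S \<longleftrightarrow>
     (\<forall>\<phi>\<in>Mult a.
        (\<forall>(m::nat) X Y (\<epsilon>::real). (\<forall>i<m. wstar_pair a (X i) (Y i)) \<and> \<epsilon> > 0 \<longrightarrow>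
           (\<exists>g\<in>S. \<forall>i<m. cmod (wstar_fun a (X i) (Y i) g - wstar_fun a (X i) (Y i) \<phi>) < \<epsilon>))
        \<longrightarrow> \<phi> \<in> S)"

definition is_ideal :: "(nat \<Rightarrow> real) \<Rightarrow> ('d::finite) fn set \<Rightarrow> bool" where
  "is_ideal a S \<longleftrightarrow> S \<subseteq> Mult a \<and> (\<lambda>z. 0) \<in> S \<and>
     (\<forall>f\<in>S. \<forall>g\<in>S. (\<lambda>z. f z + g z) \<in> S) \<and>
     (\<forall>c. \<forall>f\<in>S. (\<lambda>z. c * f z) \<in> S) \<and>
     (\<forall>f\<in>S. \<forall>g\<in>Mult a. (\<lambda>z. g z * f z) \<in> S)"

definition wstar_closed_ideal :: "(nat \<Rightarrow> real) \<Rightarrow> ('d::finite) fn set \<Rightarrow> bool" where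
  "wstar_closed_ideal a S \<longleftrightarrow> is_ideal a S \<and> wstar_closed a S"

definition aH_closed_span :: "(nat \<Rightarrow> real) \<Rightarrow> ('d::finite) fn set \<Rightarrow> 'd fn set" where
  "aH_closed_span a S = {g \<in> Hspace a. \<forall>\<epsilon>>0. \<exists>(n::nat) c f h.
      (\<forall>i<n. f i \<in> S \<and> h i \<in> Hspace a) \<and>
      Hnorm a (\<lambda>z. g z - (\<Sum>i<n. c i * f i z * h i z)) < \<epsilon>}"

definition Hquot :: "(nat \<Rightarrow> real) \<Rightarrow> ('d::finite) fn set \<Rightarrow> 'd fn set" where
  "Hquot a S = {h \<in> Hspace a. \<forall>g\<in>aH_closed_span a S. Hinner a h g = 0}"

definition projQ :: "(nat \<Rightarrow> real) \<Rightarrow> ('d::finite) fn set \<Rightarrow> 'd fn \<Rightarrow> 'd fn" where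
  "projQ a S h = (THE p. p \<in> Hquot a S \<and> (\<forall>q\<in>Hquot a S. Hinner a (\<lambda>z. h z - p z) q = 0))"

definition compress :: "(nat \<Rightarrow> real) \<Rightarrow> ('d::finite) fn set \<Rightarrow> 'd fn \<Rightarrow> ('d fn \<Rightarrow> 'd fn)" where
  "compress a S f = (\<lambda>h. projQ a S (\<lambda>z. f z * h z))"

definition Balg :: "(nat \<Rightarrow> real) \<Rightarrow> ('d::finite) fn set \<Rightarrow> ('d fn \<Rightarrow> 'd fn) set" where
  "Balg a S = {compress a S f | f. f \<in> Mult a}"

text \<open>sigma_{B_a}(A_1..A_s) = {z : I not in sum_j (A_j - z_j I) B_a}; operators are compared on H(a).\<close>
definition joint_spec :: "(nat \<Rightarrow> real) \<Rightarrow> ('d::finite) fn set \<Rightarrow> nat \<Rightarrow> (nat \<Rightarrow> ('d fn \<Rightarrow> 'd fn))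
     \<Rightarrow> (nat \<Rightarrow> complex) set" where
  "joint_spec a S s A = {z. \<not> (\<exists>B. (\<forall>j<s. B j \<in> Balg a S) \<and>
      (\<forall>h\<in>Hquot a S. (\<lambda>w. \<Sum>j<s. A j (B j h) w - z j * B j h w) = h))}"

end

theory Submission
  imports Defs
begin

text \<open>
  A point \<open>z\<close> lies outside the spectrum iff \<open>f = 1 - \<Sum> (u\<^sub>j - z\<^sub>j) g\<^sub>j\<close> compresses to \<open>0\<close> for
  some multipliers \<open>g\<^sub>j\<close>, i.e. iff \<open>f \<in> [I H]\<close>. Once this is known to force \<open>f \<in> I\<close>, the lower bound
  follows because multipliers are bounded functions. Conversely, if \<open>|f| + \<Sum> |u\<^sub>j - z\<^sub>j|\<close> is bounded below
  for some \<open>f \<in> I\<close>, no character annihilates \<open>f\<close> and all \<open>u\<^sub>j - z\<^sub>j\<close> by the corona property, so these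
  elements generate the unit ideal (Gelfand--Mazur).

  The step from \<open>[I H]\<close> to \<open>I\<close> is where the complete Pick property enters. With \<open>k = 1 / (1 - B)\<close> and
  \<open>B\<close> positive semidefinite, every square summable sequence \<open>F\<^sub>l\<close> in \<open>H\<close> admits a contractive multiplier
  \<open>\<psi> \<noteq> 1\<close> such that \<open>(1 - \<psi>) F\<close> is a contractive column multiplier. Here \<open>1 / (1 - \<psi>)\<close> is Sarason's function
  \<open>w \<mapsto> \<Sum> \<langle>F\<^sub>l, k\<^sub>w F\<^sub>l\<rangle> + (1 - \<parallel>F\<parallel>\<^sup>2) / 2\<close>, and positivity comes from the Schur product theorem. On weak-* functionals
  built from \<open>F\<close>, the multiplier \<open>f\<close> is then a limit of \<open>f (1 - \<psi>) / (1 - r \<psi>)\<close> as \<open>r\<close> tends to \<open>1\<close>, and each of these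
  is a limit of \<open>g (1 - \<psi>)\<close> with \<open>g \<in> I\<close> approximating \<open>f / (1 - r \<psi>)\<close> in the norm of \<open>H\<close>.
\<close>

section \<open>Positive semidefinite kernels\<close>

text \<open>The norm of \<open>H\<close> controls vectors only: an element of \<open>I\<close> close
  to \<open>f\<close> in that norm may have a huge multiplier norm, so a weak-* functional, an
  infinite sum over the \<open>x k\<close> and \<open>y k\<close>, cannot be estimated along such
  approximants directly. The factor \<open>1 - \<psi>\<close> removes this obstacle: sending
  \<open>p\<close> to the sequence \<open>(1 - \<psi>) x k p\<close> is then contractive from
  \<open>H\<close> into square summable sequences, so only the norm of \<open>p\<close> matters. The
  form of \<open>\<psi>\<close> is dictated by the identity \<open>1 - \<psi>(z) cnj \<psi>(w) =
  (s(z) + cnj s(w) - 1) / (s(z) cnj s(w))\<close> for \<open>s = 1 / (1 - \<psi>)\<close>.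
  Contractivity of \<open>\<psi>\<close> becomes positivity of \<open>k (s + cnj s - 1)\<close>, and
  what this kernel exceeds zero by, a Gram kernel of the \<open>k\<^sub>w F\<^sub>l\<close>, is the
  column bound. Since \<open>H\<close> is given by a domination condition, with the norm an infimum
  and the inner product a polarization, all estimates are reduced to finite combinations of kernels.
  Such estimates survive pointwise limits, which takes the place of weak compactness.\<close>

definition hform :: "nat \<Rightarrow> (nat \<Rightarrow> complex) \<Rightarrow> (nat \<Rightarrow> nat \<Rightarrow> complex) \<Rightarrow> complex" where
  "hform n c A = (\<Sum>i<n. \<Sum>j<n. cnj (c i) * c j * A i j)"

text \<open>Both conditions become one membership in \<open>\<real>\<^sub>\<ge>\<^sub>0\<close>, a
  set closed under sums, products and limits, so the closure properties of positive kernels are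
  inherited from it.\<close>

lemma psd_on_hform:
  "psd_on S k \<longleftrightarrow> (\<forall>n x c. (\<forall>i<n. x i \<in> S) \<longrightarrow> hform n c (\<lambda>i j. k (x i) (x j)) \<in> \<real>\<^sub>\<ge>\<^sub>0)"
  unfolding psd_on_def Let_def hform_def complex_nonneg_Reals_iff by (simp only: conj_commute)

lemma psd_onI:
  assumes "\<And>n x c. (\<And>i. i < n \<Longrightarrow> x i \<in> S) \<Longrightarrow> hform n c (\<lambda>i j. k (x i) (x j)) \<in> \<real>\<^sub>\<ge>\<^sub>0"
  shows "psd_on S k"
  unfolding psd_on_hform by (intro allI impI assms) auto

lemma psd_onD:
  assumes "psd_on S k" "\<And>i. i < n \<Longrightarrow> x i \<in> S"
  shows "hform n c (\<lambda>i j. k (x i) (x j)) \<in> \<real>\<^sub>\<ge>\<^sub>0"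
  using assms unfolding psd_on_hform by blast

lemma hform_cong:
  assumes "\<And>i j. i < n \<Longrightarrow> j < n \<Longrightarrow> A i j = B i j"
  shows "hform n c A = hform n c B"
  unfolding hform_def using assms by (intro sum.cong refl) simp

lemma hform_add: "hform n c (\<lambda>i j. A i j + B i j) = hform n c A + hform n c B"
  by (simp add: hform_def distrib_left sum.distrib)

lemma hform_diff: "hform n c (\<lambda>i j. A i j - B i j) = hform n c A - hform n c B"
  by (simp add: hform_def right_diff_distrib sum_subtractf)

lemma hform_scale: "hform n c (\<lambda>i j. r * A i j) = r * hform n c A"
  by (simp add: hform_def sum_distrib_left mult.left_commute)

lemma hform_congruence:
  "hform n c (\<lambda>i j. f i * cnj (f j) * A i j) = hform n (\<lambda>i. c i * cnj (f i)) A"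
  unfolding hform_def by (intro sum.cong refl) simp

lemma hform_rank_one: "hform n c (\<lambda>i j. f i * cnj (f j)) = of_real ((cmod (\<Sum>i<n. cnj (c i) * f i))\<^sup>2)"
proof -
  have "hform n c (\<lambda>i j. f i * cnj (f j)) = (\<Sum>i<n. cnj (c i) * f i) * cnj (\<Sum>i<n. cnj (c i) * f i)"
    unfolding hform_def cnj_sum sum_product by (intro sum.cong refl) simp
  then show ?thesis by (simp only: complex_norm_square)
qed

lemma psd_on_cong:
  assumes "psd_on S k" "\<And>x y. x \<in> S \<Longrightarrow> y \<in> S \<Longrightarrow> k x y = l x y"
  shows "psd_on S l"
proof (rule psd_onI)
  fix n :: nat and x c assume x: "\<And>i. i < n \<Longrightarrow> x i \<in> S"
  have "hform n c (\<lambda>i j. l (x i) (x j)) = hform n c (\<lambda>i j. k (x i) (x j))"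
    by (rule hform_cong) (simp add: x assms(2))
  with psd_onD[OF assms(1), of n x c] x
  show "hform n c (\<lambda>i j. l (x i) (x j)) \<in> \<real>\<^sub>\<ge>\<^sub>0" by simp
qed

lemma psd_on_compose:
  assumes "psd_on S k" "\<And>i. i \<in> T \<Longrightarrow> w i \<in> S"
  shows "psd_on T (\<lambda>i j. k (w i) (w j))"
proof (rule psd_onI)
  fix n :: nat and x c assume "\<And>i. i < n \<Longrightarrow> x i \<in> T"
  then show "hform n c (\<lambda>i j. k (w (x i)) (w (x j))) \<in> \<real>\<^sub>\<ge>\<^sub>0"
    using psd_onD[OF assms(1), of n "\<lambda>i. w (x i)" c] assms(2) by blast
qed

lemma psd_on_add:
  assumes "psd_on S k" "psd_on S l"
  shows "psd_on S (\<lambda>x y. k x y + l x y)"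
  by (rule psd_onI) (simp add: hform_add nonneg_Reals_add_I psd_onD[OF assms(1)] psd_onD[OF assms(2)])

lemma psd_on_scale:
  assumes "psd_on S k" "r \<ge> 0"
  shows "psd_on S (\<lambda>x y. of_real r * k x y)"
  by (rule psd_onI) (simp add: hform_scale nonneg_Reals_mult_I psd_onD[OF assms(1)] assms(2))

lemma psd_on_congruence:
  assumes "psd_on S k"
  shows "psd_on S (\<lambda>x y. f x * cnj (f y) * k x y)"
  by (rule psd_onI) (simp add: hform_congruence psd_onD[OF assms])

lemma psd_on_rank_one: "psd_on S (\<lambda>x y. f x * cnj (f y))"
  by (rule psd_onI) (simp add: hform_rank_one del: of_real_power)

lemma psd_on_one: "psd_on S (\<lambda>x y. 1)"
  using psd_on_rank_one[of S "\<lambda>_. 1"] by simp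

lemma psd_on_sum:
  assumes "\<And>i. i \<in> A \<Longrightarrow> psd_on S (k i)"
  shows "psd_on S (\<lambda>x y. \<Sum>i\<in>A. k i x y)"
  using assms
proof (induction A rule: infinite_finite_induct)
  case (insert i A)
  then have "psd_on S (\<lambda>x y. k i x y + (\<Sum>i\<in>A. k i x y))" by (intro psd_on_add) auto
  with insert.hyps show ?case by simp
qed (use psd_on_rank_one[of S "\<lambda>_. 0"] in auto)

lemma psd_on_LIMSEQ:
  assumes "\<And>N. psd_on S (k N)" "\<And>x y. x \<in> S \<Longrightarrow> y \<in> S \<Longrightarrow> (\<lambda>N. k N x y) \<longlonglongrightarrow> l x y"
  shows "psd_on S l"
proof (rule psd_onI)
  fix n :: nat and x c assume x: "\<And>i. i < n \<Longrightarrow> x i \<in> S"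
  have "(\<lambda>N. hform n c (\<lambda>i j. k N (x i) (x j))) \<longlonglongrightarrow> hform n c (\<lambda>i j. l (x i) (x j))"
    unfolding hform_def using x by (intro tendsto_sum tendsto_mult tendsto_const assms(2)) auto
  then show "hform n c (\<lambda>i j. l (x i) (x j)) \<in> \<real>\<^sub>\<ge>\<^sub>0"
    by (rule Lim_in_closed_set[OF closed_nonneg_Reals_complex, rotated 2])
      (use psd_onD[OF assms(1)] x in auto)
qed

lemma psd_on_diag:
  assumes "psd_on S k" "x \<in> S"
  shows "Im (k x x) = 0" "0 \<le> Re (k x x)"
  using psd_onD[OF assms(1), of 1 "\<lambda>_. x" "\<lambda>_. 1"] assms(2)
  by (simp_all add: hform_def complex_nonneg_Reals_iff)

lemma psd_on_pair:
  fixes a b :: complex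
  assumes "psd_on S k" "x \<in> S" "y \<in> S"
  shows "cnj a * a * k x x + cnj a * b * k x y + (cnj b * a * k y x + cnj b * b * k y y) \<in> \<real>\<^sub>\<ge>\<^sub>0"
  using psd_onD[OF assms(1), of 2 "\<lambda>i. if i = 0 then x else y" "\<lambda>i. if i = 0 then a else b"] assms(2,3)
  by (simp add: hform_def numeral_2_eq_2)

text \<open>Symmetry is not part of \<open>psd_on\<close>; it follows from the form being real.
  Coefficients \<open>(1, 1)\<close> compare the imaginary parts, \<open>(1, \<i>)\<close> the real
  parts.\<close>

lemma psd_on_hermitian:
  assumes "psd_on S k" "x \<in> S" "y \<in> S"
  shows "k y x = cnj (k x y)"
proof -
  have "Im (k x x) = 0" "Im (k y y) = 0"
    using psd_on_diag[OF assms(1)] assms(2,3) by auto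
  moreover have "Im (k x x + k x y + (k y x + k y y)) = 0"
    using psd_on_pair[OF assms, of 1 1] by (simp add: complex_nonneg_Reals_iff)
  moreover have "Im (k x x + \<i> * k x y + (- \<i> * k y x + k y y)) = 0"
    using psd_on_pair[OF assms, of 1 \<i>] by (simp add: complex_nonneg_Reals_iff)
  ultimately show ?thesis by (simp add: complex_eq_iff)
qed

lemma psd_on_Cauchy_Schwarz:
  assumes "psd_on S k" "x \<in> S" "y \<in> S"
  shows "(cmod (k x y))\<^sup>2 \<le> Re (k x x) * Re (k y y)"
proof -
  define p where "p = k x y"
  have yx: "k y x = cnj p" using psd_on_hermitian[OF assms] by (simp add: p_def)
  have xx: "k x x = of_real (Re (k x x))" and yy: "k y y = of_real (Re (k y y))"
    using psd_on_diag assms by (auto simp: complex_eq_iff)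
  have pp: "p * cnj p = of_real ((cmod p)\<^sup>2)" by (simp only: complex_norm_square)
  \<comment> \<open>The coefficients are \<open>(t, - cnj p)\<close>, whose phase makes both cross
    terms \<open>- t |p|^2\<close>. The quadratic in \<open>t\<close> is used at its minimiser
    \<open>|p|^2 / k x x\<close>; if \<open>k x x = 0\<close> it is linear, and
    \<open>t = k y y + 1\<close> already makes it negative.\<close>
  have main: "0 \<le> t\<^sup>2 * Re (k x x) - 2 * t * (cmod p)\<^sup>2 + (cmod p)\<^sup>2 * Re (k y y)" for t :: real
  proof -
    have "of_real t * of_real t * k x x + of_real t * (- cnj p) * p + ((- p) * of_real t * cnj p + (- p) * (- cnj p) * k y y)
      = of_real (t\<^sup>2 * Re (k x x) - 2 * t * (cmod p)\<^sup>2 + (cmod p)\<^sup>2 * Re (k y y))"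
      by (subst xx, subst yy) (simp only: of_real_mult of_real_diff of_real_add pp[symmetric], simp add: algebra_simps power2_eq_square)
    moreover have "of_real t * of_real t * k x x + of_real t * (- cnj p) * p + ((- p) * of_real t * cnj p + (- p) * (- cnj p) * k y y) \<in> \<real>\<^sub>\<ge>\<^sub>0"
      using psd_on_pair[OF assms, of "of_real t" "- cnj p"] unfolding p_def[symmetric] yx
      by (simp only: complex_cnj_complex_of_real complex_cnj_minus complex_cnj_cnj)
    ultimately have "of_real (t\<^sup>2 * Re (k x x) - 2 * t * (cmod p)\<^sup>2 + (cmod p)\<^sup>2 * Re (k y y)) \<in> (\<real>\<^sub>\<ge>\<^sub>0 :: complex set)"
      by (simp only:)
    then show ?thesis unfolding nonneg_Reals_of_real_iff .
  qed
  have nx: "0 \<le> Re (k x x)" and ny: "0 \<le> Re (k y y)" using psd_on_diag[OF assms(1)] assms(2,3) by auto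
  show ?thesis
  proof (cases "p = 0")
    case False
    then have p: "(cmod p)\<^sup>2 > 0" by simp
    show ?thesis
    proof (cases "Re (k x x) = 0")
      case True
      have "0 \<le> (cmod p)\<^sup>2 * (Re (k y y) - 2 * (Re (k y y) + 1))"
        using main[of "Re (k y y) + 1"] True by (simp add: algebra_simps)
      then have "0 \<le> Re (k y y) - 2 * (Re (k y y) + 1)" using p
        by (simp add: zero_le_mult_iff)
      then have False using ny by (simp add: algebra_simps)
      then show ?thesis ..
    next
      case False
      then have rx: "Re (k x x) > 0" using nx by simp
      have "0 \<le> (cmod p)\<^sup>2 * (Re (k y y) - (cmod p)\<^sup>2 / Re (k x x))"
        using main[of "(cmod p)\<^sup>2 / Re (k x x)"] rx
        by (simp add: field_simps power2_eq_square)
      then have "0 \<le> Re (k y y) - (cmod p)\<^sup>2 / Re (k x x)" using p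
        by (simp add: zero_le_mult_iff)
      then show ?thesis using rx by (simp add: p_def field_simps)
    qed
  next
    case True
    then show ?thesis using nx ny unfolding p_def[symmetric] by simp
  qed
qed

text \<open>Eliminate the last index by a Schur complement: what is subtracted from \<open>A\<close> has rank one, so
  its entrywise product with \<open>D\<close> is a congruence of \<open>D\<close>.\<close>
lemma Schur_product_finite:
  fixes A D :: "nat \<Rightarrow> nat \<Rightarrow> complex"
  assumes "psd_on {..<n} A" "psd_on {..<n} D"
  shows "psd_on {..<n} (\<lambda>i j. A i j * D i j)"
  using assms
proof (induction n arbitrary: A D)
  case 0
  show ?case 
  proof (rule psd_onI)
    fix m :: nat and x :: "nat \<Rightarrow> nat" and c :: "nat \<Rightarrow> complex"
    assume "\<And>i. i < m \<Longrightarrow> x i \<in> {..<0}"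
    then have "m = 0" by auto
    then show "hform m c (\<lambda>i j. A (x i) (x j) * D (x i) (x j)) \<in> \<real>\<^sub>\<ge>\<^sub>0" by (simp add: hform_def)
  qed
next
  case (Suc n)
  define A' where "A' = (\<lambda>i j. A i j - A i n * A n j / A n n)"
  have herm: "A j i = cnj (A i j)" if "i < Suc n" "j < Suc n" for i j
    using psd_on_hermitian[OF Suc.prems(1), of i j] that by simp
  have nn: "A n n = of_real (Re (A n n))" "0 \<le> Re (A n n)"
    using psd_on_diag[OF Suc.prems(1), of n] by (auto simp: complex_eq_iff)
  \<comment> \<open>With a zero pivot the convention \<open>x / 0 = 0\<close> gives
    \<open>A' = A\<close>. Nothing is lost, because Cauchy-Schwarz makes row and column
    \<open>n\<close> of \<open>A\<close> vanish in that case.\<close>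
  have zero: "A i n = 0" "A n i = 0" if "A n n = 0" "i < Suc n" for i
  proof -
    have "(cmod (A i n))\<^sup>2 \<le> 0"
      using psd_on_Cauchy_Schwarz[OF Suc.prems(1), of i n] that by simp
    then show "A i n = 0" by simp
    then show "A n i = 0" using herm[of i n] that by simp
  qed
  have A'n: "A' i n = 0" "A' n i = 0" if "i < Suc n" for i
    using zero[of i] that by (auto simp: A'_def)
  have psdA': "psd_on {..<Suc n} A'"
  proof (rule psd_onI)
    fix m :: nat and x :: "nat \<Rightarrow> nat" and c :: "nat \<Rightarrow> complex"
    assume x: "\<And>i. i < m \<Longrightarrow> x i \<in> {..<Suc n}"
    define s where "s = (\<Sum>j<m. c j * A n (x j))"
    \<comment> \<open>The weight \<open>- s / A n n\<close> at the additional index \<open>n\<close>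
      minimises the form of \<open>A\<close>, and the minimum is the form of the Schur complement
      \<open>A'\<close>.\<close>
    define c' where "c' = (\<lambda>i. if i < m then c i else - s / A n n)"
    define x' where "x' = (\<lambda>i. if i < m then x i else n)"
    have s': "(\<Sum>i<m. cnj (c i) * A (x i) n) = cnj s"
      using x herm[of n] by (simp add: s_def)
    have s'': "(\<Sum>j<m. c j * A n (x j)) = s" by (simp add: s_def)
    have "hform (Suc m) c' (\<lambda>i j. A (x' i) (x' j))
       = (\<Sum>i<m. (\<Sum>j<m. cnj (c i) * c j * A (x i) (x j)) + cnj (c i) * (- s / A n n) * A (x i) n)
        + ((\<Sum>j<m. cnj (- s / A n n) * c j * A n (x j)) + cnj (- s / A n n) * (- s / A n n) * A n n)"
      unfolding hform_def sum.lessThan_Suc by (simp add: c'_def x'_def)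
    also have "\<dots> = hform m c (\<lambda>i j. A (x i) (x j)) + (\<Sum>i<m. cnj (c i) * A (x i) n) * (- s / A n n)
        + (cnj (- s / A n n) * (\<Sum>j<m. c j * A n (x j)) + cnj (- s / A n n) * (- s / A n n) * A n n)"
      unfolding hform_def sum.distrib sum_distrib_left sum_distrib_right by (simp only: mult_ac)
    also have "\<dots> = hform m c (\<lambda>i j. A (x i) (x j)) - cnj s * s / A n n"
    proof (cases "A n n = 0")
      case False
      moreover have "cnj (A n n) = A n n" by (subst (1 2) nn(1)) (rule complex_cnj_complex_of_real)
      ultimately show ?thesis unfolding s' s'' by simp
    next
      case True
      then show ?thesis by (simp only: complex_cnj_divide complex_cnj_zero) simp
    qed
    also have "cnj s * s / A n n = hform m c (\<lambda>i j. A (x i) n * A n (x j) / A n n)"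
      unfolding s'[symmetric]
      unfolding s_def sum_product sum_divide_distrib hform_def
      by (intro sum.cong refl) simp
    finally have "hform (Suc m) c' (\<lambda>i j. A (x' i) (x' j)) = hform m c (\<lambda>i j. A' (x i) (x j))"
      by (simp add: A'_def hform_diff)
    with psd_onD[OF Suc.prems(1), of "Suc m" x' c'] x
    show "hform m c (\<lambda>i j. A' (x i) (x j)) \<in> \<real>\<^sub>\<ge>\<^sub>0"
      by (auto simp: x'_def)
  qed
  have sub: "psd_on {..<n} E" if "psd_on {..<Suc n} E" for E
    using psd_on_compose[OF that, of "{..<n}" "\<lambda>i. i"] by auto
  have IH: "psd_on {..<n} (\<lambda>i j. A' i j * D i j)"
    by (rule Suc.IH) (use sub psdA' Suc.prems in auto)
  have 1: "psd_on {..<Suc n} (\<lambda>i j. A' i j * D i j)"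
  proof (rule psd_onI)
    fix m :: nat and x :: "nat \<Rightarrow> nat" and c :: "nat \<Rightarrow> complex"
    assume x: "\<And>i. i < m \<Longrightarrow> x i \<in> {..<Suc n}"
    show "hform m c (\<lambda>i j. A' (x i) (x j) * D (x i) (x j)) \<in> \<real>\<^sub>\<ge>\<^sub>0"
    proof (cases "n = 0")
      case True
      then have "A' (x i) (x j) = 0" if "i < m" "j < m" for i j
        using x[OF that(1)] x[OF that(2)] A'n(1)[of 0] by auto
      then have "hform m c (\<lambda>i j. A' (x i) (x j) * D (x i) (x j)) = 0"
        unfolding hform_def by simp
      then show ?thesis by simp
    next
      case False
      \<comment> \<open>Row and column \<open>n\<close> of \<open>A'\<close> vanish, so points equal
        to \<open>n\<close> may get weight \<open>0\<close> and be moved to the dummy index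
        \<open>0\<close>, which lies below \<open>n\<close> in this case.\<close>
      define c' where "c' = (\<lambda>i. if x i = n then 0 else c i)"
      define x' where "x' = (\<lambda>i. if x i = n then 0 else x i)"
      have "hform m c (\<lambda>i j. A' (x i) (x j) * D (x i) (x j))
        = hform m c' (\<lambda>i j. A' (x' i) (x' j) * D (x' i) (x' j))"
        unfolding hform_def using x A'n by (intro sum.cong refl) (auto simp: c'_def x'_def)
      moreover have "x' i \<in> {..<n}" if "i < m" for i
        using x[OF that] False by (auto simp: x'_def)
      ultimately show ?thesis using psd_onD[OF IH, of m x' c'] by auto
    qed
  qed
  have 2: "psd_on {..<Suc n} (\<lambda>i j. of_real (1 / Re (A n n)) * (A i n * cnj (A j n) * D i j))"
    by (intro psd_on_scale psd_on_congruence Suc.prems(2)) (use nn(2) in auto)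
  show ?case
  proof (rule psd_on_cong[OF psd_on_add[OF 1 2]])
    fix i j assume "i \<in> {..<Suc n}" "j \<in> {..<Suc n}"
    then have h: "cnj (A j n) = A n j" using herm[of j n] by simp
    have r: "of_real (1 / Re (A n n)) = 1 / A n n" using nn(1) by (metis of_real_1 of_real_divide)
    show "A' i j * D i j + of_real (1 / Re (A n n)) * (A i n * cnj (A j n) * D i j) = A i j * D i j"
      unfolding h r A'_def by (simp add: algebra_simps)
  qed
qed

theorem Schur_product:
  assumes "psd_on S k" "psd_on S l"
  shows "psd_on S (\<lambda>x y. k x y * l x y)"
proof (rule psd_onI)
  fix n :: nat and x c assume x: "\<And>i. i < n \<Longrightarrow> x i \<in> S"
  have "psd_on {..<n} (\<lambda>i j. k (x i) (x j) * l (x i) (x j))"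
    by (intro Schur_product_finite psd_on_compose[OF assms(1)] psd_on_compose[OF assms(2)]) (use x in auto)
  from psd_onD[OF this, of n "\<lambda>i. i" c]
  show "hform n c (\<lambda>i j. k (x i) (x j) * l (x i) (x j)) \<in> \<real>\<^sub>\<ge>\<^sub>0" by simp
qed

lemma psd_on_power:
  assumes "psd_on S k"
  shows "psd_on S (\<lambda>x y. k x y ^ n)"
proof (induction n)
  case 0
  show ?case using psd_on_one by simp
next
  case (Suc n)
  then show ?case using Schur_product[OF assms] by simp
qed

section \<open>Reproducing kernel Hilbert spaces\<close>

text \<open>The bodies copy \<open>Hspace\<close>, \<open>Hnorm\<close> and \<open>Hinner\<close>
  for an arbitrary set and kernel. The Hilbert space theory can thus be developed without the ball,
  and the later transfer is mere unfolding.\<close>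

definition rk_space :: "'a set \<Rightarrow> ('a \<Rightarrow> 'a \<Rightarrow> complex) \<Rightarrow> ('a \<Rightarrow> complex) set" where
  "rk_space X k = {f. (\<forall>z. z \<notin> X \<longrightarrow> f z = 0) \<and>
     (\<exists>C::real. psd_on X (\<lambda>z w. of_real (C\<^sup>2) * k z w - f z * cnj (f w)))}"

definition rk_norm :: "'a set \<Rightarrow> ('a \<Rightarrow> 'a \<Rightarrow> complex) \<Rightarrow> ('a \<Rightarrow> complex) \<Rightarrow> real" where
  "rk_norm X k f = Inf {C. C \<ge> 0 \<and> psd_on X (\<lambda>z w. of_real (C\<^sup>2) * k z w - f z * cnj (f w))}"

definition rk_inner :: "'a set \<Rightarrow> ('a \<Rightarrow> 'a \<Rightarrow> complex) \<Rightarrow> ('a \<Rightarrow> complex) \<Rightarrow> ('a \<Rightarrow> complex) \<Rightarrow> complex" where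
  "rk_inner X k f g = (1/4) * (\<Sum>n<(4::nat). \<i>^n * of_real ((rk_norm X k (\<lambda>z. f z + \<i>^n * g z))\<^sup>2))"

text \<open>A list of pairs \<open>(c, x)\<close> encodes the kernel combination \<open>\<Sum> c k(_, x)\<close>; \<open>ev f v\<close> is the inner
  product of \<open>f\<close> with it.\<close>
definition ev :: "('a \<Rightarrow> complex) \<Rightarrow> (complex \<times> 'a) list \<Rightarrow> complex" where
  "ev f v = (\<Sum>(c, x)\<leftarrow>v. cnj c * f x)"

definition lscale :: "complex \<Rightarrow> (complex \<times> 'a) list \<Rightarrow> (complex \<times> 'a) list" where
  "lscale r v = map (\<lambda>(c, x). (r * c, x)) v"

lemma ev_Nil [simp]: "ev f [] = 0"
  by (simp add: ev_def)

lemma ev_Cons [simp]: "ev f (p # v) = cnj (fst p) * f (snd p) + ev f v"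
  by (simp add: ev_def split_def)

lemma ev_append [simp]: "ev f (v @ w) = ev f v + ev f w"
  by (induction v) simp_all

lemma ev_lscale [simp]: "ev f (lscale r v) = cnj r * ev f v"
  by (induction v) (simp_all add: lscale_def algebra_simps split_def)

lemma ev_add: "ev (\<lambda>z. f z + g z) v = ev f v + ev g v"
  by (induction v) (simp_all add: algebra_simps)

lemma ev_cmult: "ev (\<lambda>z. c * f z) v = c * ev f v"
  by (induction v) (simp_all add: algebra_simps)

lemma ev_zero [simp]: "ev (\<lambda>z. 0) v = 0"
  by (induction v) simp_all

lemma ev_upt: "ev f (map (\<lambda>i. (c i, x i)) [0..<n]) = (\<Sum>i<n. cnj (c i) * f (x i))"
  by (induction n) simp_all

lemma tendsto_ev:
  assumes "\<And>c x. (c, x) \<in> set v \<Longrightarrow> ((\<lambda>n. f n x) \<longlongrightarrow> g x) F"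
  shows "((\<lambda>n. ev (f n) v) \<longlongrightarrow> ev g v) F"
  using assms
proof (induction v)
  case (Cons p v)
  have "((\<lambda>n. f n (snd p)) \<longlongrightarrow> g (snd p)) F" using Cons.prems[of "fst p" "snd p"] by simp
  then show ?case using Cons by (auto intro!: tendsto_intros)
qed simp

locale rkhs =
  fixes X :: "'a set" and k :: "'a \<Rightarrow> 'a \<Rightarrow> complex"
  assumes psd: "psd_on X k"
begin

abbreviation "H \<equiv> rk_space X k"
abbreviation "nrm \<equiv> rk_norm X k"
abbreviation "inn \<equiv> rk_inner X k"
abbreviation V :: "(complex \<times> 'a) list set" where "V \<equiv> lists (UNIV \<times> X)"

definition kern :: "(complex \<times> 'a) list \<Rightarrow> 'a \<Rightarrow> complex" where
  "kern v = (\<lambda>z. if z \<in> X then (\<Sum>(c, x)\<leftarrow>v. c * k z x) else 0)"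

text \<open>This will turn out to be the squared norm of \<open>kern v\<close>
  (\<open>nrm_kern\<close>), but it is available before the norm is understood.\<close>

definition Q :: "(complex \<times> 'a) list \<Rightarrow> real" where
  "Q v = Re (ev (kern v) v)"

lemma kern_off [simp]: "z \<notin> X \<Longrightarrow> kern v z = 0"
  by (simp add: kern_def)

lemma kern_Nil [simp]: "kern [] = (\<lambda>z. 0)"
  by (simp add: kern_def fun_eq_iff)

lemma kern_Cons: "z \<in> X \<Longrightarrow> kern (p # v) z = fst p * k z (snd p) + kern v z"
  by (simp add: kern_def split_def)

lemma kern_append: "kern (v @ w) z = kern v z + kern w z"
  by (simp add: kern_def)

lemma kern_lscale: "kern (lscale r v) z = r * kern v z"
  by (induction v) (auto simp: lscale_def kern_def algebra_simps split_def)

lemma lscale_V [simp]: "v \<in> V \<Longrightarrow> lscale r v \<in> V"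
  by (auto simp: lscale_def)

lemma k_herm: "x \<in> X \<Longrightarrow> y \<in> X \<Longrightarrow> k y x = cnj (k x y)"
  by (rule psd_on_hermitian[OF psd])

lemma ev_kern_herm:
  assumes "v \<in> V" "w \<in> V"
  shows "ev (kern w) v = cnj (ev (kern v) w)"
proof -
  have one: "kern w x = cnj (ev (\<lambda>z. k z x) w)" if "x \<in> X" for x
    using assms(2) by (induction w) (auto simp: kern_Cons that k_herm[of _ x])
  have two: "ev (kern (p # v)) w = fst p * ev (\<lambda>z. k z (snd p)) w + ev (kern v) w"
    if "p \<in> UNIV \<times> X" for p v
    using assms(2) by (induction w) (auto simp: kern_Cons algebra_simps)
  show ?thesis using assms(1)
    by (induction v) (auto simp: two one)
qed

lemma ev_kern_upt:
  fixes c :: "nat \<Rightarrow> complex"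
  assumes "\<And>i. i < n \<Longrightarrow> x i \<in> X"
  defines "v \<equiv> map (\<lambda>i. (c i, x i)) [0..<n]"
  shows "ev (kern v) v = hform n c (\<lambda>i j. k (x i) (x j))"
proof -
  have "kern v z = (\<Sum>j<n. c j * k z (x j))" if "z \<in> X" for z
    using that by (simp add: v_def kern_def comp_def interv_sum_list_conv_sum_set_nat atLeast0LessThan)
  then show ?thesis unfolding hform_def using assms(1)
    by (subst v_def, subst ev_upt) (simp add: sum_distrib_left mult.assoc)
qed

lemma list_as_upt: "v = map (\<lambda>i. (fst (v ! i), snd (v ! i))) [0..<length v]"
  by (simp add: map_nth)

lemma V_nth: "v \<in> V \<Longrightarrow> i < length v \<Longrightarrow> snd (v ! i) \<in> X"
  by (metis lists_UNIV mem_Sigma_iff prod.collapse nth_mem in_lists_conv_set)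

lemma ev_kern_self:
  assumes "v \<in> V"
  shows "ev (kern v) v \<in> \<real>\<^sub>\<ge>\<^sub>0"
proof -
  have "ev (kern v) v = hform (length v) (\<lambda>i. fst (v ! i)) (\<lambda>i j. k (snd (v ! i)) (snd (v ! j)))"
    using ev_kern_upt[of "length v" "\<lambda>i. snd (v ! i)" "\<lambda>i. fst (v ! i)"] V_nth[OF assms]
    by (simp add: map_nth)
  then show ?thesis using psd_onD[OF psd, of "length v"] V_nth[OF assms] by simp
qed

lemma ev_kern_Q: "v \<in> V \<Longrightarrow> ev (kern v) v = of_real (Q v)"
  using ev_kern_self[of v] by (auto simp: Q_def complex_nonneg_Reals_iff complex_eq_iff)

lemma Q_nonneg: "v \<in> V \<Longrightarrow> 0 \<le> Q v"
  using ev_kern_self[of v] by (auto simp: Q_def complex_nonneg_Reals_iff)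

lemma Q_Nil [simp]: "Q [] = 0"
  by (simp add: Q_def)

lemma Q_append:
  assumes "v \<in> V" "w \<in> V"
  shows "Q (v @ w) = Q v + 2 * Re (ev (kern v) w) + Q w"
  using ev_kern_herm[OF assms] by (simp add: Q_def kern_append[abs_def] ev_add)

lemma Q_lscale: "v \<in> V \<Longrightarrow> Q (lscale r v) = (cmod r)\<^sup>2 * Q v"
proof -
  assume v: "v \<in> V"
  have "ev (kern (lscale r v)) (lscale r v) = of_real ((cmod r)\<^sup>2 * Q v)"
    by (simp add: kern_lscale[abs_def] ev_cmult ev_kern_Q[OF v] complex_norm_square mult_ac del: of_real_power)
  then show ?thesis by (simp add: Q_def del: of_real_power of_real_mult)
qed

text \<open>Aronszajn's domination condition is a Cauchy-Schwarz inequality in disguise: it says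
  that pairing \<open>f\<close> with kernel combinations is bounded by \<open>C\<close> times their
  norm.\<close>

lemma bound_iff:
  "psd_on X (\<lambda>z w. of_real (C\<^sup>2) * k z w - f z * cnj (f w)) \<longleftrightarrow>
    (\<forall>v\<in>V. (cmod (ev f v))\<^sup>2 \<le> C\<^sup>2 * Q v)" (is "?L = ?R")
proof -
  have eq: "hform n c (\<lambda>i j. of_real (C\<^sup>2) * k (x i) (x j) - f (x i) * cnj (f (x j)))
     = of_real (C\<^sup>2 * Q v - (cmod (ev f v))\<^sup>2)"
    if v: "v = map (\<lambda>i. (c i, x i)) [0..<n]" and "\<And>i. i < n \<Longrightarrow> x i \<in> X" for n c x v
  proof -
    have "v \<in> V" using that by (auto simp: v)
    then have "hform n c (\<lambda>i j. k (x i) (x j)) = of_real (Q v)"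
      using ev_kern_upt[of n x c] that by (simp add: ev_kern_Q)
    then show ?thesis
      by (simp add: hform_diff hform_scale hform_rank_one v ev_upt)
  qed
  show ?thesis
  proof
    assume ?L
    show ?R
    proof
      fix v assume v: "v \<in> V"
      have "complex_of_real (C\<^sup>2 * Q v - (cmod (ev f v))\<^sup>2) \<in> \<real>\<^sub>\<ge>\<^sub>0"
        using eq[OF list_as_upt[of v]] psd_onD[OF \<open>?L\<close>, of "length v" "\<lambda>i. snd (v ! i)" "\<lambda>i. fst (v ! i)"] V_nth[OF v]
        by simp
      then show "(cmod (ev f v))\<^sup>2 \<le> C\<^sup>2 * Q v" unfolding nonneg_Reals_of_real_iff by simp
    qed
  next
    assume R: ?R
    show ?L
    proof (rule psd_onI)
      fix n :: nat and x and c :: "nat \<Rightarrow> complex" assume x: "\<And>i. i < n \<Longrightarrow> x i \<in> X"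
      let ?v = "map (\<lambda>i. (c i, x i)) [0..<n]"
      have "?v \<in> V" using x by auto
      then have "0 \<le> C\<^sup>2 * Q ?v - (cmod (ev f ?v))\<^sup>2" using R by auto
      moreover have "hform n c (\<lambda>i j. of_real (C\<^sup>2) * k (x i) (x j) - f (x i) * cnj (f (x j)))
          = of_real (C\<^sup>2 * Q ?v - (cmod (ev f ?v))\<^sup>2)"
        by (rule eq[OF refl]) (rule x)
      ultimately show "hform n c (\<lambda>i j. of_real (C\<^sup>2) * k (x i) (x j) - f (x i) * cnj (f (x j))) \<in> \<real>\<^sub>\<ge>\<^sub>0"
        by (simp only: nonneg_Reals_of_real_iff)
    qed
  qed
qed

lemma bound_iff':
  assumes "C \<ge> 0"
  shows "psd_on X (\<lambda>z w. of_real (C\<^sup>2) * k z w - f z * cnj (f w)) \<longleftrightarrow>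
    (\<forall>v\<in>V. cmod (ev f v) \<le> C * sqrt (Q v))"
proof -
  have "(cmod (ev f v))\<^sup>2 \<le> C\<^sup>2 * Q v \<longleftrightarrow> cmod (ev f v) \<le> C * sqrt (Q v)" if "v \<in> V" for v
  proof -
    have "C\<^sup>2 * Q v = (C * sqrt (Q v))\<^sup>2" using Q_nonneg[OF that] by (simp add: power_mult_distrib)
    then show ?thesis using assms Q_nonneg[OF that] by (simp add: power2_le_iff_abs_le)
  qed
  then show ?thesis unfolding bound_iff by blast
qed

lemma H_off: "f \<in> H \<Longrightarrow> z \<notin> X \<Longrightarrow> f z = 0"
  by (simp add: rk_space_def)

lemma nrm_le:
  assumes "\<And>z. z \<notin> X \<Longrightarrow> f z = 0" "C \<ge> 0" "\<And>v. v \<in> V \<Longrightarrow> cmod (ev f v) \<le> C * sqrt (Q v)"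
  shows "f \<in> H" "nrm f \<le> C"
proof -
  have psd: "psd_on X (\<lambda>z w. of_real (C\<^sup>2) * k z w - f z * cnj (f w))"
    using assms(3) unfolding bound_iff'[OF assms(2)] by blast
  then show "f \<in> H" using assms(1) by (auto simp: rk_space_def)
  show "nrm f \<le> C" unfolding rk_norm_def
    by (rule cInf_lower) (use psd assms(2) in auto)
qed

lemma H_bound_ex:
  assumes "f \<in> H"
  obtains C where "C \<ge> 0" "\<forall>v\<in>V. cmod (ev f v) \<le> C * sqrt (Q v)"
proof -
  obtain C where "psd_on X (\<lambda>z w. of_real (C\<^sup>2) * k z w - f z * cnj (f w))"
    using assms by (auto simp: rk_space_def)
  then have "psd_on X (\<lambda>z w. of_real (\<bar>C\<bar>\<^sup>2) * k z w - f z * cnj (f w))" by simp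
  then show ?thesis using that[of "\<bar>C\<bar>"] bound_iff'[of "\<bar>C\<bar>" f] by simp
qed

lemma nrm_set_eq: "nrm f = Inf {C. C \<ge> 0 \<and> (\<forall>v\<in>V. cmod (ev f v) \<le> C * sqrt (Q v))}"
  unfolding rk_norm_def using bound_iff'[of _ f] by (intro arg_cong[of _ _ Inf]) blast

lemma nrm_nonneg: "f \<in> H \<Longrightarrow> 0 \<le> nrm f"
  unfolding nrm_set_eq by (rule cInf_greatest) (auto elim: H_bound_ex simp del: in_lists_conv_set)

lemma ev_le_nrm:
  assumes "f \<in> H" "v \<in> V"
  shows "cmod (ev f v) \<le> nrm f * sqrt (Q v)"
proof (cases "Q v = 0")
  case True
  obtain C where "\<forall>v\<in>V. cmod (ev f v) \<le> C * sqrt (Q v)" using H_bound_ex[OF assms(1)] by blast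
  then have "cmod (ev f v) \<le> C * sqrt (Q v)" using assms(2) by blast
  then show ?thesis using True by simp
next
  case False
  then have q: "sqrt (Q v) > 0" using Q_nonneg[OF assms(2)] by simp
  have "cmod (ev f v) / sqrt (Q v) \<le> nrm f" unfolding nrm_set_eq
  proof (rule cInf_greatest)
    show "{C. C \<ge> 0 \<and> (\<forall>v\<in>V. cmod (ev f v) \<le> C * sqrt (Q v))} \<noteq> {}"
      by (rule H_bound_ex[OF assms(1)]) blast
  next
    fix C assume "C \<in> {C. C \<ge> 0 \<and> (\<forall>v\<in>V. cmod (ev f v) \<le> C * sqrt (Q v))}"
    then have "cmod (ev f v) \<le> C * sqrt (Q v)" using assms(2) by blast
    then show "cmod (ev f v) / sqrt (Q v) \<le> C" using q by (simp add: field_simps)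
  qed
  then show ?thesis using q by (simp add: field_simps)
qed

section \<open>The normed space of functions dominated by the kernel\<close>

lemma H_zero [simp]: "(\<lambda>z. 0) \<in> H"
  by (rule nrm_le(1)[where C=0]) (auto simp del: in_lists_conv_set)

lemma H_add [intro]:
  assumes "f \<in> H" "g \<in> H"
  shows "(\<lambda>z. f z + g z) \<in> H" and nrm_triangle: "nrm (\<lambda>z. f z + g z) \<le> nrm f + nrm g"
proof -
  have "cmod (ev (\<lambda>z. f z + g z) v) \<le> (nrm f + nrm g) * sqrt (Q v)" if "v \<in> V" for v
    using ev_le_nrm[OF assms(1) that] ev_le_nrm[OF assms(2) that] norm_triangle_ineq[of "ev f v" "ev g v"]
    unfolding ev_add by (simp add: distrib_right)
  then show "(\<lambda>z. f z + g z) \<in> H" "nrm (\<lambda>z. f z + g z) \<le> nrm f + nrm g"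
    using nrm_le[of "\<lambda>z. f z + g z" "nrm f + nrm g"] nrm_nonneg[OF assms(1)] nrm_nonneg[OF assms(2)] H_off[OF assms(1)] H_off[OF assms(2)] by simp_all
qed

lemma H_cmult_aux:
  assumes "f \<in> H"
  shows "(\<lambda>z. c * f z) \<in> H" "nrm (\<lambda>z. c * f z) \<le> cmod c * nrm f"
proof -
  have "cmod (ev (\<lambda>z. c * f z) v) \<le> (cmod c * nrm f) * sqrt (Q v)" if "v \<in> V" for v
    using mult_left_mono[OF ev_le_nrm[OF assms(1) that], of "cmod c"]
    unfolding ev_cmult by (simp add: norm_mult mult.assoc)
  then show "(\<lambda>z. c * f z) \<in> H" "nrm (\<lambda>z. c * f z) \<le> cmod c * nrm f"
    using nrm_le[of "\<lambda>z. c * f z" "cmod c * nrm f"] nrm_nonneg[OF assms] H_off[OF assms] by simp_all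
qed

lemma H_cmult [intro]: "f \<in> H \<Longrightarrow> (\<lambda>z. c * f z) \<in> H"
  by (rule H_cmult_aux)

lemma H_uminus [intro]: "f \<in> H \<Longrightarrow> (\<lambda>z. - f z) \<in> H"
  using H_cmult[of f "-1"] by simp

lemma H_diff [intro]: "f \<in> H \<Longrightarrow> g \<in> H \<Longrightarrow> (\<lambda>z. f z - g z) \<in> H"
  using H_add(1)[OF _ H_uminus] by simp

lemma H_sum [intro]: "(\<And>i. i \<in> A \<Longrightarrow> f i \<in> H) \<Longrightarrow> (\<lambda>z. \<Sum>i\<in>A. f i z) \<in> H"
  by (induction A rule: infinite_finite_induct) auto

lemma nrm_zero [simp]: "nrm (\<lambda>z. 0) = 0"
  using H_cmult_aux(2)[OF H_zero, of 0] nrm_nonneg[OF H_zero] by simp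

lemma nrm_cmult:
  assumes "f \<in> H"
  shows "nrm (\<lambda>z. c * f z) = cmod c * nrm f"
proof (cases "c = 0")
  case False
  have "nrm (\<lambda>z. (1 / c) * (c * f z)) \<le> cmod (1 / c) * nrm (\<lambda>z. c * f z)"
    by (intro H_cmult_aux assms)
  then have "nrm f \<le> nrm (\<lambda>z. c * f z) / cmod c" using False by (simp add: norm_divide)
  then have "cmod c * nrm f \<le> nrm (\<lambda>z. c * f z)" using False by (simp add: field_simps)
  then show ?thesis using H_cmult_aux(2)[OF assms, of c] by simp
qed simp

lemma nrm_uminus: "f \<in> H \<Longrightarrow> nrm (\<lambda>z. - f z) = nrm f"
  using nrm_cmult[of f "-1"] by simp

lemma nrm_minus_commute: "f \<in> H \<Longrightarrow> g \<in> H \<Longrightarrow> nrm (\<lambda>z. f z - g z) = nrm (\<lambda>z. g z - f z)"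
  using nrm_uminus[of "\<lambda>z. f z - g z"] H_diff by simp

lemma nrm_triangle_diff: "f \<in> H \<Longrightarrow> g \<in> H \<Longrightarrow> nrm (\<lambda>z. f z - g z) \<le> nrm f + nrm g"
  using nrm_triangle[OF _ H_uminus, of f g] nrm_uminus[of g] by simp

lemma nrm_diff_abs: 
  assumes "f \<in> H" "g \<in> H"
  shows "\<bar>nrm f - nrm g\<bar> \<le> nrm (\<lambda>z. f z - g z)"
proof -
  have "nrm (\<lambda>z. (f z - g z) + g z) \<le> nrm (\<lambda>z. f z - g z) + nrm g"
    by (intro nrm_triangle H_diff assms)
  moreover have "nrm (\<lambda>z. (g z - f z) + f z) \<le> nrm (\<lambda>z. g z - f z) + nrm f"
    by (intro nrm_triangle H_diff assms)
  ultimately show ?thesis using nrm_minus_commute[OF assms] by simp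
qed

lemma nrm_sum_le: "(\<And>i. i \<in> A \<Longrightarrow> f i \<in> H) \<Longrightarrow> nrm (\<lambda>z. \<Sum>i\<in>A. f i z) \<le> (\<Sum>i\<in>A. nrm (f i))"
proof (induction A rule: infinite_finite_induct)
  case (insert i A)
  have "nrm (\<lambda>z. f i z + (\<Sum>i\<in>A. f i z)) \<le> nrm (f i) + nrm (\<lambda>z. \<Sum>i\<in>A. f i z)"
    using insert.prems by (intro nrm_triangle H_sum) auto
  then show ?case using insert by simp
qed simp_all

lemma eval_le:
  assumes "f \<in> H" "z \<in> X"
  shows "cmod (f z) \<le> nrm f * sqrt (Re (k z z))"
proof -
  have "[(1, z)] \<in> V" using assms by simp
  from ev_le_nrm[OF assms(1) this] show ?thesis
    using assms(2) by (simp add: Q_def kern_Cons)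
qed

lemma nrm_eq_0: "f \<in> H \<Longrightarrow> nrm f = 0 \<Longrightarrow> f = (\<lambda>z. 0)"
  using eval_le[of f] H_off[of f] by (auto simp: fun_eq_iff)

text \<open>Together with \<open>variational_ge\<close> this exhibits the squared norm as the
  supremum of \<open>2 * Re (ev f v) - Q v\<close>. Each of these expressions is affine in
  \<open>f\<close> and involves finitely many point values, so it is easier to shift and to pass to
  limits in than the infimum defining the norm.\<close>

lemma variational_le:
  assumes "f \<in> H" "v \<in> V"
  shows "2 * Re (ev f v) - Q v \<le> (nrm f)\<^sup>2"
proof -
  have "Re (ev f v) \<le> nrm f * sqrt (Q v)"
    using ev_le_nrm[OF assms] complex_Re_le_cmod[of "ev f v"] by linarith
  moreover have "0 \<le> (nrm f - sqrt (Q v))\<^sup>2" by simp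
  ultimately show ?thesis using Q_nonneg[OF assms(2)] by (simp add: power2_diff)
qed

lemma variational_ge:
  assumes "\<And>z. z \<notin> X \<Longrightarrow> f z = 0" and le: "\<And>v. v \<in> V \<Longrightarrow> 2 * Re (ev f v) - Q v \<le> R"
  shows "f \<in> H" "(nrm f)\<^sup>2 \<le> R"
proof -
  have R: "R \<ge> 0" using le[of "[]"] by simp
  have main: "cmod (ev f v) \<le> sqrt R * sqrt (Q v)" if v: "v \<in> V" for v
  proof -
    define m where "m = cmod (ev f v)"
    have tt: "2 * t * m - t\<^sup>2 * Q v \<le> R" for t :: real
    proof (cases "m = 0")
      case True
      have "0 \<le> t\<^sup>2 * Q v" using Q_nonneg[OF v] by simp
      then show ?thesis using True R by simp
    next
      case False
      \<comment> \<open>\<open>u\<close> has modulus \<open>|t|\<close> and, up to the sign of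
        \<open>t\<close>, the phase of \<open>ev f v\<close>. Scaling \<open>v\<close> by it turns
        the hypothesis into a quadratic inequality in the real variable \<open>t\<close>.\<close>
      define u where "u = of_real t * (ev f v / of_real m)"
      have cu: "cmod u = \<bar>t\<bar>" using False by (simp add: u_def norm_mult norm_divide m_def)
      have "cnj (ev f v) * ev f v = of_real (m\<^sup>2)" unfolding m_def complex_norm_square by simp
      then have "cnj u * ev f v = of_real (t * m)"
        using False by (simp add: u_def power2_eq_square mult.assoc)
      then have "Re (ev f (lscale u v)) = t * m" by simp
      moreover have "Q (lscale u v) = t\<^sup>2 * Q v" by (simp add: Q_lscale[OF v] cu)
      ultimately show ?thesis using le[OF lscale_V[OF v, of u]] by simp
    qed
    have "m\<^sup>2 \<le> R * Q v"
    proof (cases "Q v = 0")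
      case True
      have "m = 0"
      proof (rule ccontr)
        assume "m \<noteq> 0"
        then have "m > 0" by (simp add: m_def)
        then show False using tt[of "(R + 1) / m"] True R by simp
      qed
      then show ?thesis using True by simp
    next
      case False
      then have q: "Q v > 0" using Q_nonneg[OF v] by simp
      have "2 * (m / Q v) * m - (m / Q v)\<^sup>2 * Q v = m\<^sup>2 / Q v"
        using q by (simp add: power2_eq_square field_simps)
      then have "m\<^sup>2 / Q v \<le> R" using tt[of "m / Q v"] by simp
      then show ?thesis using q by (simp add: field_simps)
    qed
    then have "sqrt (m\<^sup>2) \<le> sqrt (R * Q v)" by (rule real_sqrt_le_mono)
    then show ?thesis by (simp add: m_def real_sqrt_mult)
  qed
  show fH: "f \<in> H" by (rule nrm_le(1)[OF assms(1) _ main]) (use R in auto)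
  have "nrm f \<le> sqrt R" by (rule nrm_le(2)[OF assms(1) _ main]) (use R in auto)
  then have "(nrm f)\<^sup>2 \<le> (sqrt R)\<^sup>2" using nrm_nonneg[OF fH] by (intro power_mono) auto
  then show "(nrm f)\<^sup>2 \<le> R" using R by simp
qed

text \<open>In the variational formula, testing \<open>f + kern v\<close> with \<open>w\<close>
  amounts to testing \<open>f\<close> with \<open>w - v\<close>, up to the terms on the
  right.\<close>

lemma nrm_add_kern_le:
  assumes f: "f \<in> H" and v: "v \<in> V"
  shows "(\<lambda>z. f z + kern v z) \<in> H" "(nrm (\<lambda>z. f z + kern v z))\<^sup>2 \<le> (nrm f)\<^sup>2 + 2 * Re (ev f v) + Q v"
proof -
  have "2 * Re (ev (\<lambda>z. f z + kern v z) w) - Q w \<le> (nrm f)\<^sup>2 + 2 * Re (ev f v) + Q v" if w: "w \<in> V" for w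
  proof -
    have "w @ lscale (-1) v \<in> V" using v w by (auto simp: lscale_def)
    from variational_le[OF f this]
    have "2 * Re (ev f w - ev f v) - (Q w + 2 * Re (ev (kern w) (lscale (-1) v)) + Q v) \<le> (nrm f)\<^sup>2"
      by (simp add: Q_append[OF w lscale_V[OF v]] Q_lscale[OF v])
    then show ?thesis using ev_kern_herm[OF v w] by (simp add: ev_add)
  qed
  then show "(\<lambda>z. f z + kern v z) \<in> H" "(nrm (\<lambda>z. f z + kern v z))\<^sup>2 \<le> (nrm f)\<^sup>2 + 2 * Re (ev f v) + Q v"
    using variational_ge[of "\<lambda>z. f z + kern v z"] H_off[OF f] by auto
qed

text \<open>The reverse estimate comes from applying the inequality to \<open>f + kern v\<close> and
  \<open>- v\<close>, which leads back to \<open>f\<close>.\<close>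

lemma nrm_add_kern:
  assumes f: "f \<in> H" and v: "v \<in> V"
  shows "(nrm (\<lambda>z. f z + kern v z))\<^sup>2 = (nrm f)\<^sup>2 + 2 * Re (ev f v) + Q v"
proof -
  let ?g = "\<lambda>z. f z + kern v z"
  have "(nrm (\<lambda>z. ?g z + kern (lscale (-1) v) z))\<^sup>2 \<le> (nrm ?g)\<^sup>2 + 2 * Re (ev ?g (lscale (-1) v)) + Q (lscale (-1) v)"
    by (intro nrm_add_kern_le assms lscale_V)
  then have "(nrm f)\<^sup>2 \<le> (nrm ?g)\<^sup>2 - 2 * Re (ev f v + ev (kern v) v) + Q v"
    by (simp add: kern_lscale Q_lscale[OF v] ev_add)
  then show ?thesis using nrm_add_kern_le(2)[OF assms] by (simp add: Q_def)
qed

lemma kern_H [intro]: "v \<in> V \<Longrightarrow> kern v \<in> H"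
  using nrm_add_kern_le(1)[OF H_zero, of v] by simp

lemma nrm_kern: "v \<in> V \<Longrightarrow> (nrm (kern v))\<^sup>2 = Q v"
  using nrm_add_kern[OF H_zero, of v] by simp

text \<open>By \<open>nrm_add_kern\<close>, the squared distance from \<open>f\<close> to
  \<open>kern v\<close> is exactly the gap left by \<open>v\<close> in the variational formula, so a
  near-maximiser is automatically near in norm.\<close>

lemma kern_dense:
  assumes f: "f \<in> H" and e: "e > 0"
  obtains v where "v \<in> V" "nrm (\<lambda>z. f z - kern v z) < e"
proof -
  have "\<exists>v\<in>V. (nrm f)\<^sup>2 - e\<^sup>2 < 2 * Re (ev f v) - Q v"
  proof (rule ccontr)
    assume "\<not> ?thesis"
    then have "(nrm f)\<^sup>2 \<le> (nrm f)\<^sup>2 - e\<^sup>2"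
      by (intro variational_ge(2) H_off[OF f]) (auto simp: not_less simp del: in_lists_conv_set)
    then show False using e by simp
  qed
  then obtain v where v: "v \<in> V" "(nrm f)\<^sup>2 - e\<^sup>2 < 2 * Re (ev f v) - Q v" by blast
  have "(nrm (\<lambda>z. f z + kern (lscale (-1) v) z))\<^sup>2 = (nrm f)\<^sup>2 - 2 * Re (ev f v) + Q v"
    by (subst nrm_add_kern[OF f lscale_V[OF v(1)]]) (simp add: Q_lscale[OF v(1)])
  then have "(nrm (\<lambda>z. f z - kern v z))\<^sup>2 < e\<^sup>2" using v(2) by (simp add: kern_lscale)
  then have "nrm (\<lambda>z. f z - kern v z) < e" using e by (simp add: power_less_imp_less_base)
  with v(1) show ?thesis by (rule that)
qed

lemma inn_expand: "inn f g = (1/4) * (of_real ((nrm (\<lambda>z. f z + g z))\<^sup>2) + \<i> * of_real ((nrm (\<lambda>z. f z + \<i> * g z))\<^sup>2)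
   - of_real ((nrm (\<lambda>z. f z - g z))\<^sup>2) - \<i> * of_real ((nrm (\<lambda>z. f z - \<i> * g z))\<^sup>2))"
proof -
  have "{..<4::nat} = {0,1,2,3}" by auto
  then show ?thesis by (simp add: rk_inner_def power3_eq_cube algebra_simps)
qed

text \<open>The four norms in the polarization are known exactly from \<open>nrm_add_kern\<close>,
  so the reproducing property can be computed before \<open>inn\<close> is known to be
  sesquilinear.\<close>

lemma inn_kern:
  assumes f: "f \<in> H" and v: "v \<in> V"
  shows "inn f (kern v) = ev f v"
proof -
  have *: "(nrm (\<lambda>z. f z + r * kern v z))\<^sup>2 = (nrm f)\<^sup>2 + 2 * Re (cnj r * ev f v) + (cmod r)\<^sup>2 * Q v" for r
    using nrm_add_kern[OF f lscale_V[OF v, of r]] by (simp add: kern_lscale Q_lscale[OF v])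
  show ?thesis
    using *[of 1] *[of "-1"] *[of \<i>] *[of "-\<i>"]
    by (simp add: inn_expand complex_eq_iff)
qed

text \<open>The last conclusion is the purpose: \<open>ev f (v n)\<close> is visibly linear in
  \<open>f\<close>, and its limit \<open>inn f g\<close> inherits linearity. No parallelogram
  argument is needed to make sense of the polarization.\<close>

lemma kern_approx:
  assumes g: "g \<in> H"
  obtains v :: "nat \<Rightarrow> _" where "\<And>n. v n \<in> V" "(\<lambda>n. nrm (\<lambda>z. g z - kern (v n) z)) \<longlonglongrightarrow> 0"
    "(\<lambda>n. nrm (kern (v n))) \<longlonglongrightarrow> nrm g" "\<And>f. f \<in> H \<Longrightarrow> (\<lambda>n. ev f (v n)) \<longlonglongrightarrow> inn f g"
proof -
  have "\<forall>n. \<exists>v. v \<in> V \<and> nrm (\<lambda>z. g z - kern v z) < inverse (real (Suc n))"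
    using kern_dense[OF g] by (metis inverse_positive_iff_positive of_nat_0_less_iff zero_less_Suc)
  then obtain v where v: "\<And>n. v n \<in> V" "\<And>n. nrm (\<lambda>z. g z - kern (v n) z) < inverse (real (Suc n))"
    by metis
  have lim: "(\<lambda>n. nrm (\<lambda>z. g z - kern (v n) z)) \<longlonglongrightarrow> 0"
    by (rule tendsto_sandwich[OF _ _ tendsto_const LIMSEQ_inverse_real_of_nat])
      (intro always_eventually allI nrm_nonneg H_diff g kern_H v(1) less_imp_le v(2))+
  have gen: "(\<lambda>n. nrm (\<lambda>z. f z + r * kern (v n) z)) \<longlonglongrightarrow> nrm (\<lambda>z. f z + r * g z)" if f: "f \<in> H" for f r
  proof -
    have le: "\<bar>nrm (\<lambda>z. f z + r * kern (v n) z) - nrm (\<lambda>z. f z + r * g z)\<bar> \<le> cmod r * nrm (\<lambda>z. g z - kern (v n) z)" for n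
    proof -
      have "\<bar>nrm (\<lambda>z. f z + r * kern (v n) z) - nrm (\<lambda>z. f z + r * g z)\<bar>
        \<le> nrm (\<lambda>z. (f z + r * kern (v n) z) - (f z + r * g z))"
        by (intro nrm_diff_abs H_add H_cmult kern_H v f g)
      also have "\<dots> = nrm (\<lambda>z. (- r) * (g z - kern (v n) z))"
        by (simp add: algebra_simps)
      also have "\<dots> = cmod r * nrm (\<lambda>z. g z - kern (v n) z)"
        by (subst nrm_cmult) (auto intro!: H_diff kern_H v g simp del: in_lists_conv_set)
      finally show ?thesis .
    qed
    have "(\<lambda>n. nrm (\<lambda>z. f z + r * kern (v n) z) - nrm (\<lambda>z. f z + r * g z)) \<longlonglongrightarrow> 0"
      by (rule Lim_null_comparison[OF _ tendsto_mult_right_zero[OF lim, of "cmod r"]])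
        (use le in auto)
    then show ?thesis by (simp add: LIM_zero_iff)
  qed
  have ev: "(\<lambda>n. ev f (v n)) \<longlonglongrightarrow> inn f g" if f: "f \<in> H" for f
  proof -
    have "(\<lambda>n. inn f (kern (v n))) \<longlonglongrightarrow> inn f g"
      unfolding rk_inner_def by (intro tendsto_intros gen f)
    then show ?thesis using inn_kern[OF f v(1)] by simp
  qed
  show ?thesis
    using that[of v] v(1) lim gen[OF H_zero, of 1] ev by simp
qed

lemma inn_add_left:
  assumes "f \<in> H" "f' \<in> H" "g \<in> H"
  shows "inn (\<lambda>z. f z + f' z) g = inn f g + inn f' g"
proof -
  obtain v where v: "\<And>f. f \<in> H \<Longrightarrow> (\<lambda>n::nat. ev f (v n)) \<longlonglongrightarrow> inn f g"
    by (rule kern_approx[OF assms(3)]) (rule that)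
  have "(\<lambda>n. ev (\<lambda>z. f z + f' z) (v n)) \<longlonglongrightarrow> inn (\<lambda>z. f z + f' z) g" by (intro v H_add assms)
  moreover have "(\<lambda>n. ev f (v n) + ev f' (v n)) \<longlonglongrightarrow> inn f g + inn f' g" by (intro tendsto_add v assms)
  ultimately show ?thesis unfolding ev_add by (rule LIMSEQ_unique)
qed

lemma inn_cmult_left:
  assumes "f \<in> H" "g \<in> H"
  shows "inn (\<lambda>z. c * f z) g = c * inn f g"
proof -
  obtain v where v: "\<And>f. f \<in> H \<Longrightarrow> (\<lambda>n::nat. ev f (v n)) \<longlonglongrightarrow> inn f g"
    by (rule kern_approx[OF assms(2)]) (rule that)
  have "(\<lambda>n. ev (\<lambda>z. c * f z) (v n)) \<longlonglongrightarrow> inn (\<lambda>z. c * f z) g" by (intro v H_cmult assms)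
  moreover have "(\<lambda>n. c * ev f (v n)) \<longlonglongrightarrow> c * inn f g" by (intro tendsto_mult_left v assms)
  ultimately show ?thesis unfolding ev_cmult by (rule LIMSEQ_unique)
qed

lemma inn_cnj:
  assumes "f \<in> H" "g \<in> H"
  shows "inn g f = cnj (inn f g)"
proof -
  have "nrm (\<lambda>z. g z + \<i> * f z) = nrm (\<lambda>z. \<i> * (f z - \<i> * g z))" by (simp add: algebra_simps)
  also have "\<dots> = nrm (\<lambda>z. f z - \<i> * g z)" by (subst nrm_cmult) (auto intro!: assms)
  finally have 1: "nrm (\<lambda>z. g z + \<i> * f z) = nrm (\<lambda>z. f z - \<i> * g z)" .
  have "nrm (\<lambda>z. g z - \<i> * f z) = nrm (\<lambda>z. (-\<i>) * (f z + \<i> * g z))" by (simp add: algebra_simps)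
  also have "\<dots> = nrm (\<lambda>z. f z + \<i> * g z)" by (subst nrm_cmult) (auto intro!: assms)
  finally have 2: "nrm (\<lambda>z. g z - \<i> * f z) = nrm (\<lambda>z. f z + \<i> * g z)" .
  show ?thesis unfolding inn_expand 1 2 nrm_minus_commute[OF assms]
    by (simp add: algebra_simps)
qed

lemma inn_self:
  assumes "f \<in> H"
  shows "inn f f = of_real ((nrm f)\<^sup>2)"
proof -
  have *: "nrm (\<lambda>z. f z + r * f z) = cmod (1 + r) * nrm f" for r
    using nrm_cmult[OF assms, of "1 + r"] by (simp add: algebra_simps)
  have "cmod (1 + \<i>) = sqrt 2" "cmod (1 - \<i>) = sqrt 2" by (simp_all add: cmod_def)
  then show ?thesis
    using *[of 1] *[of "-1"] *[of \<i>] *[of "-\<i>"]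
    by (simp add: inn_expand power_mult_distrib)
qed

lemma inn_le:
  assumes "f \<in> H" "g \<in> H"
  shows "cmod (inn f g) \<le> nrm f * nrm g"
proof -
  obtain v where v: "\<And>n::nat. v n \<in> V" "(\<lambda>n. nrm (kern (v n))) \<longlonglongrightarrow> nrm g"
    "\<And>f. f \<in> H \<Longrightarrow> (\<lambda>n. ev f (v n)) \<longlonglongrightarrow> inn f g"
    by (rule kern_approx[OF assms(2)]) (rule that)
  have "cmod (ev f (v n)) \<le> nrm f * nrm (kern (v n))" for n
    using ev_le_nrm[OF assms(1) v(1)[of n]] nrm_kern[OF v(1)[of n]] nrm_nonneg[OF kern_H[OF v(1)[of n]]]
    by (metis abs_of_nonneg real_sqrt_abs)
  then show ?thesis
    by (intro LIMSEQ_le[OF tendsto_norm[OF v(3)[OF assms(1)]] tendsto_mult_left[OF v(2)]]) auto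
qed

lemma inn_add_right:
  assumes "f \<in> H" "g \<in> H" "g' \<in> H"
  shows "inn f (\<lambda>z. g z + g' z) = inn f g + inn f g'"
  unfolding inn_cnj[OF H_add(1)[OF assms(2,3)] assms(1)] inn_cnj[OF assms(2,1)] inn_cnj[OF assms(3,1)]
    inn_add_left[OF assms(2,3,1)] by simp

lemma inn_cmult_right:
  assumes "f \<in> H" "g \<in> H"
  shows "inn f (\<lambda>z. c * g z) = cnj c * inn f g"
  unfolding inn_cnj[OF H_cmult[OF assms(2)] assms(1)] inn_cnj[OF assms(2,1)] inn_cmult_left[OF assms(2,1)] by simp

lemma inn_diff_left: "f \<in> H \<Longrightarrow> f' \<in> H \<Longrightarrow> g \<in> H \<Longrightarrow> inn (\<lambda>z. f z - f' z) g = inn f g - inn f' g"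
  using inn_add_left[of f "\<lambda>z. (-1) * f' z" g] inn_cmult_left[of f' g "-1"] H_cmult[of f' "-1"] by simp

lemma inn_diff_right: "f \<in> H \<Longrightarrow> g \<in> H \<Longrightarrow> g' \<in> H \<Longrightarrow> inn f (\<lambda>z. g z - g' z) = inn f g - inn f g'"
  using inn_add_right[of f g "\<lambda>z. (-1) * g' z"] inn_cmult_right[of f g' "-1"] H_cmult[of g' "-1"] by simp

lemma inn_zero_left [simp]: "g \<in> H \<Longrightarrow> inn (\<lambda>z. 0) g = 0"
  using inn_cmult_left[OF H_zero, of g 0] by simp

lemma inn_sum_left:
  "(\<And>i. i \<in> A \<Longrightarrow> f i \<in> H) \<Longrightarrow> g \<in> H \<Longrightarrow> inn (\<lambda>z. \<Sum>i\<in>A. f i z) g = (\<Sum>i\<in>A. inn (f i) g)"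
  by (induction A rule: infinite_finite_induct) (simp_all add: inn_add_left H_sum)

lemma inn_sum_right:
  assumes "\<And>i. i \<in> A \<Longrightarrow> f i \<in> H" "g \<in> H"
  shows "inn g (\<lambda>z. \<Sum>i\<in>A. f i z) = (\<Sum>i\<in>A. inn g (f i))"
  using assms by (simp add: inn_cnj[of _ g] H_sum inn_sum_left cnj_sum)

lemma nrm_add_sq:
  assumes "f \<in> H" "g \<in> H"
  shows "(nrm (\<lambda>z. f z + g z))\<^sup>2 = (nrm f)\<^sup>2 + 2 * Re (inn f g) + (nrm g)\<^sup>2"
proof -
  have "inn (\<lambda>z. f z + g z) (\<lambda>z. f z + g z) = inn f f + inn f g + (inn g f + inn g g)"
    using assms by (simp add: inn_add_left inn_add_right H_add)
  then have "of_real ((nrm (\<lambda>z. f z + g z))\<^sup>2) = of_real ((nrm f)\<^sup>2) + inn f g + (cnj (inn f g) + of_real ((nrm g)\<^sup>2))"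
    using assms by (simp only: inn_self H_add inn_cnj[of f g])
  from arg_cong[OF this, of Re] show ?thesis by simp
qed

lemma nrm_diff_sq:
  assumes "f \<in> H" "g \<in> H"
  shows "(nrm (\<lambda>z. f z - g z))\<^sup>2 = (nrm f)\<^sup>2 - 2 * Re (inn f g) + (nrm g)\<^sup>2"
  using nrm_add_sq[OF assms(1) H_uminus[OF assms(2)]] inn_cmult_right[OF assms, of "-1"] nrm_uminus[OF assms(2)] by simp

text \<open>The indices in \<open>inn (h j) (h i)\<close> are transposed because \<open>inn\<close>
  is linear in its first argument while \<open>hform\<close> conjugates the coefficient of the first
  index.\<close>

lemma Gram_psd:
  assumes "\<And>i. h i \<in> H"
  shows "psd_on S (\<lambda>i j. inn (h j) (h i))"
proof (rule psd_onI)
  fix n and x :: "nat \<Rightarrow> _" and c :: "nat \<Rightarrow> complex"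
  have "hform n c (\<lambda>i j. inn (h (x j)) (h (x i))) = inn (\<lambda>z. \<Sum>j<n. c j * h (x j) z) (\<lambda>z. \<Sum>i<n. c i * h (x i) z)"
    using assms by (simp add: hform_def inn_sum_left inn_sum_right H_sum H_cmult inn_cmult_left inn_cmult_right
        sum_distrib_left mult.assoc mult.left_commute)
      (subst sum.swap, simp)
  also have "\<dots> = of_real ((nrm (\<lambda>z. \<Sum>j<n. c j * h (x j) z))\<^sup>2)"
    by (intro inn_self H_sum H_cmult assms)
  finally show "hform n c (\<lambda>i j. inn (h (x j)) (h (x i))) \<in> \<real>\<^sub>\<ge>\<^sub>0"
    by (simp del: of_real_power)
qed

text \<open>A norm bound is a family of inequalities, each about finitely many point values, so
  pointwise convergence preserves it. This is the substitute for weak compactness of balls.\<close>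

lemma H_pointwise_limit:
  assumes "\<And>n::nat. f n \<in> H" "\<And>n. nrm (f n) \<le> C" "\<And>z. z \<in> X \<Longrightarrow> (\<lambda>n. f n z) \<longlonglongrightarrow> g z"
    "\<And>z. z \<notin> X \<Longrightarrow> g z = 0"
  shows "g \<in> H" "nrm g \<le> C"
proof -
  have C: "C \<ge> 0" using nrm_nonneg[OF assms(1)] assms(2) by (meson order_trans)
  have "cmod (ev g v) \<le> C * sqrt (Q v)" if v: "v \<in> V" for v
  proof (rule LIMSEQ_le_const2)
    show "(\<lambda>n. cmod (ev (f n) v)) \<longlonglongrightarrow> cmod (ev g v)"
      using v by (intro tendsto_norm tendsto_ev assms(3)) (auto simp: in_lists_conv_set)
    show "\<exists>N. \<forall>n\<ge>N. cmod (ev (f n) v) \<le> C * sqrt (Q v)"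
      using ev_le_nrm[OF assms(1) v] mult_right_mono[OF assms(2), of "sqrt (Q v)"] Q_nonneg[OF v]
      by (meson order_trans real_sqrt_ge_zero)
  qed
  then show "g \<in> H" "nrm g \<le> C" using nrm_le[of g C] assms(4) C by blast+
qed

section \<open>Completeness and orthogonal projection\<close>

lemma H_complete:
  assumes f: "\<And>n::nat. f n \<in> H" and Cau: "\<And>e. e > 0 \<Longrightarrow> \<exists>N. \<forall>m\<ge>N. \<forall>n\<ge>N. nrm (\<lambda>z. f m z - f n z) < e"
  obtains g where "g \<in> H" "(\<lambda>n. nrm (\<lambda>z. f n z - g z)) \<longlonglongrightarrow> 0" "\<And>z. (\<lambda>n. f n z) \<longlonglongrightarrow> g z"
proof -
  have "Cauchy (\<lambda>n. f n z)" for z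
  proof (cases "z \<in> X")
    case True
    show ?thesis
    proof (rule metric_CauchyI)
      fix e :: real assume e: "e > 0"
      let ?K = "sqrt (Re (k z z)) + 1"
      have K: "?K > 0" using psd_on_diag(2)[OF psd True] by (simp add: add_nonneg_pos)
      obtain N where N: "\<forall>m\<ge>N. \<forall>n\<ge>N. nrm (\<lambda>z. f m z - f n z) < e / ?K" using Cau[of "e / ?K"] e K by auto
      have "dist (f m z) (f n z) < e" if "m \<ge> N" "n \<ge> N" for m n
      proof -
        have "dist (f m z) (f n z) \<le> nrm (\<lambda>z. f m z - f n z) * sqrt (Re (k z z))"
          using eval_le[OF H_diff[OF f f] True] by (simp add: dist_norm)
        also have "\<dots> \<le> nrm (\<lambda>z. f m z - f n z) * ?K"
          using nrm_nonneg[OF H_diff[OF f f], of m n] by (intro mult_left_mono) auto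
        also have "\<dots> < e / ?K * ?K" using N that K by (intro mult_strict_right_mono) auto
        finally show ?thesis using K by simp
      qed
      then show "\<exists>M. \<forall>m\<ge>M. \<forall>n\<ge>M. dist (f m z) (f n z) < e" by blast
    qed
  next
    case False
    then show ?thesis using H_off[OF f] by (simp add: Cauchy_def)
  qed
  then have "\<forall>z. \<exists>l. (\<lambda>n. f n z) \<longlonglongrightarrow> l" by (simp add: Cauchy_convergent_iff convergent_def)
  then obtain g where g: "\<And>z. (\<lambda>n. f n z) \<longlonglongrightarrow> g z" by metis
  have g0: "g z = 0" if "z \<notin> X" for z
    using H_off[OF f that] g[of z] by (simp add: LIMSEQ_const_iff)
  have tail: "(\<lambda>z. f m z - g z) \<in> H \<and> nrm (\<lambda>z. f m z - g z) \<le> e"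
    if N: "\<forall>m\<ge>N. \<forall>n\<ge>N. nrm (\<lambda>z. f m z - f n z) < e" "m \<ge> N" for N m e
  proof -
    have lim: "(\<lambda>n. f m z - f (n + N) z) \<longlonglongrightarrow> f m z - g z" for z
      by (intro tendsto_diff tendsto_const LIMSEQ_ignore_initial_segment g)
    show ?thesis
      using H_pointwise_limit[of "\<lambda>n z. f m z - f (n + N) z" e "\<lambda>z. f m z - g z", OF H_diff[OF f f] _ lim]
        N g0 H_off[OF f] by (simp add: less_imp_le)
  qed
  obtain N where "\<forall>m\<ge>N. \<forall>n\<ge>N. nrm (\<lambda>z. f m z - f n z) < 1" using Cau[of 1] by auto
  then have "(\<lambda>z. f N z - g z) \<in> H" using tail by blast
  from H_diff[OF f[of N] this] have gH: "g \<in> H" by simp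
  have "(\<lambda>n. nrm (\<lambda>z. f n z - g z)) \<longlonglongrightarrow> 0"
  proof (rule LIMSEQ_I)
    fix e :: real assume "e > 0"
    then obtain N where N: "\<forall>m\<ge>N. \<forall>n\<ge>N. nrm (\<lambda>z. f m z - f n z) < e / 2" using Cau[of "e / 2"] by auto
    have "norm (nrm (\<lambda>z. f n z - g z) - 0) < e" if "n \<ge> N" for n
      using tail[OF N that] nrm_nonneg[of "\<lambda>z. f n z - g z"] \<open>e > 0\<close> by auto
    then show "\<exists>N. \<forall>n\<ge>N. norm (nrm (\<lambda>z. f n z - g z) - 0) < e" by blast
  qed
  then show ?thesis using that gH g by blast
qed

lemma orthogonal_decomposition:
  assumes sub: "N \<subseteq> H" "(\<lambda>z. 0) \<in> N"
    and add: "\<And>f g. f \<in> N \<Longrightarrow> g \<in> N \<Longrightarrow> (\<lambda>z. f z + g z) \<in> N"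
    and scale: "\<And>c f. f \<in> N \<Longrightarrow> (\<lambda>z. c * f z) \<in> N"
    and closed: "\<And>g. g \<in> H \<Longrightarrow> (\<And>e. e > 0 \<Longrightarrow> \<exists>n\<in>N. nrm (\<lambda>z. g z - n z) < e) \<Longrightarrow> g \<in> N"
    and h: "h \<in> H"
  obtains n where "n \<in> N" "\<And>q. q \<in> N \<Longrightarrow> inn (\<lambda>z. h z - n z) q = 0"
proof -
  define D where "D = Inf ((\<lambda>n. (nrm (\<lambda>z. h z - n z))\<^sup>2) ` N)"
  have bdd: "bdd_below ((\<lambda>n. (nrm (\<lambda>z. h z - n z))\<^sup>2) ` N)" by (rule bdd_belowI2[of _ 0]) simp
  have D: "D \<le> (nrm (\<lambda>z. h z - n z))\<^sup>2" if "n \<in> N" for n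
    unfolding D_def by (intro cINF_lower bdd that)
  have "\<exists>n\<in>N. (nrm (\<lambda>z. h z - n z))\<^sup>2 < D + e" if "e > 0" for e
  proof (rule ccontr)
    assume "\<not> ?thesis"
    then have "D + e \<le> D" unfolding D_def by (intro cINF_greatest) (use sub(2) in \<open>auto simp: not_less\<close>)
    then show False using that by simp
  qed
  then have "\<forall>j. \<exists>n\<in>N. (nrm (\<lambda>z. h z - n z))\<^sup>2 < D + inverse (real (Suc j))" by simp
  then obtain n where n: "\<And>j. n j \<in> N" "\<And>j. (nrm (\<lambda>z. h z - n j z))\<^sup>2 < D + inverse (real (Suc j))"
    by metis
  have nH: "n j \<in> H" for j using n(1) sub(1) by blast
  \<comment> \<open>The parallelogram law for \<open>h - n i\<close> and \<open>h - n j\<close>: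
    their mean is \<open>h\<close> minus an element of \<open>N\<close>, hence has squared norm at
    least \<open>D\<close>. This forces a minimising sequence to be Cauchy.\<close>
  have par: "(nrm (\<lambda>z. n i z - n j z))\<^sup>2 \<le> 2 * inverse (real (Suc i)) + 2 * inverse (real (Suc j))" for i j
  proof -
    let ?a = "\<lambda>z. h z - n i z" and ?b = "\<lambda>z. h z - n j z"
    let ?m = "\<lambda>z. (1/2) * (n i z + n j z)"
    have ab: "?a \<in> H" "?b \<in> H" by (intro H_diff h nH)+
    have "?m \<in> N" by (intro scale add n)
    from D[OF this] have "D \<le> (nrm (\<lambda>z. h z - ?m z))\<^sup>2" .
    moreover have "nrm (\<lambda>z. ?a z + ?b z) = 2 * nrm (\<lambda>z. h z - ?m z)"
    proof -
      have "nrm (\<lambda>z. 2 * (h z - ?m z)) = cmod 2 * nrm (\<lambda>z. h z - ?m z)"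
        by (intro nrm_cmult H_diff h H_cmult H_add nH)
      then show ?thesis by (simp add: algebra_simps)
    qed
    moreover have "nrm (\<lambda>z. n i z - n j z) = nrm (\<lambda>z. ?b z - ?a z)" by simp
    ultimately have "(nrm (\<lambda>z. n i z - n j z))\<^sup>2 + 4 * D \<le> (nrm (\<lambda>z. ?b z - ?a z))\<^sup>2 + (nrm (\<lambda>z. ?b z + ?a z))\<^sup>2"
      by (simp add: power_mult_distrib add.commute)
    also have "\<dots> = 2 * (nrm ?a)\<^sup>2 + 2 * (nrm ?b)\<^sup>2"
      using nrm_diff_sq[OF ab(2,1)] nrm_add_sq[OF ab(2,1)] by simp
    finally show ?thesis using n(2)[of i] n(2)[of j] by linarith
  qed
  have "\<exists>N. \<forall>i\<ge>N. \<forall>j\<ge>N. nrm (\<lambda>z. n i z - n j z) < e" if e: "e > 0" for e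
  proof -
    obtain M where M: "inverse (real (Suc M)) < e\<^sup>2 / 4"
      using reals_Archimedean[of "e\<^sup>2 / 4"] e by auto
    have "nrm (\<lambda>z. n i z - n j z) < e" if "i \<ge> M" "j \<ge> M" for i j
    proof -
      have "inverse (real (Suc i)) \<le> inverse (real (Suc M))" "inverse (real (Suc j)) \<le> inverse (real (Suc M))"
        using that by (auto intro!: le_imp_inverse_le)
      then have "(nrm (\<lambda>z. n i z - n j z))\<^sup>2 < e\<^sup>2" using par[of i j] M by linarith
      then show ?thesis using e by (simp add: power_less_imp_less_base)
    qed
    then show ?thesis by blast
  qed
  from H_complete[OF nH this] obtain p where p: "p \<in> H" "(\<lambda>j. nrm (\<lambda>z. n j z - p z)) \<longlonglongrightarrow> 0" by metis
  have pN: "p \<in> N"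
  proof (rule closed[OF p(1)])
    fix e :: real assume "e > 0"
    then obtain j where "nrm (\<lambda>z. n j z - p z) < e"
      using order_tendstoD(2)[OF p(2)] by (auto simp: eventually_sequentially)
    then show "\<exists>n\<in>N. nrm (\<lambda>z. p z - n z) < e" using n(1)[of j] nrm_minus_commute[OF nH p(1)] by auto
  qed
  have min: "(nrm (\<lambda>z. h z - p z))\<^sup>2 \<le> D"
  proof -
    have "(\<lambda>j. nrm (\<lambda>z. h z - n j z) - nrm (\<lambda>z. h z - p z)) \<longlonglongrightarrow> 0"
    proof (rule Lim_null_comparison[OF _ p(2)], intro always_eventually allI)
      fix j
      have "\<bar>nrm (\<lambda>z. h z - n j z) - nrm (\<lambda>z. h z - p z)\<bar> \<le> nrm (\<lambda>z. (h z - n j z) - (h z - p z))"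
        by (intro nrm_diff_abs H_diff h nH p)
      also have "\<dots> = nrm (\<lambda>z. n j z - p z)" using nrm_minus_commute[OF nH p(1), of j] by simp
      finally show "norm (nrm (\<lambda>z. h z - n j z) - nrm (\<lambda>z. h z - p z)) \<le> nrm (\<lambda>z. n j z - p z)" by simp
    qed
    then have 1: "(\<lambda>j. (nrm (\<lambda>z. h z - n j z))\<^sup>2) \<longlonglongrightarrow> (nrm (\<lambda>z. h z - p z))\<^sup>2"
      by (intro tendsto_power) (simp add: LIM_zero_iff)
    have 2: "(\<lambda>j. D + inverse (real (Suc j))) \<longlonglongrightarrow> D + 0"
      by (intro tendsto_intros LIMSEQ_inverse_real_of_nat)
    show ?thesis using LIMSEQ_le[OF 1 2] n(2) less_imp_le by (simp del: of_nat_Suc) blast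
  qed
  have "inn (\<lambda>z. h z - p z) q = 0" if q: "q \<in> N" for q
  proof (cases "nrm q = 0")
    case True
    have qH: "q \<in> H" using q sub(1) by blast
    have "cmod (inn (\<lambda>z. h z - p z) q) \<le> nrm (\<lambda>z. h z - p z) * nrm q"
      by (intro inn_le H_diff h p qH)
    then show ?thesis using True by simp
  next
    case False
    let ?r = "\<lambda>z. h z - p z"
    have qH: "q \<in> H" using q sub(1) by blast
    have rH: "?r \<in> H" by (intro H_diff h p)
    \<comment> \<open>\<open>t\<close> is the optimal coefficient of \<open>q\<close>: moving from
      \<open>p\<close> to \<open>p + t q\<close> lowers the squared distance by
      \<open>|inn ?r q|^2 / (nrm q)^2\<close>, which minimality forces to be
      \<open>0\<close>.\<close>
    define t where "t = inn ?r q / of_real ((nrm q)\<^sup>2)"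
    have "(\<lambda>z. p z + t * q z) \<in> N" by (intro add scale pN q)
    from D[OF this] have "D \<le> (nrm (\<lambda>z. ?r z - t * q z))\<^sup>2" by (simp add: algebra_simps)
    also have "\<dots> = (nrm ?r)\<^sup>2 - 2 * Re (cnj t * inn ?r q) + (cmod t * nrm q)\<^sup>2"
      using nrm_diff_sq[OF rH H_cmult[OF qH, of t]] inn_cmult_right[OF rH qH, of t] nrm_cmult[OF qH, of t] by simp
    finally have "2 * Re (cnj t * inn ?r q) \<le> (cmod t * nrm q)\<^sup>2" using min by simp
    moreover have "cnj t * inn ?r q = of_real ((cmod (inn ?r q))\<^sup>2 / (nrm q)\<^sup>2)"
      unfolding t_def of_real_divide complex_norm_square by simp
    moreover have "(cmod t * nrm q)\<^sup>2 = (cmod (inn ?r q))\<^sup>2 / (nrm q)\<^sup>2"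
    proof -
      have "cmod t = cmod (inn ?r q) / (nrm q)\<^sup>2" by (simp add: t_def norm_divide norm_power)
      then have "cmod t * nrm q = cmod (inn ?r q) / nrm q" using False by (simp add: power2_eq_square)
      then show ?thesis by (simp add: power_divide)
    qed
    ultimately have "(cmod (inn ?r q))\<^sup>2 / (nrm q)\<^sup>2 \<le> 0" by simp
    then show ?thesis using False by (simp add: divide_le_0_iff)
  qed
  with pN show ?thesis by (rule that)
qed

end

section \<open>Multipliers\<close>

definition rk_mult :: "'a set \<Rightarrow> ('a \<Rightarrow> 'a \<Rightarrow> complex) \<Rightarrow> ('a \<Rightarrow> complex) set" where
  "rk_mult X k = {\<phi>. (\<forall>z. z \<notin> X \<longrightarrow> \<phi> z = 0) \<and> (\<forall>f\<in>rk_space X k. (\<lambda>z. \<phi> z * f z) \<in> rk_space X k)}"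

context rkhs
begin

abbreviation "M \<equiv> rk_mult X k"

definition mbound :: "('a \<Rightarrow> complex) \<Rightarrow> real \<Rightarrow> bool" where
  "mbound \<phi> C \<longleftrightarrow> C \<ge> 0 \<and> (\<forall>f\<in>H. nrm (\<lambda>z. \<phi> z * f z) \<le> C * nrm f)"

lemma mboundD: "mbound \<phi> C \<Longrightarrow> f \<in> H \<Longrightarrow> nrm (\<lambda>z. \<phi> z * f z) \<le> C * nrm f"
  by (simp add: mbound_def)

lemma M_off: "\<phi> \<in> M \<Longrightarrow> z \<notin> X \<Longrightarrow> \<phi> z = 0"
  by (simp add: rk_mult_def)

lemma M_H: "\<phi> \<in> M \<Longrightarrow> f \<in> H \<Longrightarrow> (\<lambda>z. \<phi> z * f z) \<in> H"
  by (simp add: rk_mult_def)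

lemma MI: "(\<And>z. z \<notin> X \<Longrightarrow> \<phi> z = 0) \<Longrightarrow> (\<And>f. f \<in> H \<Longrightarrow> (\<lambda>z. \<phi> z * f z) \<in> H) \<Longrightarrow> \<phi> \<in> M"
  by (simp add: rk_mult_def)

text \<open>Gliding hump: the steps \<open>\<plusminus>3\<^sup>-\<^sup>n g\<^sub>n\<close> sum to an \<open>h\<close> whose inner products with the \<open>g\<^sub>n\<close> decay no faster
  than \<open>3\<^sup>-\<^sup>n\<close>.\<close>
lemma no_rapidly_null_unit_sequence:
  assumes g: "\<And>n::nat. g n \<in> H" "\<And>n. nrm (g n) = 1"
    and null: "\<And>h. h \<in> H \<Longrightarrow> \<exists>C. \<forall>n. cmod (inn h (g n)) \<le> C * (1/4) ^ n"
  shows False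
proof -
  let ?P = "\<lambda>(n::nat) h. h \<in> H"
  \<comment> \<open>All steps after step \<open>n\<close> together have norm at most half of the
    \<open>3^-n\<close> secured at step \<open>n\<close>. So half of it survives in the limit, and
    \<open>3^-n\<close> outlasts the assumed decay \<open>4^-n\<close>.\<close>
  let ?R = "\<lambda>n h h'. nrm (\<lambda>z. h' z - h z) \<le> (1/3) ^ n \<and> (1/3) ^ n \<le> cmod (inn h' (g n))"
  have "\<exists>h. \<forall>n. ?P n (h n) \<and> ?R n (h n) (h (Suc n))"
  proof (rule dependent_nat_choice)
    show "\<exists>h. ?P 0 h" using H_zero by blast
  next
    fix h n assume h: "?P n h"
    define t :: complex where "t = of_real ((1/3) ^ n)"
    have t: "cmod t = (1/3) ^ n" by (simp add: t_def norm_power)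
    have ex: "?P (Suc n) (\<lambda>z. h z + s * t * g n z) \<and> nrm (\<lambda>z. (h z + s * t * g n z) - h z) \<le> (1/3) ^ n \<and>
        inn (\<lambda>z. h z + s * t * g n z) (g n) = inn h (g n) + s * t" if "cmod s = 1" for s
    proof -
      have "(\<lambda>z. h z + s * t * g n z) \<in> H" by (intro H_add h H_cmult g)
      moreover have "nrm (\<lambda>z. (h z + s * t * g n z) - h z) = (1/3) ^ n"
        using nrm_cmult[OF g(1), of "s * t"] that by (simp add: g(2) norm_mult t)
      moreover have "inn (\<lambda>z. h z + s * t * g n z) (g n) = inn h (g n) + s * t * inn (g n) (g n)"
        using h g by (simp add: inn_add_left inn_cmult_left H_cmult)
      moreover have "inn (g n) (g n) = 1" using inn_self[OF g(1)] g(2) by simp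
      ultimately show ?thesis by simp
    qed
    \<comment> \<open>The two candidates for the new inner product differ by \<open>2 t\<close>, so
      one of them has modulus at least \<open>|t|\<close>.\<close>
    have "2 * cmod t \<le> cmod (inn h (g n) + 1 * t) + cmod (inn h (g n) + (-1) * t)"
      using norm_triangle_ineq4[of "inn h (g n) + t" "inn h (g n) - t"] by (simp add: norm_mult)
    then have "cmod t \<le> cmod (inn h (g n) + 1 * t) \<or> cmod t \<le> cmod (inn h (g n) + (-1) * t)" by linarith
    then show "\<exists>h'. ?P (Suc n) h' \<and> ?R n h h'"
    proof
      assume "cmod t \<le> cmod (inn h (g n) + 1 * t)"
      then show ?thesis
        using ex[of 1] unfolding t by (intro exI[of _ "\<lambda>z. h z + 1 * t * g n z"]) simp
    next
      assume "cmod t \<le> cmod (inn h (g n) + (-1) * t)"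
      then show ?thesis
        using ex[of "-1"] unfolding t by (intro exI[of _ "\<lambda>z. h z + (-1) * t * g n z"]) simp
    qed
  qed
  then obtain h where h: "\<And>n. h n \<in> H" "\<And>n. nrm (\<lambda>z. h (Suc n) z - h n z) \<le> (1/3) ^ n"
    "\<And>n. (1/3) ^ n \<le> cmod (inn (h (Suc n)) (g n))" by blast
  have tail: "nrm (\<lambda>z. h (n + p) z - h n z) \<le> (3/2) * (1/3) ^ n * (1 - (1/3) ^ p)" for n p
  proof (induction p)
    case (Suc p)
    have "nrm (\<lambda>z. (h (n + p) z - h n z) + (h (Suc (n + p)) z - h (n + p) z))
       \<le> nrm (\<lambda>z. h (n + p) z - h n z) + nrm (\<lambda>z. h (Suc (n + p)) z - h (n + p) z)"
      by (intro nrm_triangle H_diff h)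
    also have "\<dots> \<le> (3/2) * (1/3) ^ n * (1 - (1/3) ^ p) + (1/3) ^ (n + p)"
      by (intro add_mono Suc h)
    finally show ?case by (simp add: power_add field_simps)
  qed simp
  have tail': "nrm (\<lambda>z. h m z - h n z) \<le> (3/2) * (1/3) ^ n" if "m \<ge> n" for m n
  proof -
    have "(3/2) * (1/3::real) ^ n * (1 - (1/3) ^ (m - n)) \<le> (3/2) * (1/3) ^ n * 1"
      by (intro mult_left_mono) auto
    moreover have "n + (m - n) = m" using that by simp
    ultimately have "nrm (\<lambda>z. h m z - h n z) \<le> (3/2) * (1/3) ^ n * 1"
      using order_trans[OF tail[of n "m - n"]] by (simp only:)
    then show ?thesis by simp
  qed
  have Cau: "\<exists>N. \<forall>m\<ge>N. \<forall>n\<ge>N. nrm (\<lambda>z. h m z - h n z) < e" if e: "e > 0" for e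
  proof -
    obtain N where N: "(1/3::real) ^ N < e / 3" using real_arch_pow_inv[of "e / 3" "1/3"] e by auto
    have "nrm (\<lambda>z. h m z - h n z) < e" if "m \<ge> N" "n \<ge> N" for m n
    proof -
      have "nrm (\<lambda>z. (h m z - h N z) - (h n z - h N z)) \<le> nrm (\<lambda>z. h m z - h N z) + nrm (\<lambda>z. h n z - h N z)"
        by (intro nrm_triangle_diff H_diff h)
      then show ?thesis using tail'[OF that(1)] tail'[OF that(2)] N by simp
    qed
    then show ?thesis by blast
  qed
  obtain l where l: "l \<in> H" "(\<lambda>n. nrm (\<lambda>z. h n z - l z)) \<longlonglongrightarrow> 0"
    by (rule H_complete[OF h(1) Cau]) (assumption, rule that)
  have lim: "nrm (\<lambda>z. h (Suc n) z - l z) \<le> (1/2) * (1/3) ^ n" for n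
  proof (rule LIMSEQ_le_const)
    show "(\<lambda>m. (1/2) * (1/3) ^ n + nrm (\<lambda>z. h m z - l z)) \<longlonglongrightarrow> (1/2) * (1/3) ^ n"
      using tendsto_add[OF tendsto_const l(2)] by simp
    show "\<exists>N. \<forall>m\<ge>N. nrm (\<lambda>z. h (Suc n) z - l z) \<le> (1/2) * (1/3) ^ n + nrm (\<lambda>z. h m z - l z)"
    proof (intro exI allI impI)
      fix m assume "m \<ge> Suc n"
      have "nrm (\<lambda>z. (h m z - l z) - (h m z - h (Suc n) z)) \<le> nrm (\<lambda>z. h m z - l z) + nrm (\<lambda>z. h m z - h (Suc n) z)"
        by (intro nrm_triangle_diff H_diff h l)
      then show "nrm (\<lambda>z. h (Suc n) z - l z) \<le> (1/2) * (1/3) ^ n + nrm (\<lambda>z. h m z - l z)"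
        using tail'[OF \<open>m \<ge> Suc n\<close>] by simp
    qed
  qed
  obtain C where C: "\<And>n. cmod (inn l (g n)) \<le> C * (1/4) ^ n" using null[OF l(1)] by blast
  have le: "(1/2) * (1/3) ^ n \<le> C * (1/4) ^ n" for n
  proof -
    have "inn (h (Suc n)) (g n) = inn (\<lambda>z. h (Suc n) z - l z) (g n) + inn l (g n)"
      by (simp add: inn_diff_left h l g)
    then have "(1/3) ^ n \<le> cmod (inn (\<lambda>z. h (Suc n) z - l z) (g n)) + cmod (inn l (g n))"
      using h(3)[of n] norm_triangle_ineq by (metis order_trans)
    moreover have "cmod (inn (\<lambda>z. h (Suc n) z - l z) (g n)) \<le> nrm (\<lambda>z. h (Suc n) z - l z) * 1"
      using inn_le[OF H_diff[OF h(1) l(1)] g(1)] by (simp add: g(2))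
    ultimately show ?thesis using lim[of n] C[of n] by simp
  qed
  have "(4/3) ^ n \<le> 2 * C" for n
  proof -
    have "(4/3::real) ^ n = (1/3) ^ n * 4 ^ n" "(1/4::real) ^ n * 4 ^ n = 1"
      by (simp_all flip: power_mult_distrib)
    moreover have "(1/2) * (1/3) ^ n * 4 ^ n \<le> C * (1/4) ^ n * 4 ^ n"
      by (intro mult_right_mono le) simp
    ultimately show ?thesis by (simp add: mult.assoc)
  qed
  moreover obtain n where "2 * C < (4/3) ^ n" using real_arch_pow[of "4/3" "2 * C"] by auto
  ultimately show False by (meson not_less)
qed

text \<open>The adjoint of multiplication by \<open>\<phi>\<close> sends the kernel at
  \<open>x\<close> to \<open>cnj (\<phi> x)\<close> times itself; \<open>adj\<close> is this action
  on lists, and is available without knowing that the multiplication is bounded.\<close>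

definition adj :: "('a \<Rightarrow> complex) \<Rightarrow> (complex \<times> 'a) list \<Rightarrow> (complex \<times> 'a) list" where
  "adj \<phi> v = map (\<lambda>(c, x). (c * cnj (\<phi> x), x)) v"

lemma adj_V: "v \<in> V \<Longrightarrow> adj \<phi> v \<in> V"
  by (auto simp: adj_def)

lemma ev_adj: "ev f (adj \<phi> v) = ev (\<lambda>z. \<phi> z * f z) v"
  by (induction v) (auto simp: adj_def)

lemma mboundI_adj:
  assumes "\<And>z. z \<notin> X \<Longrightarrow> \<phi> z = 0" "C \<ge> 0" "\<And>v. v \<in> V \<Longrightarrow> sqrt (Q (adj \<phi> v)) \<le> C * sqrt (Q v)"
  shows "\<phi> \<in> M" "mbound \<phi> C"
proof -
  have *: "cmod (ev (\<lambda>z. \<phi> z * f z) v) \<le> (C * nrm f) * sqrt (Q v)" if "f \<in> H" "v \<in> V" for f v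
  proof -
    have "cmod (ev f (adj \<phi> v)) \<le> nrm f * sqrt (Q (adj \<phi> v))" by (intro ev_le_nrm adj_V that)
    also have "\<dots> \<le> nrm f * (C * sqrt (Q v))" by (intro mult_left_mono assms nrm_nonneg that)
    finally show ?thesis by (simp add: ev_adj mult_ac)
  qed
  show "\<phi> \<in> M"
    by (rule MI) (simp add: assms(1), rule nrm_le(1)[OF _ _ *], simp_all add: assms(1,2) nrm_nonneg del: in_lists_conv_set)
  show "mbound \<phi> C" unfolding mbound_def
    by (intro conjI ballI assms(2)) (rule nrm_le(2)[OF _ _ *], simp_all add: assms(1,2) nrm_nonneg del: in_lists_conv_set)
qed

text \<open>This does the work of the closed graph theorem. If the adjoint were unbounded on kernel
  combinations, some \<open>v n\<close> would be stretched by more than \<open>4^n\<close>. Their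
  normalised images \<open>g n\<close> are unit vectors, yet pairing \<open>h\<close> with
  \<open>g n\<close> amounts to pairing the element \<open>\<phi> h\<close> of \<open>H\<close> with
  a vector of norm below \<open>4^-n\<close>, which the gliding hump excludes.\<close>

lemma M_bounded:
  assumes "\<phi> \<in> M"
  obtains C where "mbound \<phi> C"
proof -
  have "\<exists>C\<ge>0. \<forall>v\<in>V. sqrt (Q (adj \<phi> v)) \<le> C * sqrt (Q v)"
  proof (rule ccontr)
    assume *: "\<not> ?thesis"
    have "\<forall>n. \<exists>v\<in>V. 4 ^ n * sqrt (Q v) < sqrt (Q (adj \<phi> v))"
    proof
      fix n :: nat
      have "(4::real) ^ n \<ge> 0" by simp
      then show "\<exists>v\<in>V. 4 ^ n * sqrt (Q v) < sqrt (Q (adj \<phi> v))" using * by (meson not_less)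
    qed
    then obtain v where v: "\<And>n. v n \<in> V" "\<And>n. 4 ^ n * sqrt (Q (v n)) < sqrt (Q (adj \<phi> (v n)))" by metis
    define w where "w n = adj \<phi> (v n)" for n
    have w: "w n \<in> V" for n unfolding w_def by (intro adj_V v)
    have q: "nrm (kern (w n)) = sqrt (Q (w n))" for n
      using nrm_kern[OF w] nrm_nonneg[OF kern_H[OF w]] by (metis real_sqrt_unique)
    have pos: "nrm (kern (w n)) > 0" for n
      unfolding q using v(2)[of n] Q_nonneg[OF v(1)[of n]] unfolding w_def
      by (metis le_less_trans mult_nonneg_nonneg real_sqrt_ge_zero zero_le_numeral zero_le_power)
    define g where "g n = (\<lambda>z. of_real (1 / nrm (kern (w n))) * kern (w n) z)" for n
    have gH: "g n \<in> H" for n unfolding g_def by (intro H_cmult kern_H w)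
    show False
    proof (rule no_rapidly_null_unit_sequence[of g])
      show "nrm (g n) = 1" for n
        unfolding g_def using pos[of n] by (subst nrm_cmult[OF kern_H[OF w]]) (simp add: norm_divide)
      fix h assume h: "h \<in> H"
      have "cmod (inn h (g n)) \<le> nrm (\<lambda>z. \<phi> z * h z) * (1/4) ^ n" for n
      proof -
        have "cmod (inn h (kern (w n))) = cmod (ev (\<lambda>z. \<phi> z * h z) (v n))"
          unfolding inn_kern[OF h w] unfolding w_def ev_adj ..
        also have "\<dots> \<le> nrm (\<lambda>z. \<phi> z * h z) * sqrt (Q (v n))"
          by (intro ev_le_nrm M_H assms h v)
        also have "\<dots> \<le> nrm (\<lambda>z. \<phi> z * h z) * ((1/4) ^ n * nrm (kern (w n)))"
        proof (intro mult_left_mono nrm_nonneg M_H assms h)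
          show "sqrt (Q (v n)) \<le> (1/4) ^ n * nrm (kern (w n))"
            using v(2)[of n] unfolding q w_def[symmetric] by (simp add: power_divide field_simps)
        qed
        finally have "cmod (inn h (kern (w n))) / nrm (kern (w n)) \<le> nrm (\<lambda>z. \<phi> z * h z) * (1/4) ^ n"
          using pos[of n] by (simp add: field_simps)
        moreover have "inn h (g n) = of_real (1 / nrm (kern (w n))) * inn h (kern (w n))"
          unfolding g_def by (subst inn_cmult_right[OF h kern_H[OF w]]) simp
        ultimately show ?thesis using pos[of n] by (simp add: norm_mult norm_divide)
      qed
      then show "\<exists>C. \<forall>n. cmod (inn h (g n)) \<le> C * (1/4) ^ n" by blast
    qed (rule gH)
  qed
  then obtain C where "C \<ge> 0" "\<forall>v\<in>V. sqrt (Q (adj \<phi> v)) \<le> C * sqrt (Q v)" by blast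
  then show ?thesis using mboundI_adj(2)[of \<phi> C] M_off[OF assms] that by blast
qed

section \<open>The multipliers as a unital normed algebra\<close>

lemma M_add [intro]: "\<phi> \<in> M \<Longrightarrow> \<psi> \<in> M \<Longrightarrow> (\<lambda>z. \<phi> z + \<psi> z) \<in> M"
  by (rule MI) (simp_all add: M_off distrib_right H_add M_H)

lemma M_cmult [intro]: "\<phi> \<in> M \<Longrightarrow> (\<lambda>z. c * \<phi> z) \<in> M"
  by (rule MI) (simp_all add: M_off mult.assoc H_cmult M_H)

lemma M_mult [intro]: "\<phi> \<in> M \<Longrightarrow> \<psi> \<in> M \<Longrightarrow> (\<lambda>z. \<phi> z * \<psi> z) \<in> M"
  by (rule MI) (simp_all add: M_off mult.assoc M_H)

lemma M_diff [intro]: "\<phi> \<in> M \<Longrightarrow> \<psi> \<in> M \<Longrightarrow> (\<lambda>z. \<phi> z - \<psi> z) \<in> M"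
  using M_add[OF _ M_cmult, of \<phi> \<psi> "-1"] by simp

lemma M_zero [simp]: "(\<lambda>z. 0) \<in> M"
  by (rule MI) simp_all

lemma M_sum [intro]: "(\<And>i. i \<in> A \<Longrightarrow> \<phi> i \<in> M) \<Longrightarrow> (\<lambda>z. \<Sum>i\<in>A. \<phi> i z) \<in> M"
  by (induction A rule: infinite_finite_induct) auto

text \<open>Multipliers are normalised to vanish off \<open>X\<close>, so the unit of the algebra is
  the indicator of \<open>X\<close> and not the constant \<open>1\<close>.\<close>

definition one :: "'a \<Rightarrow> complex" where
  "one = (\<lambda>z. if z \<in> X then 1 else 0)"

lemma one_M [simp, intro]: "one \<in> M"
proof (rule MI)
  fix f assume f: "f \<in> H"
  then have "(\<lambda>z. one z * f z) = f" using H_off[OF f] by (auto simp: one_def fun_eq_iff)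
  then show "(\<lambda>z. one z * f z) \<in> H" using f by simp
qed (simp add: one_def)

lemma mult_one: "\<phi> \<in> M \<Longrightarrow> \<phi> z * one z = \<phi> z" "f \<in> H \<Longrightarrow> f z * one z = f z"
  using M_off H_off by (auto simp: one_def)

definition mnorm :: "('a \<Rightarrow> complex) \<Rightarrow> real" where
  "mnorm \<phi> = Inf {C. mbound \<phi> C}"

lemma mnorm_le: "mbound \<phi> C \<Longrightarrow> mnorm \<phi> \<le> C"
  unfolding mnorm_def by (rule cInf_lower) (auto simp: mbound_def intro: bdd_belowI[of _ 0])

lemma mbound_mnorm:
  assumes "\<phi> \<in> M"
  shows "mbound \<phi> (mnorm \<phi>)"
proof -
  have ne: "{C. mbound \<phi> C} \<noteq> {}" using M_bounded[OF assms] by blast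
  have "nrm (\<lambda>z. \<phi> z * f z) \<le> mnorm \<phi> * nrm f" if f: "f \<in> H" for f
  proof (cases "nrm f = 0")
    case True
    then have "f = (\<lambda>z. 0)" using nrm_eq_0[OF f] by simp
    then show ?thesis by simp
  next
    case False
    then have p: "nrm f > 0" using nrm_nonneg[OF f] by simp
    have "nrm (\<lambda>z. \<phi> z * f z) / nrm f \<le> mnorm \<phi>" unfolding mnorm_def
      by (rule cInf_greatest[OF ne]) (use f p in \<open>auto simp: mbound_def field_simps\<close>)
    then show ?thesis using p by (simp add: field_simps)
  qed
  moreover have "mnorm \<phi> \<ge> 0" unfolding mnorm_def
    by (rule cInf_greatest[OF ne]) (simp add: mbound_def)
  ultimately show ?thesis by (simp add: mbound_def)
qed

lemma mnorm_nonneg: "\<phi> \<in> M \<Longrightarrow> 0 \<le> mnorm \<phi>"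
  using mbound_mnorm[of \<phi>] by (simp add: mbound_def)

lemma nrm_mult_le: "\<phi> \<in> M \<Longrightarrow> f \<in> H \<Longrightarrow> nrm (\<lambda>z. \<phi> z * f z) \<le> mnorm \<phi> * nrm f"
  using mbound_mnorm[of \<phi>] by (simp add: mbound_def)

lemma mnorm_add_le:
  assumes "\<phi> \<in> M" "\<psi> \<in> M"
  shows "mnorm (\<lambda>z. \<phi> z + \<psi> z) \<le> mnorm \<phi> + mnorm \<psi>"
proof (rule mnorm_le, unfold mbound_def, intro conjI ballI)
  fix f assume f: "f \<in> H"
  have "nrm (\<lambda>z. \<phi> z * f z + \<psi> z * f z) \<le> nrm (\<lambda>z. \<phi> z * f z) + nrm (\<lambda>z. \<psi> z * f z)"
    by (intro nrm_triangle M_H assms f)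
  then show "nrm (\<lambda>z. (\<phi> z + \<psi> z) * f z) \<le> (mnorm \<phi> + mnorm \<psi>) * nrm f"
    using nrm_mult_le[OF assms(1) f] nrm_mult_le[OF assms(2) f] by (simp add: distrib_right)
qed (use mnorm_nonneg assms in auto)

lemma mnorm_mult_le:
  assumes "\<phi> \<in> M" "\<psi> \<in> M"
  shows "mnorm (\<lambda>z. \<phi> z * \<psi> z) \<le> mnorm \<phi> * mnorm \<psi>"
proof (rule mnorm_le, unfold mbound_def, intro conjI ballI)
  fix f assume f: "f \<in> H"
  have "nrm (\<lambda>z. \<phi> z * (\<psi> z * f z)) \<le> mnorm \<phi> * nrm (\<lambda>z. \<psi> z * f z)"
    by (intro nrm_mult_le M_H assms f)
  also have "\<dots> \<le> mnorm \<phi> * (mnorm \<psi> * nrm f)"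
    by (intro mult_left_mono nrm_mult_le mnorm_nonneg assms f)
  finally show "nrm (\<lambda>z. \<phi> z * \<psi> z * f z) \<le> mnorm \<phi> * mnorm \<psi> * nrm f"
    by (simp add: mult.assoc)
qed (use mnorm_nonneg assms in auto)

lemma mnorm_cmult_le:
  assumes "\<phi> \<in> M"
  shows "mnorm (\<lambda>z. c * \<phi> z) \<le> cmod c * mnorm \<phi>"
proof (rule mnorm_le, unfold mbound_def, intro conjI ballI)
  fix f assume f: "f \<in> H"
  have "nrm (\<lambda>z. c * (\<phi> z * f z)) = cmod c * nrm (\<lambda>z. \<phi> z * f z)"
    by (intro nrm_cmult M_H assms f)
  also have "\<dots> \<le> cmod c * (mnorm \<phi> * nrm f)"
    by (intro mult_left_mono nrm_mult_le assms f) simp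
  finally show "nrm (\<lambda>z. c * \<phi> z * f z) \<le> cmod c * mnorm \<phi> * nrm f"
    by (simp add: mult.assoc)
qed (use mnorm_nonneg assms in auto)

lemma mbound_one: "mbound one 1"
  unfolding mbound_def
proof (intro conjI ballI)
  fix f assume f: "f \<in> H"
  then have "(\<lambda>z. one z * f z) = f" using H_off[OF f] by (auto simp: one_def fun_eq_iff)
  then show "nrm (\<lambda>z. one z * f z) \<le> 1 * nrm f" by simp
qed simp

end

text \<open>\<open>B = 1 - 1/k\<close> is the positive semidefinite kernel witnessing the complete Pick property.\<close>
locale pick_space = rkhs +
  assumes k_pos: "z \<in> X \<Longrightarrow> 0 < Re (k z z)"
    and pick: "psd_on X (\<lambda>z w. 1 - 1 / k z w)"
begin

definition B :: "'a \<Rightarrow> 'a \<Rightarrow> complex" where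
  "B z w = 1 - 1 / k z w"

lemma B_psd: "psd_on X B"
  using pick unfolding B_def[abs_def] .

lemma k_diag: "z \<in> X \<Longrightarrow> k z z = of_real (Re (k z z))"
  using psd_on_diag(1)[OF psd] by (simp add: complex_eq_iff)

lemma B_diag: "z \<in> X \<Longrightarrow> Re (B z z) < 1"
  by (subst B_def, subst k_diag) (simp_all add: k_pos)

lemma B_less_1:
  assumes "z \<in> X" "w \<in> X"
  shows "cmod (B z w) < 1"
proof -
  have "(cmod (B z w))\<^sup>2 \<le> Re (B z z) * Re (B w w)" by (rule psd_on_Cauchy_Schwarz[OF B_psd assms])
  also have "\<dots> \<le> Re (B z z) * 1"
    using B_diag[OF assms(2)] psd_on_diag(2)[OF B_psd assms(1)] by (intro mult_left_mono) auto
  also have "\<dots> < 1" using B_diag[OF assms(1)] by simp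
  finally show ?thesis using power2_less_imp_less[of "cmod (B z w)" 1] by simp
qed

text \<open>At a zero of \<open>k\<close> the convention \<open>1 / 0 = 0\<close> would give
  \<open>B z w = 1\<close>, contrary to \<open>B_less_1\<close>.\<close>

lemma k_nz: "z \<in> X \<Longrightarrow> w \<in> X \<Longrightarrow> k z w \<noteq> 0"
  using B_less_1[of z w] by (auto simp: B_def)

lemma k_eq: "z \<in> X \<Longrightarrow> w \<in> X \<Longrightarrow> B z w * k z w = k z w - 1"
  using k_nz[of z w] by (simp add: B_def algebra_simps)

text \<open>The kernel \<open>k - 1 = B k\<close> is positive by the Schur product theorem, which is
  the domination condition for \<open>one\<close> with constant \<open>1\<close>.\<close>

lemma one_H [simp, intro]: "one \<in> H"
proof -
  have "psd_on X (\<lambda>z w. of_real (1\<^sup>2) * k z w - one z * cnj (one w))"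
    by (rule psd_on_cong[OF Schur_product[OF B_psd psd]]) (simp add: k_eq one_def)
  then have "\<exists>C::real. psd_on X (\<lambda>z w. of_real (C\<^sup>2) * k z w - one z * cnj (one w))" by blast
  then show ?thesis by (simp add: rk_space_def) (simp add: one_def)
qed

lemma M_subset_H: "\<phi> \<in> M \<Longrightarrow> \<phi> \<in> H"
  using M_H[OF _ one_H, of \<phi>] mult_one(1)[of \<phi>] by simp

text \<open>Apply the multiplier to the kernel at \<open>z\<close> and evaluate at \<open>z\<close>:
  the factor \<open>k z z\<close> appears on both sides and cancels.\<close>

lemma cmod_le_mbound:
  assumes "\<phi> \<in> M" "mbound \<phi> C" "z \<in> X"
  shows "cmod (\<phi> z) \<le> C"
proof -
  have v: "[(1, z)] \<in> V" using assms by simp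
  have kz: "kern [(1, z)] z = of_real (Re (k z z))" using assms(3) k_diag by (simp add: kern_Cons)
  have n: "nrm (kern [(1, z)]) = sqrt (Re (k z z))"
  proof -
    have "(nrm (kern [(1, z)]))\<^sup>2 = Re (k z z)"
      using nrm_kern[OF v] kz by (simp add: Q_def)
    then show ?thesis using nrm_nonneg[OF kern_H[OF v]] by (simp add: real_sqrt_unique)
  qed
  have "cmod (\<phi> z * kern [(1, z)] z) \<le> nrm (\<lambda>z'. \<phi> z' * kern [(1, z)] z') * sqrt (Re (k z z))"
    using eval_le[OF M_H[OF assms(1) kern_H[OF v]] assms(3)] by simp
  also have "\<dots> \<le> C * nrm (kern [(1, z)]) * sqrt (Re (k z z))"
    using mboundD[OF assms(2) kern_H[OF v]] k_pos[OF assms(3)] by (intro mult_right_mono) auto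
  finally have "cmod (\<phi> z) * Re (k z z) \<le> C * Re (k z z)"
    using k_pos[OF assms(3)] by (simp add: kz n norm_mult mult.assoc)
  then show ?thesis using k_pos[OF assms(3)] by simp
qed

lemma cmod_le_mnorm: "\<phi> \<in> M \<Longrightarrow> z \<in> X \<Longrightarrow> cmod (\<phi> z) \<le> mnorm \<phi>"
  using cmod_le_mbound mbound_mnorm by blast

text \<open>The partial sums of the geometric series applied to \<open>f\<close> are uniformly
  bounded and converge pointwise, which is all that \<open>H_pointwise_limit\<close> asks
  for.\<close>

lemma Neumann_inverse:
  assumes "\<phi> \<in> M" "mbound \<phi> C" "C < 1"
  shows "(\<lambda>z. if z \<in> X then 1 / (1 - \<phi> z) else 0) \<in> M"
    and "mbound (\<lambda>z. if z \<in> X then 1 / (1 - \<phi> z) else 0) (1 / (1 - C))"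
proof -
  let ?\<psi> = "\<lambda>z. if z \<in> X then 1 / (1 - \<phi> z) else 0"
  have C: "C \<ge> 0" using assms(2) by (simp add: mbound_def)
  have main: "(\<lambda>z. ?\<psi> z * f z) \<in> H \<and> nrm (\<lambda>z. ?\<psi> z * f z) \<le> (1 / (1 - C)) * nrm f" if f: "f \<in> H" for f
  proof -
    define s where "s n = (\<lambda>z. \<Sum>i<n. \<phi> z ^ i * f z)" for n :: nat
    have pw: "(\<lambda>z. \<phi> z ^ i * f z) \<in> H \<and> nrm (\<lambda>z. \<phi> z ^ i * f z) \<le> C ^ i * nrm f" for i
    proof (induction i)
      case (Suc i)
      have "nrm (\<lambda>z. \<phi> z * (\<phi> z ^ i * f z)) \<le> C * nrm (\<lambda>z. \<phi> z ^ i * f z)"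
        using Suc by (intro mboundD[OF assms(2)]) auto
      also have "\<dots> \<le> C * (C ^ i * nrm f)" using Suc C by (intro mult_left_mono) auto
      finally show ?case using M_H[OF assms(1) conjunct1[OF Suc]] by (simp add: mult.assoc)
    qed (use f in simp)
    have sH: "s n \<in> H" for n unfolding s_def using pw by (intro H_sum) auto
    have sn: "nrm (s n) \<le> (1 / (1 - C)) * nrm f" for n
    proof -
      have "nrm (s n) \<le> (\<Sum>i<n. C ^ i * nrm f)"
        unfolding s_def using pw by (intro order_trans[OF nrm_sum_le sum_mono]) auto
      also have "\<dots> = (\<Sum>i<n. C ^ i) * nrm f" by (simp add: sum_distrib_right)
      also have "(\<Sum>i<n. C ^ i) \<le> 1 / (1 - C)"
        using C assms(3) by (simp add: sum_gp_strict divide_right_mono)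
      finally show ?thesis using nrm_nonneg[OF f] by (simp add: mult_right_mono)
    qed
    have lim: "(\<lambda>n. s n z) \<longlonglongrightarrow> ?\<psi> z * f z" if z: "z \<in> X" for z
    proof -
      have "cmod (\<phi> z) < 1" using cmod_le_mbound[OF assms(1,2) z] assms(3) by simp
      then have "(\<lambda>i. \<phi> z ^ i) sums (1 / (1 - \<phi> z))" by (rule geometric_sums)
      from sums_mult2[OF this, of "f z"] show ?thesis using z unfolding sums_def s_def by simp
    qed
    show ?thesis
      using H_pointwise_limit[OF sH sn lim] by simp
  qed
  show "?\<psi> \<in> M" by (rule MI) (use main in auto)
  show "mbound ?\<psi> (1 / (1 - C))" using main assms(3) by (simp add: mbound_def)
qed

lemma sum_lessThan_add: "(\<Sum>l<n + m. f l) = (\<Sum>l<n. f l) + (\<Sum>l<m. f (n + l))" for f :: "nat \<Rightarrow> complex"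
  by (induction m) (simp_all add: add.assoc)

text \<open>If \<open>B z w\<close> is written as a sum of \<open>b(z) cnj (b(w))\<close>, the row
  of the multipliers \<open>b\<close> is a contraction, because \<open>k (1 - B) = 1\<close> is
  positive. The lemma states this on the vectors obtained by pairing the column at
  \<open>w j\<close> with \<open>h j\<close>, and avoids choosing such a factorization: the Schur
  product of \<open>B\<close> with a Gram kernel supplies the positivity.\<close>

lemma row_contraction:
  fixes n :: nat
  assumes w: "\<And>j. j < n \<Longrightarrow> w j \<in> X" and h: "\<And>j. j < n \<Longrightarrow> h j \<in> H"
  shows "(\<lambda>z. \<Sum>j<n. B z (w j) * h j z) \<in> H"
    and "(nrm (\<lambda>z. \<Sum>j<n. B z (w j) * h j z))\<^sup>2 \<le> Re (\<Sum>i<n. \<Sum>j<n. B (w i) (w j) * inn (h j) (h i))"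
proof -
  let ?T = "\<lambda>z. \<Sum>j<n. B z (w j) * h j z"
  define R where "R = (\<Sum>i<n. \<Sum>j<n. B (w i) (w j) * inn (h j) (h i))"
  have le: "2 * Re (ev ?T v) - Q v \<le> Re R" if v: "v \<in> V" for v
  proof -
    define m where "m = length v"
    define c x where "c l = fst (v ! l)" and "x l = snd (v ! l)" for l :: nat
    have vv: "v = map (\<lambda>l. (c l, x l)) [0..<m]" unfolding c_def x_def m_def by (rule list_as_upt)
    have xX: "x l \<in> X" if "l < m" for l using V_nth[OF v] that by (simp add: x_def m_def)
    define K where "K l = kern [(c l, x l)]" for l
    have KV: "[(c l, x l)] \<in> V" if "l < m" for l using xX[OF that] by simp
    have KH: "K l \<in> H" if "l < m" for l unfolding K_def by (intro kern_H KV that)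
    have innK: "inn g (K l) = cnj (c l) * g (x l)" if "l < m" "g \<in> H" for l g
      unfolding K_def using inn_kern[OF that(2) KV[OF that(1)]] by simp
    define p where "p l = (if l < n then w l else x (l - n))" for l :: nat
    define g where "g l = (if l < n then h l else if l < n + m then K (l - n) else (\<lambda>z. 0))" for l :: nat
    have gH: "g l \<in> H" for l using h KH by (auto simp: g_def)
    have pX: "p l \<in> X" if "l < n + m" for l using that w xX by (auto simp: p_def)
    have psdG: "psd_on {..<n + m} (\<lambda>i j. B (p i) (p j) * inn (g j) (g i))"
      by (intro Schur_product psd_on_compose[OF B_psd] Gram_psd gH) (use pX in auto)
    \<comment> \<open>Weight \<open>1\<close> on the \<open>h j\<close> and \<open>-1\<close> on the
      kernel pieces \<open>K l\<close> of a test vector \<open>v\<close> make the nonnegative form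
      equal to \<open>R - 2 Re S + D\<close>. With \<open>S = ev ?T v\<close> and
      \<open>Re D \<le> Q v\<close> this is the variational bound for \<open>?T\<close>.\<close>
    define d :: "nat \<Rightarrow> complex" where "d l = (if l < n then 1 else -1)" for l :: nat
    define S where "S = (\<Sum>i<m. \<Sum>j<n. B (x i) (w j) * inn (h j) (K i))"
    define D where "D = (\<Sum>i<m. \<Sum>j<m. B (x i) (x j) * inn (K j) (K i))"
    have "hform (n + m) d (\<lambda>i j. B (p i) (p j) * inn (g j) (g i))
      = (R - (\<Sum>i<n. \<Sum>j<m. B (w i) (x j) * inn (K j) (h i))) + (D - S)"
      unfolding hform_def sum_lessThan_add sum.distrib
      by (simp add: d_def p_def g_def R_def S_def D_def sum_negf)
    also have "(\<Sum>i<n. \<Sum>j<m. B (w i) (x j) * inn (K j) (h i)) = cnj S"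
      unfolding S_def cnj_sum
      by (subst sum.swap) (intro sum.cong refl, simp add: psd_on_hermitian[OF B_psd xX w] inn_cnj[OF KH h])
    finally have "0 \<le> Re (R - cnj S + (D - S))"
      using psd_onD[OF psdG, of "n + m" "\<lambda>i. i" d] by (simp add: complex_nonneg_Reals_iff)
    moreover have "S = ev ?T v"
    proof -
      have "S = (\<Sum>i<m. cnj (c i) * ?T (x i))"
        unfolding S_def by (intro sum.cong refl) (simp add: innK h sum_distrib_left mult_ac)
      then show ?thesis by (subst vv, subst ev_upt) simp
    qed
    \<comment> \<open>The Pick property enters here: \<open>B k = k - 1\<close>, so \<open>D\<close>
      is \<open>Q v\<close> minus a rank one term.\<close>
    moreover have "Re D \<le> Q v"
    proof -
      have "D = hform m c (\<lambda>i j. k (x i) (x j) - 1)"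
        unfolding D_def hform_def
        by (intro sum.cong refl) (simp add: innK KH, simp add: K_def kern_Cons xX k_eq[symmetric] mult_ac)
      also have "\<dots> = hform m c (\<lambda>i j. k (x i) (x j)) - of_real ((cmod (\<Sum>i<m. cnj (c i)))\<^sup>2)"
        using hform_rank_one[of m c "\<lambda>_. 1"] by (simp add: hform_diff)
      also have "hform m c (\<lambda>i j. k (x i) (x j)) = of_real (Q v)"
        using ev_kern_upt[of m x c] xX vv ev_kern_Q[OF v] by simp
      finally show ?thesis by (simp del: of_real_power)
    qed
    ultimately show ?thesis by simp
  qed
  have off: "?T z = 0" if "z \<notin> X" for z using H_off[OF h that] by simp
  show "?T \<in> H" "(nrm ?T)\<^sup>2 \<le> Re (\<Sum>i<n. \<Sum>j<n. B (w i) (w j) * inn (h j) (h i))"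
    using variational_ge[of ?T "Re R"] off le unfolding R_def by blast+
qed

text \<open>By the row contraction with a single entry, multiplication by \<open>B(_, w)\<close> has
  norm at most \<open>sqrt (Re (B w w)) < 1\<close>, and the kernel at \<open>w\<close> is its
  Neumann inverse \<open>1 / (1 - B(_, w))\<close>.\<close>

lemma kern_point_M:
  assumes w: "w \<in> X"
  shows "kern [(1, w)] \<in> M"
proof -
  define b where "b = (\<lambda>z. if z \<in> X then B z w else 0)"
  have Bw: "0 \<le> Re (B w w)" "Re (B w w) < 1" using psd_on_diag(2)[OF B_psd w] B_diag[OF w] by auto
  have *: "(\<lambda>z. b z * f z) \<in> H \<and> nrm (\<lambda>z. b z * f z) \<le> sqrt (Re (B w w)) * nrm f" if f: "f \<in> H" for f
  proof -
    have eq: "(\<lambda>z. \<Sum>j<(1::nat). B z w * f z) = (\<lambda>z. b z * f z)"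
      using H_off[OF f] by (auto simp: b_def fun_eq_iff)
    have H: "(\<lambda>z. b z * f z) \<in> H" using row_contraction(1)[of 1 "\<lambda>_. w" "\<lambda>_. f"] w f unfolding eq by blast
    have "(nrm (\<lambda>z. b z * f z))\<^sup>2 \<le> Re (B w w) * (nrm f)\<^sup>2"
    proof -
      have "Re (\<Sum>i<(1::nat). \<Sum>j<(1::nat). B w w * inn f f) = Re (B w w) * (nrm f)\<^sup>2"
        by (simp add: inn_self[OF f])
      then show ?thesis using row_contraction(2)[of 1 "\<lambda>_. w" "\<lambda>_. f"] w f unfolding eq by simp
    qed
    then have "(nrm (\<lambda>z. b z * f z))\<^sup>2 \<le> (sqrt (Re (B w w)) * nrm f)\<^sup>2" using Bw by (simp add: power_mult_distrib)
    then show ?thesis using H nrm_nonneg[OF f] Bw by (auto intro: power2_le_imp_le)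
  qed
  have bM: "b \<in> M" by (rule MI) (use * in \<open>auto simp: b_def\<close>)
  have "mbound b (sqrt (Re (B w w)))" using * Bw by (simp add: mbound_def)
  from Neumann_inverse(1)[OF bM this] Bw
  have "(\<lambda>z. if z \<in> X then 1 / (1 - b z) else 0) \<in> M" by simp
  moreover have "(\<lambda>z. if z \<in> X then 1 / (1 - b z) else 0) = kern [(1, w)]"
    using w by (auto simp: fun_eq_iff b_def kern_Cons B_def)
  ultimately show ?thesis by simp
qed

lemma kern_M:
  assumes "v \<in> V"
  shows "kern v \<in> M"
  using assms
proof (induction v)
  case (Cons p v)
  have "(\<lambda>z. fst p * kern [(1, snd p)] z + kern v z) \<in> M"
    using Cons by (intro M_add M_cmult kern_point_M) auto
  moreover have "(\<lambda>z. fst p * kern [(1, snd p)] z + kern v z) = kern (p # v)"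
    by (auto simp: fun_eq_iff kern_def split_def)
  ultimately show ?case by simp
qed simp

end

section \<open>Sarason functions and the column factorization\<close>

context rkhs
begin

lemma variational_approx:
  assumes "f \<in> H" "e > 0"
  obtains v where "v \<in> V" "(nrm f)\<^sup>2 - e < 2 * Re (ev f v) - Q v"
proof -
  have "\<exists>v\<in>V. (nrm f)\<^sup>2 - e < 2 * Re (ev f v) - Q v"
  proof (rule ccontr)
    assume "\<not> ?thesis"
    then have "(nrm f)\<^sup>2 \<le> (nrm f)\<^sup>2 - e"
      by (intro variational_ge(2) H_off[OF assms(1)]) (auto simp: not_less simp del: in_lists_conv_set)
    then show False using assms(2) by simp
  qed
  then show ?thesis using that by blast
qed

text \<open>Bounding the entries separately would lose the sum. Instead each squared norm is
  replaced by one nearly optimal variational expression, and the finite sum of these is continuous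
  under pointwise convergence. The bound is asked only from \<open>m\<close> on, since the
  \<open>n\<close>-th approximation of a column controls just its first \<open>n\<close>
  entries.\<close>

lemma sum_nrm_sq_pointwise_limit:
  fixes f :: "nat \<Rightarrow> nat \<Rightarrow> 'a \<Rightarrow> complex"
  assumes fH: "\<And>n l. f n l \<in> H" and gH: "\<And>l. g l \<in> H"
    and lim: "\<And>l z. z \<in> X \<Longrightarrow> (\<lambda>n. f n l z) \<longlonglongrightarrow> g l z"
    and le: "\<And>n. n \<ge> m \<Longrightarrow> (\<Sum>l<N. (nrm (f n l))\<^sup>2) \<le> R"
  shows "(\<Sum>l<N. (nrm (g l))\<^sup>2) \<le> R"
proof (rule field_le_epsilon)
  fix e :: real assume e: "e > 0"
  define d where "d = e / (real N + 1)"
  have d: "d > 0" "real N * d \<le> e" using e by (simp_all add: d_def field_simps)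
  have "\<forall>l. \<exists>v\<in>V. (nrm (g l))\<^sup>2 - d < 2 * Re (ev (g l) v) - Q v"
  proof
    fix l
    obtain v where "v \<in> V" "(nrm (g l))\<^sup>2 - d < 2 * Re (ev (g l) v) - Q v"
      by (rule variational_approx[OF gH d(1)]) (rule that)
    then show "\<exists>v\<in>V. (nrm (g l))\<^sup>2 - d < 2 * Re (ev (g l) v) - Q v" by blast
  qed
  then obtain v where v: "\<And>l. v l \<in> V" "\<And>l. (nrm (g l))\<^sup>2 - d < 2 * Re (ev (g l) (v l)) - Q (v l)" by metis
  have "(\<lambda>n. \<Sum>l<N. 2 * Re (ev (f n l) (v l)) - Q (v l)) \<longlonglongrightarrow> (\<Sum>l<N. 2 * Re (ev (g l) (v l)) - Q (v l))"
    using v(1) by (intro tendsto_sum tendsto_diff tendsto_mult tendsto_const tendsto_Re tendsto_ev lim)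
      (auto simp: in_lists_conv_set)
  moreover have "(\<Sum>l<N. 2 * Re (ev (f n l) (v l)) - Q (v l)) \<le> R" if "n \<ge> m" for n
    by (rule order_trans[OF sum_mono le[OF that]]) (intro variational_le fH v)
  ultimately have "(\<Sum>l<N. 2 * Re (ev (g l) (v l)) - Q (v l)) \<le> R"
    by (intro LIMSEQ_le_const2) auto
  moreover have "(\<Sum>l<N. (nrm (g l))\<^sup>2 - d) \<le> (\<Sum>l<N. 2 * Re (ev (g l) (v l)) - Q (v l))"
    by (intro sum_mono less_imp_le v)
  ultimately show "(\<Sum>l<N. (nrm (g l))\<^sup>2) \<le> R + e" using d(2) by (simp add: sum_subtractf)
qed

lemma inn_diff_bound:
  assumes "a \<in> H" "b \<in> H" "a' \<in> H" "b' \<in> H"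
  shows "cmod (inn a b - inn a' b') \<le> nrm (\<lambda>z. a z - a' z) * nrm b + nrm a' * nrm (\<lambda>z. b z - b' z)"
proof -
  have "inn a b - inn a' b' = inn (\<lambda>z. a z - a' z) b + inn a' (\<lambda>z. b z - b' z)"
    using assms by (simp add: inn_diff_left inn_diff_right)
  also have "cmod \<dots> \<le> cmod (inn (\<lambda>z. a z - a' z) b) + cmod (inn a' (\<lambda>z. b z - b' z))"
    by (rule norm_triangle_ineq)
  also have "\<dots> \<le> nrm (\<lambda>z. a z - a' z) * nrm b + nrm a' * nrm (\<lambda>z. b z - b' z)"
    by (intro add_mono inn_le H_diff assms)
  finally show ?thesis .
qed

lemma tendsto_nrm:
  assumes "\<And>n. a n \<in> H" "a' \<in> H" "(\<lambda>n. nrm (\<lambda>z. a n z - a' z)) \<longlonglongrightarrow> 0"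
  shows "(\<lambda>n. nrm (a n)) \<longlonglongrightarrow> nrm a'"
proof -
  have "(\<lambda>n. nrm (a n) - nrm a') \<longlonglongrightarrow> 0"
    by (rule Lim_null_comparison[OF _ assms(3)]) (use nrm_diff_abs[OF assms(1,2)] in auto)
  then show ?thesis by (simp add: LIM_zero_iff)
qed

lemma tendsto_inn:
  assumes "\<And>n. a n \<in> H" "a' \<in> H" "(\<lambda>n. nrm (\<lambda>z. a n z - a' z)) \<longlonglongrightarrow> 0"
    and "\<And>n. b n \<in> H" "b' \<in> H" "(\<lambda>n. nrm (\<lambda>z. b n z - b' z)) \<longlonglongrightarrow> 0"
  shows "(\<lambda>n. inn (a n) (b n)) \<longlonglongrightarrow> inn a' b'"
proof -
  have "(\<lambda>n. nrm (\<lambda>z. a n z - a' z) * nrm (b n) + nrm a' * nrm (\<lambda>z. b n z - b' z)) \<longlonglongrightarrow> 0 * nrm b' + nrm a' * 0"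
    by (intro tendsto_add tendsto_mult tendsto_const assms tendsto_nrm)
  then have lim: "(\<lambda>n. nrm (\<lambda>z. a n z - a' z) * nrm (b n) + nrm a' * nrm (\<lambda>z. b n z - b' z)) \<longlonglongrightarrow> 0" by simp
  have "(\<lambda>n. inn (a n) (b n) - inn a' b') \<longlonglongrightarrow> 0"
    by (rule Lim_null_comparison[OF _ lim]) (intro always_eventually allI inn_diff_bound assms)
  then show ?thesis by (simp add: LIM_zero_iff)
qed

lemma tendsto_mult_nrm:
  assumes "\<phi> \<in> M" "\<And>n. a n \<in> H" "a' \<in> H" "(\<lambda>n. nrm (\<lambda>z. a n z - a' z)) \<longlonglongrightarrow> 0"
  shows "(\<lambda>n. nrm (\<lambda>z. \<phi> z * a n z - \<phi> z * a' z)) \<longlonglongrightarrow> 0"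
proof (rule Lim_null_comparison)
  show "(\<lambda>n. mnorm \<phi> * nrm (\<lambda>z. a n z - a' z)) \<longlonglongrightarrow> 0"
    using tendsto_mult_left[OF assms(4), of "mnorm \<phi>"] by simp
  have "norm (nrm (\<lambda>z. \<phi> z * a n z - \<phi> z * a' z)) \<le> mnorm \<phi> * nrm (\<lambda>z. a n z - a' z)" for n
    using nrm_mult_le[OF assms(1) H_diff[OF assms(2,3)], of n] nrm_nonneg[OF M_H[OF assms(1) H_diff[OF assms(2,3)]], of n]
    by (simp add: right_diff_distrib)
  then show "\<forall>\<^sub>F n in sequentially. norm (nrm (\<lambda>z. \<phi> z * a n z - \<phi> z * a' z)) \<le> mnorm \<phi> * nrm (\<lambda>z. a n z - a' z)"
    by simp
qed

text \<open>With \<open>c\<close> the squared norm of \<open>f\<close>, the kernel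
  \<open>c k - (\<phi> f) cnj (\<phi> f)\<close> is the sum of
  \<open>c k (1 - \<phi> cnj \<phi>)\<close> and of \<open>c k - f cnj f\<close> multiplied by
  \<open>\<phi> cnj \<phi>\<close>.\<close>

lemma contractive_multiplier:
  assumes off: "\<And>z. z \<notin> X \<Longrightarrow> \<phi> z = 0" and "psd_on X (\<lambda>z w. k z w * (1 - \<phi> z * cnj (\<phi> w)))"
  shows "\<phi> \<in> M" "mbound \<phi> 1"
proof -
  have main: "(\<lambda>z. \<phi> z * f z) \<in> H \<and> nrm (\<lambda>z. \<phi> z * f z) \<le> nrm f" if f: "f \<in> H" for f
  proof -
    have "psd_on X (\<lambda>z w. of_real ((nrm f)\<^sup>2) * k z w - f z * cnj (f w))"
      unfolding bound_iff'[OF nrm_nonneg[OF f]] using ev_le_nrm[OF f] by blast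
    from psd_on_add[OF psd_on_scale[OF assms(2), of "(nrm f)\<^sup>2"] psd_on_congruence[OF this, of \<phi>]]
    have "psd_on X (\<lambda>z w. of_real ((nrm f)\<^sup>2) * k z w - (\<phi> z * f z) * cnj (\<phi> w * f w))"
      by (rule psd_on_cong) (simp_all add: algebra_simps)
    then have "\<forall>v\<in>V. cmod (ev (\<lambda>z. \<phi> z * f z) v) \<le> nrm f * sqrt (Q v)"
      unfolding bound_iff'[OF nrm_nonneg[OF f]] .
    then show ?thesis
      using nrm_le[of "\<lambda>z. \<phi> z * f z" "nrm f"] off nrm_nonneg[OF f] by (simp del: in_lists_conv_set)
  qed
  show "\<phi> \<in> M" by (rule MI) (use main off in auto)
  show "mbound \<phi> 1" using main by (simp add: mbound_def)
qed

end

context pick_space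
begin

abbreviation "K w \<equiv> kern [(1, w)]"

lemma K_apply: "z \<in> X \<Longrightarrow> K w z = k z w"
  by (simp add: kern_Cons)

lemma KF_H [intro]: "w \<in> X \<Longrightarrow> F \<in> H \<Longrightarrow> (\<lambda>z. K w z * F z) \<in> H"
  by (intro M_H kern_point_M)

text \<open>Modulo the Schur factor \<open>k\<close> this is the row contraction applied to \<open>(k\<^sub>w - 1) F = B\<^sub>w k\<^sub>w F\<close>.\<close>
lemma Sarason_kernel_psd:
  assumes F: "F \<in> H"
  defines "s \<equiv> \<lambda>w. inn F (\<lambda>z. K w z * F z)"
  shows "psd_on X (\<lambda>z w. k z w * (s z + cnj (s w) - of_real ((nrm F)\<^sup>2)) - inn (\<lambda>y. K w y * F y) (\<lambda>y. K z y * F y))"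
proof -
  define G where "G z w = inn (\<lambda>y. K w y * F y) (\<lambda>y. K z y * F y)" for z w
  define E where "E z w = inn (\<lambda>y. K w y * F y - F y) (\<lambda>y. K z y * F y - F y)" for z w
  have "psd_on X (\<lambda>z w. B z w * G z w - E z w)"
  proof (rule psd_onI)
    fix n :: nat and x c assume x: "\<And>i. i < n \<Longrightarrow> x i \<in> X"
    define h where "h j = (\<lambda>z. c j * (K (x j) z * F z))" for j
    have hH: "h j \<in> H" if "j < n" for j unfolding h_def by (intro H_cmult KF_H x that F)
    have dH: "(\<lambda>y. K (x j) y * F y - F y) \<in> H" if "j < n" for j by (intro H_diff KF_H x that F)
    have 1: "hform n c (\<lambda>i j. B (x i) (x j) * G (x i) (x j)) = (\<Sum>i<n. \<Sum>j<n. B (x i) (x j) * inn (h j) (h i))"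
      unfolding hform_def G_def h_def using x F
      by (intro sum.cong refl) (simp add: inn_cmult_left inn_cmult_right KF_H H_cmult)
    have 2: "hform n c (\<lambda>i j. E (x i) (x j)) = of_real ((nrm (\<lambda>z. \<Sum>j<n. B z (x j) * h j z))\<^sup>2)"
    proof -
      let ?T = "\<lambda>z. \<Sum>j<n. c j * (K (x j) z * F z - F z)"
      have "hform n c (\<lambda>i j. E (x i) (x j)) = (\<Sum>i<n. \<Sum>j<n. inn (\<lambda>z. c j * (K (x j) z * F z - F z)) (\<lambda>z. c i * (K (x i) z * F z - F z)))"
        unfolding hform_def E_def
        by (intro sum.cong refl) (simp add: inn_cmult_left inn_cmult_right dH H_cmult)
      also have "\<dots> = (\<Sum>i<n. inn ?T (\<lambda>z. c i * (K (x i) z * F z - F z)))"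
        by (intro sum.cong refl inn_sum_left[symmetric]) (auto intro!: H_cmult dH)
      also have "\<dots> = inn ?T ?T"
        by (intro inn_sum_right[symmetric] H_sum) (auto intro!: H_cmult dH)
      also have "\<dots> = of_real ((nrm ?T)\<^sup>2)"
        by (intro inn_self H_sum) (auto intro!: H_cmult dH)
      also have "?T = (\<lambda>z. \<Sum>j<n. B z (x j) * h j z)"
      proof (rule ext, intro sum.cong refl)
        fix z j assume "j \<in> {..<n}"
        then have xj: "x j \<in> X" using x by simp
        show "c j * (K (x j) z * F z - F z) = B z (x j) * h j z"
        proof (cases "z \<in> X")
          case True
          have "K (x j) z * F z - F z = (B z (x j) * k z (x j)) * F z"
            unfolding k_eq[OF True xj] by (simp add: K_apply[OF True] algebra_simps)
          then show ?thesis by (simp add: h_def K_apply[OF True])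
        qed (simp add: h_def H_off[OF F])
      qed
      finally show ?thesis .
    qed
    \<comment> \<open>\<open>Gram_psd\<close> wants a vector of \<open>H\<close> at every index,
      hence the zero function beyond \<open>n\<close>.\<close>
    have "psd_on {..<n} (\<lambda>i j. B (x i) (x j) * inn (\<lambda>y. (if j < n then K (x j) y * F y else 0)) (\<lambda>y. (if i < n then K (x i) y * F y else 0)))"
    proof (intro Schur_product psd_on_compose[OF B_psd] Gram_psd)
      show "(\<lambda>y. if j < n then K (x j) y * F y else 0) \<in> H" for j
        by (cases "j < n") (simp_all add: KF_H F x)
    qed (use x in auto)
    from psd_onD[OF this, of n "\<lambda>i. i" c]
    have "hform n c (\<lambda>i j. B (x i) (x j) * G (x i) (x j)) \<in> \<real>\<^sub>\<ge>\<^sub>0"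
      using hform_cong[of n "\<lambda>i j. B (x i) (x j) * inn (\<lambda>y. (if j < n then K (x j) y * F y else 0)) (\<lambda>y. (if i < n then K (x i) y * F y else 0))" "\<lambda>i j. B (x i) (x j) * G (x i) (x j)" c]
      by (simp add: G_def)
    then show "hform n c (\<lambda>i j. B (x i) (x j) * G (x i) (x j) - E (x i) (x j)) \<in> \<real>\<^sub>\<ge>\<^sub>0"
      using row_contraction(2)[of n x h, OF x hH] unfolding hform_diff complex_nonneg_Reals_iff 2
      by (simp add: 1)
  qed
  \<comment> \<open>Multiplying by \<open>k\<close> replaces \<open>B k\<close> by
    \<open>k - 1\<close>. The terms \<open>k G\<close> from \<open>B G\<close> and from the
    expansion of \<open>E\<close> then cancel and leave the claimed kernel.\<close>
  from Schur_product[OF psd this] show ?thesis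
  proof (rule psd_on_cong)
    fix z w assume zw: "z \<in> X" "w \<in> X"
    have Ezw: "E z w = G z w - cnj (s w) - s z + of_real ((nrm F)\<^sup>2)"
      unfolding E_def G_def s_def using zw F
      by (simp add: inn_diff_left inn_diff_right KF_H H_diff inn_self inn_cnj[of F "\<lambda>y. K w y * F y"])
    have "k z w * (B z w * G z w - E z w) = (B z w * k z w) * G z w - k z w * (G z w - cnj (s w) - s z + of_real ((nrm F)\<^sup>2))"
      unfolding Ezw by (simp add: algebra_simps)
    also have "\<dots> = k z w * (s z + cnj (s w) - of_real ((nrm F)\<^sup>2)) - G z w"
      unfolding k_eq[OF zw] by (simp add: algebra_simps)
    finally show "k z w * (B z w * G z w - E z w) = k z w * (s z + cnj (s w) - of_real ((nrm F)\<^sup>2)) - inn (\<lambda>y. K w y * F y) (\<lambda>y. K z y * F y)"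
      by (simp add: G_def)
  qed
qed

text \<open>The additive constant makes \<open>sar n F z + cnj (sar n F w) - 1\<close> the sum of
  the kernels from \<open>Sarason_kernel_psd\<close>, whatever the norms of the \<open>F l\<close>
  are.\<close>

definition sar :: "nat \<Rightarrow> (nat \<Rightarrow> 'a \<Rightarrow> complex) \<Rightarrow> 'a \<Rightarrow> complex" where
  "sar n F w = (\<Sum>l<n. inn (F l) (\<lambda>z. K w z * F l z)) + of_real ((1 - (\<Sum>l<n. (nrm (F l))\<^sup>2)) / 2)"

lemma sar_psd:
  assumes F: "\<And>l. F l \<in> H"
  shows "psd_on X (\<lambda>z w. k z w * (sar n F z + cnj (sar n F w) - 1) - (\<Sum>l<n. inn (\<lambda>y. K w y * F l y) (\<lambda>y. K z y * F l y)))"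
proof (rule psd_on_cong)
  show "psd_on X (\<lambda>z w. \<Sum>l<n. k z w * (inn (F l) (\<lambda>y. K z y * F l y) + cnj (inn (F l) (\<lambda>y. K w y * F l y)) - of_real ((nrm (F l))\<^sup>2)) - inn (\<lambda>y. K w y * F l y) (\<lambda>y. K z y * F l y))"
    by (intro psd_on_sum Sarason_kernel_psd F)
  fix z w assume "z \<in> X" "w \<in> X"
  have "sar n F z + cnj (sar n F w) - 1 = (\<Sum>l<n. inn (F l) (\<lambda>y. K z y * F l y)) + (\<Sum>l<n. cnj (inn (F l) (\<lambda>y. K w y * F l y))) - (\<Sum>l<n. of_real ((nrm (F l))\<^sup>2))"
    by (simp add: sar_def field_simps cnj_sum)
  then show "(\<Sum>l<n. k z w * (inn (F l) (\<lambda>y. K z y * F l y) + cnj (inn (F l) (\<lambda>y. K w y * F l y)) - of_real ((nrm (F l))\<^sup>2)) - inn (\<lambda>y. K w y * F l y) (\<lambda>y. K z y * F l y))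
     = k z w * (sar n F z + cnj (sar n F w) - 1) - (\<Sum>l<n. inn (\<lambda>y. K w y * F l y) (\<lambda>y. K z y * F l y))"
    by (simp only: sum_subtractf sum.distrib sum_distrib_left[symmetric])
qed

lemma KF_Gram_psd:
  assumes "F \<in> H"
  shows "psd_on X (\<lambda>z w. inn (\<lambda>y. K w y * F y) (\<lambda>y. K z y * F y))"
proof (rule psd_on_cong)
  show "psd_on X (\<lambda>z w. inn (\<lambda>y. (if w \<in> X then K w y * F y else 0)) (\<lambda>y. (if z \<in> X then K z y * F y else 0)))"
  proof (rule Gram_psd)
    show "(\<lambda>y. if z \<in> X then K z y * F y else 0) \<in> H" for z
      by (cases "z \<in> X") (simp_all add: KF_H assms)
  qed
qed simp

text \<open>This is the diagonal of \<open>sar_psd\<close>. The half-plane found here is the one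
  mapped into the closed unit disc by \<open>s \<mapsto> 1 - 1 / s\<close>.\<close>

lemma sar_Re:
  assumes F: "\<And>l. F l \<in> H" and z: "z \<in> X"
  shows "1/2 \<le> Re (sar n F z)"
proof -
  define G where "G = (\<Sum>l<n. (nrm (\<lambda>y. K z y * F l y))\<^sup>2)"
  have G: "(\<Sum>l<n. inn (\<lambda>y. K z y * F l y) (\<lambda>y. K z y * F l y)) = of_real G"
    using KF_H[OF z F] by (simp add: inn_self G_def)
  have "0 \<le> Re (k z z * (sar n F z + cnj (sar n F z) - 1) - of_real G)"
    using psd_on_diag(2)[OF sar_psd[of F n, OF F] z] unfolding G .
  also have "\<dots> = Re (k z z) * (2 * Re (sar n F z) - 1) - G"
    by (subst k_diag[OF z]) simp
  finally have "0 \<le> Re (k z z) * (2 * Re (sar n F z) - 1)"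
    using sum_nonneg[of "{..<n}" "\<lambda>l. (nrm (\<lambda>y. K z y * F l y))\<^sup>2"] by (simp add: G_def)
  then show ?thesis using k_pos[OF z] by (simp add: zero_le_mult_iff)
qed

definition isar :: "nat \<Rightarrow> (nat \<Rightarrow> 'a \<Rightarrow> complex) \<Rightarrow> 'a \<Rightarrow> complex" where
  "isar n F = (\<lambda>z. if z \<in> X then 1 / sar n F z else 0)"

lemma sar_nz: "(\<And>l. F l \<in> H) \<Longrightarrow> z \<in> X \<Longrightarrow> sar n F z \<noteq> 0"
  using sar_Re[of F z n] by auto

text \<open>With \<open>\<psi> = 1 - 1 / s\<close>, the kernel
  \<open>k (1 - \<psi> cnj \<psi>)\<close> is \<open>k (s + cnj s - 1)\<close> divided by
  \<open>s cnj s\<close>; the numerator is positive, being a Gram kernel plus the kernel of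
  \<open>sar_psd\<close>.\<close>

lemma isar_contractive:
  assumes F: "\<And>l. F l \<in> H"
  shows "(\<lambda>z. one z - isar n F z) \<in> M" "mbound (\<lambda>z. one z - isar n F z) 1"
proof -
  let ?\<psi> = "\<lambda>z. one z - isar n F z"
  have "psd_on X (\<lambda>z w. isar n F z * cnj (isar n F w) *
      ((k z w * (sar n F z + cnj (sar n F w) - 1) - (\<Sum>l<n. inn (\<lambda>y. K w y * F l y) (\<lambda>y. K z y * F l y)))
        + (\<Sum>l<n. inn (\<lambda>y. K w y * F l y) (\<lambda>y. K z y * F l y))))"
    by (intro psd_on_congruence psd_on_add sar_psd psd_on_sum KF_Gram_psd F)
  then have "psd_on X (\<lambda>z w. k z w * (1 - ?\<psi> z * cnj (?\<psi> w)))"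
  proof (rule psd_on_cong)
    fix z w assume zw: "z \<in> X" "w \<in> X"
    define a b where "a = sar n F z" and "b = cnj (sar n F w)"
    have ab: "a \<noteq> 0" "b \<noteq> 0" using sar_nz[of F, OF F] zw by (simp_all add: a_def b_def)
    have "1 / a * (1 / b) * (k z w * (a + b - 1)) = k z w * (1 - (1 - 1 / a) * (1 - 1 / b))"
      using ab by (simp add: field_simps)
    then show "isar n F z * cnj (isar n F w) *
      ((k z w * (sar n F z + cnj (sar n F w) - 1) - (\<Sum>l<n. inn (\<lambda>y. K w y * F l y) (\<lambda>y. K z y * F l y)))
        + (\<Sum>l<n. inn (\<lambda>y. K w y * F l y) (\<lambda>y. K z y * F l y))) = k z w * (1 - ?\<psi> z * cnj (?\<psi> w))"
      using zw by (simp add: isar_def one_def a_def b_def)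
  qed
  then show "?\<psi> \<in> M" "mbound ?\<psi> 1"
    using contractive_multiplier[of ?\<psi>] by (auto simp: isar_def one_def)
qed

lemma kern_cnj_ev: "v \<in> V \<Longrightarrow> x \<in> X \<Longrightarrow> kern v x = cnj (ev (K x) v)"
  using ev_kern_herm[of v "[(1, x)]"] by (simp add: complex_eq_iff)

text \<open>For kernel combinations \<open>F l\<close> the function \<open>sar n F\<close> is itself a multiplier, so that the inequality
  encoded by positivity can be tested on \<open>g = (1 - \<psi>) h\<close>.\<close>
lemma sar_kern_M:
  assumes v: "\<And>l. v l \<in> V"
  obtains x where "x \<in> M" "\<And>z. z \<in> X \<Longrightarrow> x z = sar n (\<lambda>l. kern (v l)) z"
proof
  let ?x = "\<lambda>z. (\<Sum>l<n. kern (adj (kern (v l)) (v l)) z) + of_real ((1 - (\<Sum>l<n. (nrm (kern (v l)))\<^sup>2)) / 2) * one z"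
  show "?x \<in> M" by (intro M_add M_sum M_cmult kern_M adj_V v one_M)
  fix z assume z: "z \<in> X"
  have "inn (kern (v l)) (\<lambda>y. K z y * kern (v l) y) = kern (adj (kern (v l)) (v l)) z" for l
  proof -
    have "inn (kern (v l)) (\<lambda>y. K z y * kern (v l) y) = cnj (inn (\<lambda>y. K z y * kern (v l) y) (kern (v l)))"
      by (intro inn_cnj KF_H kern_H v z)
    also have "\<dots> = cnj (ev (\<lambda>y. K z y * kern (v l) y) (v l))"
      by (subst inn_kern) (intro KF_H kern_H v z refl)+
    also have "ev (\<lambda>y. K z y * kern (v l) y) (v l) = ev (K z) (adj (kern (v l)) (v l))"
      by (simp add: ev_adj mult.commute)
    finally show ?thesis using kern_cnj_ev[OF adj_V[OF v] z] by simp
  qed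
  then show "?x z = sar n (\<lambda>l. kern (v l)) z" using z by (simp add: sar_def one_def)
qed

text \<open>Tested on a vector \<open>g\<close>, the positivity of \<open>sar_psd\<close> reads: the
  sum of the squared norms of \<open>F l g\<close> is at most \<open>2 Re (inn (x g) g)\<close>
  minus the squared norm of \<open>g\<close>, where \<open>x\<close> is the multiplier
  \<open>sar n F\<close>. For \<open>g = h / x\<close> the right side is the squared norm of
  \<open>h\<close> minus that of \<open>h - g\<close>.\<close>

lemma isar_kern_column:
  assumes v: "\<And>l. v l \<in> V" and h: "h \<in> H"
  defines "F \<equiv> \<lambda>l. kern (v l)"
  shows "(\<Sum>l<n. (nrm (\<lambda>z. isar n F z * F l z * h z))\<^sup>2) \<le> (nrm h)\<^sup>2"
proof -
  have FH: "F l \<in> H" and FM: "F l \<in> M" for l unfolding F_def by (intro kern_H kern_M v)+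
  obtain x where x: "x \<in> M" "\<And>z. z \<in> X \<Longrightarrow> x z = sar n F z"
    by (rule sar_kern_M[of v n]) (use v F_def that in blast)+
  have ker: "(\<Sum>l<n. (nrm (\<lambda>z. F l z * kern u z))\<^sup>2) \<le> 2 * Re (inn (\<lambda>z. x z * kern u z) (kern u)) - (nrm (kern u))\<^sup>2"
    if u: "u \<in> V" for u
  proof -
    define m where "m = length u"
    define c p where "c l = fst (u ! l)" and "p l = snd (u ! l)" for l
    have uu: "u = map (\<lambda>l. (c l, p l)) [0..<m]" unfolding c_def p_def m_def by (rule list_as_upt)
    have pX: "p l \<in> X" if "l < m" for l using V_nth[OF u] that by (simp add: p_def m_def)
    have st: "kern [(c j, p j)] z = c j * K (p j) z" for j z by (simp add: kern_def)
    have ku: "kern u z = (\<Sum>j<m. c j * K (p j) z)" for z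
    proof -
      have "kern (map (\<lambda>l. (c l, p l)) [0..<m']) z = (\<Sum>j<m'. c j * K (p j) z)" for m'
        by (induction m') (simp_all add: kern_append st)
      then show ?thesis by (subst uu) 
    qed
    define S where "S = inn (\<lambda>z. x z * kern u z) (kern u)"
    have S: "S = hform m c (\<lambda>i j. k (p i) (p j) * sar n F (p i))"
    proof -
      have "S = ev (\<lambda>z. x z * kern u z) u"
        unfolding S_def by (intro inn_kern M_H x kern_H u)
      also have "\<dots> = (\<Sum>i<m. cnj (c i) * (x (p i) * kern u (p i)))"
        by (subst (2) uu) (rule ev_upt)
      also have "\<dots> = hform m c (\<lambda>i j. k (p i) (p j) * sar n F (p i))"
        unfolding hform_def ku using pX
        by (intro sum.cong refl) (simp add: x(2) K_apply sum_distrib_left mult_ac)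
      finally show ?thesis .
    qed
    have S': "cnj S = hform m c (\<lambda>i j. k (p i) (p j) * cnj (sar n F (p j)))"
      unfolding S hform_def cnj_sum
    proof (subst sum.swap, intro sum.cong refl)
      fix i j assume "i \<in> {..<m}" "j \<in> {..<m}"
      then have "k (p i) (p j) = cnj (k (p j) (p i))" by (intro k_herm pX) auto
      then show "cnj (cnj (c j) * c i * (k (p j) (p i) * sar n F (p j))) = cnj (c i) * c j * (k (p i) (p j) * cnj (sar n F (p j)))"
        by simp
    qed
    have Qu: "hform m c (\<lambda>i j. k (p i) (p j)) = of_real ((nrm (kern u))\<^sup>2)"
      unfolding nrm_kern[OF u] ev_kern_Q[OF u, symmetric] using ev_kern_upt[of m p c] pX by (simp add: uu[symmetric])
    have G: "hform m c (\<lambda>i j. inn (\<lambda>y. K (p j) y * F l y) (\<lambda>y. K (p i) y * F l y)) = of_real ((nrm (\<lambda>z. F l z * kern u z))\<^sup>2)" for l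
    proof -
      have "hform m c (\<lambda>i j. inn (\<lambda>y. K (p j) y * F l y) (\<lambda>y. K (p i) y * F l y))
        = (\<Sum>i<m. \<Sum>j<m. inn (\<lambda>y. c j * (K (p j) y * F l y)) (\<lambda>y. c i * (K (p i) y * F l y)))"
        unfolding hform_def using pX FH
        by (intro sum.cong refl) (simp add: inn_cmult_left inn_cmult_right KF_H H_cmult)
      also have "\<dots> = (\<Sum>i<m. inn (\<lambda>y. \<Sum>j<m. c j * (K (p j) y * F l y)) (\<lambda>y. c i * (K (p i) y * F l y)))"
        by (intro sum.cong refl inn_sum_left[symmetric] H_cmult KF_H FH) (use pX in auto)
      also have "\<dots> = inn (\<lambda>y. \<Sum>j<m. c j * (K (p j) y * F l y)) (\<lambda>y. \<Sum>j<m. c j * (K (p j) y * F l y))"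
        by (intro inn_sum_right[symmetric] H_sum H_cmult KF_H FH) (use pX in auto)
      also have "(\<lambda>y. \<Sum>j<m. c j * (K (p j) y * F l y)) = (\<lambda>z. F l z * kern u z)"
        by (simp add: fun_eq_iff ku sum_distrib_left mult_ac)
      also have "inn (\<lambda>z. F l z * kern u z) (\<lambda>z. F l z * kern u z) = of_real ((nrm (\<lambda>z. F l z * kern u z))\<^sup>2)"
        by (intro inn_self M_H FM kern_H u)
      finally show ?thesis .
    qed
    have hs: "hform m c (\<lambda>i j. \<Sum>l<n. A l i j) = (\<Sum>l<n. hform m c (A l))" for A
      by (induction n) (simp_all add: hform_add, simp add: hform_def)
    have "hform m c (\<lambda>i j. k (p i) (p j) * (sar n F (p i) + cnj (sar n F (p j)) - 1) - (\<Sum>l<n. inn (\<lambda>y. K (p j) y * F l y) (\<lambda>y. K (p i) y * F l y)))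
      = S + cnj S - of_real ((nrm (kern u))\<^sup>2) - (\<Sum>l<n. of_real ((nrm (\<lambda>z. F l z * kern u z))\<^sup>2))"
      by (simp only: right_diff_distrib distrib_left mult_1_right hform_diff hform_add hs S[symmetric] S'[symmetric] Qu G)
    then have "0 \<le> Re (S + cnj S - of_real ((nrm (kern u))\<^sup>2) - (\<Sum>l<n. of_real ((nrm (\<lambda>z. F l z * kern u z))\<^sup>2)))"
      using psd_onD[OF sar_psd[of F n, OF FH], of m p c] pX by (simp only: complex_nonneg_Reals_iff)
    then show ?thesis unfolding S_def[symmetric] by simp
  qed
  \<comment> \<open>Both sides are continuous in the norm of \<open>g\<close> because
    \<open>x\<close> and the \<open>F l\<close> are multipliers, which is why the \<open>F l\<close>
    are kernel combinations.\<close>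
  have gen: "(\<Sum>l<n. (nrm (\<lambda>z. F l z * g z))\<^sup>2) \<le> 2 * Re (inn (\<lambda>z. x z * g z) g) - (nrm g)\<^sup>2" if g: "g \<in> H" for g
  proof -
    obtain u where u: "\<And>i::nat. u i \<in> V" "(\<lambda>i. nrm (\<lambda>z. g z - kern (u i) z)) \<longlonglongrightarrow> 0"
      by (rule kern_approx[OF g]) (rule that)
    have lim: "(\<lambda>i. nrm (\<lambda>z. kern (u i) z - g z)) \<longlonglongrightarrow> 0"
      using u(2) nrm_minus_commute[OF g kern_H[OF u(1)]] by simp
    note uH = kern_H[OF u(1)]
    have "(\<lambda>i. \<Sum>l<n. (nrm (\<lambda>z. F l z * kern (u i) z))\<^sup>2) \<longlonglongrightarrow> (\<Sum>l<n. (nrm (\<lambda>z. F l z * g z))\<^sup>2)"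
      by (intro tendsto_sum tendsto_power tendsto_nrm tendsto_mult_nrm M_H FM uH g lim)
    moreover have "(\<lambda>i. 2 * Re (inn (\<lambda>z. x z * kern (u i) z) (kern (u i))) - (nrm (kern (u i)))\<^sup>2)
        \<longlonglongrightarrow> 2 * Re (inn (\<lambda>z. x z * g z) g) - (nrm g)\<^sup>2"
      by (intro tendsto_diff tendsto_mult tendsto_const tendsto_Re tendsto_inn tendsto_power tendsto_nrm tendsto_mult_nrm M_H x uH g lim)
    ultimately show ?thesis using ker[OF u(1)] by (intro LIMSEQ_le) auto
  qed
  let ?\<psi> = "\<lambda>z. one z - isar n F z"
  let ?g = "\<lambda>z. isar n F z * h z"
  have isM: "isar n F \<in> M" using M_diff[OF one_M isar_contractive(1)[of F n, OF FH]] by simp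
  have gH: "?g \<in> H" by (intro M_H isM h)
  have xg: "(\<lambda>z. x z * ?g z) = h"
    using H_off[OF h] sar_nz[of F, OF FH] by (auto simp: fun_eq_iff isar_def x(2))
  have "(\<Sum>l<n. (nrm (\<lambda>z. F l z * ?g z))\<^sup>2) \<le> 2 * Re (inn h ?g) - (nrm ?g)\<^sup>2"
    using gen[OF gH] unfolding xg .
  also have "\<dots> = (nrm h)\<^sup>2 - (nrm (\<lambda>z. h z - ?g z))\<^sup>2"
    using nrm_diff_sq[OF h gH] by simp
  also have "\<dots> \<le> (nrm h)\<^sup>2" by simp
  finally show ?thesis by (simp add: mult_ac)
qed

text \<open>The error \<open>1 / (n + 1)^2\<close> per entry is chosen against the \<open>n\<close>
  entries occurring in \<open>sar n\<close>: their total error is of order \<open>1 / n\<close>, so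
  \<open>sar n (G n)\<close> has the same limit as \<open>sar n F\<close>.\<close>

lemma sar_LIMSEQ:
  assumes F: "\<And>l. F l \<in> H" and sF: "summable (\<lambda>l. (nrm (F l))\<^sup>2)"
    and G: "\<And>n l. G n l \<in> H" and close: "\<And>n l. nrm (\<lambda>z. G n l z - F l z) \<le> inverse (real (Suc n)) ^ 2"
    and w: "w \<in> X"
  shows "convergent (\<lambda>n. sar n (G n) w)"
proof -
  define m where "m = mnorm (K w)"
  have KM: "K w \<in> M" by (rule kern_point_M[OF w])
  have m: "m \<ge> 0" unfolding m_def by (rule mnorm_nonneg[OF KM])
  have Kle: "nrm (\<lambda>z. K w z * f z) \<le> m * nrm f" if "f \<in> H" for f
    unfolding m_def by (rule nrm_mult_le[OF KM that])
  have sK: "summable (\<lambda>l. inn (F l) (\<lambda>z. K w z * F l z))"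
  proof (rule summable_comparison_test'[OF summable_mult[OF sF, of m], of 0])
    fix l
    have "cmod (inn (F l) (\<lambda>z. K w z * F l z)) \<le> nrm (F l) * (m * nrm (F l))"
      by (intro order_trans[OF inn_le mult_left_mono[OF Kle]] KF_H w F nrm_nonneg)
    then show "norm (inn (F l) (\<lambda>z. K w z * F l z)) \<le> m * (nrm (F l))\<^sup>2" by (simp add: power2_eq_square mult_ac)
  qed
  have L: "(\<lambda>n. sar n F w) \<longlonglongrightarrow> suminf (\<lambda>l. inn (F l) (\<lambda>z. K w z * F l z)) + of_real ((1 - suminf (\<lambda>l. (nrm (F l))\<^sup>2)) / 2)"
    unfolding sar_def
    by (rule tendsto_add[OF summable_LIMSEQ[OF sK] tendsto_of_real]) (intro tendsto_divide tendsto_diff tendsto_const summable_LIMSEQ sF, simp)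
  define R where "R = sqrt (suminf (\<lambda>l. (nrm (F l))\<^sup>2))"
  have R: "nrm (F l) \<le> R" for l
  proof -
    have "(\<Sum>i\<in>{l}. (nrm (F i))\<^sup>2) \<le> suminf (\<lambda>l. (nrm (F l))\<^sup>2)" by (rule sum_le_suminf[OF sF]) auto
    then show ?thesis unfolding R_def using nrm_nonneg[OF F] by (intro real_le_rsqrt) simp
  qed
  \<comment> \<open>The factor \<open>m\<close> accounts for the inner products and
    \<open>1/2\<close> for the additive constants in \<open>sar\<close>; \<open>2 * R + 1\<close>
    bounds a sum of two norms, since each approximant has norm at most \<open>R + 1\<close>.\<close>
  define c where "c = (m + 1/2) * (2 * R + 1)"
  have entry: "cmod (inn (G n l) (\<lambda>z. K w z * G n l z) - inn (F l) (\<lambda>z. K w z * F l z))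
      \<le> m * (2 * R + 1) * inverse (real (Suc n)) ^ 2 \<and> \<bar>(nrm (G n l))\<^sup>2 - (nrm (F l))\<^sup>2\<bar> \<le> (2 * R + 1) * inverse (real (Suc n)) ^ 2" for n l
  proof -
    define d where "d = nrm (\<lambda>z. G n l z - F l z)"
    have d: "0 \<le> d" "d \<le> inverse (real (Suc n)) ^ 2"
      unfolding d_def using close by (auto intro!: nrm_nonneg H_diff G F)
    have "inverse (real (Suc n)) ^ 2 \<le> 1" by (intro power_le_one) (auto simp: inverse_eq_divide)
    then have d1: "d \<le> 1" using d by linarith
    have dab: "\<bar>nrm (G n l) - nrm (F l)\<bar> \<le> d" unfolding d_def by (rule nrm_diff_abs[OF G F])
    then have nG: "nrm (G n l) \<le> R + 1" using R[of l] d1 by linarith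
    have KGF: "nrm (\<lambda>z. K w z * G n l z - K w z * F l z) \<le> m * d"
      using Kle[OF H_diff[OF G F], of n l l] by (simp add: d_def right_diff_distrib)
    have "cmod (inn (G n l) (\<lambda>z. K w z * G n l z) - inn (F l) (\<lambda>z. K w z * F l z))
      \<le> d * nrm (\<lambda>z. K w z * G n l z) + nrm (F l) * nrm (\<lambda>z. K w z * G n l z - K w z * F l z)"
      unfolding d_def by (intro inn_diff_bound KF_H w G F)
    also have "\<dots> \<le> d * (m * (R + 1)) + R * (m * d)"
    proof (rule add_mono)
      have "nrm (\<lambda>z. K w z * G n l z) \<le> m * (R + 1)" using Kle[OF G, of n l] mult_left_mono[OF nG m] by linarith
      then show "d * nrm (\<lambda>z. K w z * G n l z) \<le> d * (m * (R + 1))" by (intro mult_left_mono d)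
      have "0 \<le> R" using R[of l] nrm_nonneg[OF F, of l] by linarith
      then show "nrm (F l) * nrm (\<lambda>z. K w z * G n l z - K w z * F l z) \<le> R * (m * d)"
        by (intro mult_mono KGF R nrm_nonneg H_diff KF_H w G F)
    qed
    also have "\<dots> = m * (2 * R + 1) * d" by (simp add: algebra_simps)
    also have "\<dots> \<le> m * (2 * R + 1) * inverse (real (Suc n)) ^ 2"
      using m R[of l] nrm_nonneg[OF F, of l] d by (intro mult_left_mono) auto
    finally have 1: "cmod (inn (G n l) (\<lambda>z. K w z * G n l z) - inn (F l) (\<lambda>z. K w z * F l z)) \<le> m * (2 * R + 1) * inverse (real (Suc n)) ^ 2" .
    have "\<bar>(nrm (G n l))\<^sup>2 - (nrm (F l))\<^sup>2\<bar> = \<bar>nrm (G n l) + nrm (F l)\<bar> * \<bar>nrm (G n l) - nrm (F l)\<bar>"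
      by (simp add: abs_mult[symmetric] power2_eq_square algebra_simps)
    also have "\<dots> \<le> (2 * R + 1) * d"
      using nG R[of l] nrm_nonneg[OF F, of l] nrm_nonneg[OF G, of n l] dab by (intro mult_mono) auto
    also have "\<dots> \<le> (2 * R + 1) * inverse (real (Suc n)) ^ 2"
      using R[of l] nrm_nonneg[OF F, of l] d by (intro mult_left_mono) auto
    finally show ?thesis using 1 by simp
  qed
  have diff: "norm (sar n (G n) w - sar n F w) \<le> c * inverse (real (Suc n))" for n
  proof -
    let ?e = "inverse (real (Suc n)) ^ 2"
    have eq: "sar n (G n) w - sar n F w = (\<Sum>l<n. inn (G n l) (\<lambda>z. K w z * G n l z) - inn (F l) (\<lambda>z. K w z * F l z))
        - of_real ((\<Sum>l<n. (nrm (G n l))\<^sup>2 - (nrm (F l))\<^sup>2) / 2)"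
      by (simp add: sar_def sum_subtractf field_simps)
    have "norm (sar n (G n) w - sar n F w) \<le> norm (\<Sum>l<n. inn (G n l) (\<lambda>z. K w z * G n l z) - inn (F l) (\<lambda>z. K w z * F l z))
        + \<bar>\<Sum>l<n. (nrm (G n l))\<^sup>2 - (nrm (F l))\<^sup>2\<bar> / 2"
      unfolding eq by (rule order_trans[OF norm_triangle_ineq4]) (simp only: norm_of_real abs_divide abs_numeral order_refl)
    also have "\<dots> \<le> (\<Sum>l<n. m * (2 * R + 1) * ?e) + (\<Sum>l<n. (2 * R + 1) * ?e) / 2"
      using entry by (intro add_mono divide_right_mono order_trans[OF norm_sum sum_mono] order_trans[OF sum_abs sum_mono]) auto
    also have "\<dots> = real n * (c * ?e)" by (simp add: c_def algebra_simps)
    also have "\<dots> \<le> real (Suc n) * (c * ?e)"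
      using m R[of 0] nrm_nonneg[OF F, of 0] by (intro mult_right_mono) (auto simp: c_def)
    also have "\<dots> = c * inverse (real (Suc n))" by (simp add: power2_eq_square field_simps del: of_nat_Suc)
    finally show ?thesis .
  qed
  have "(\<lambda>n. c * inverse (real (Suc n))) \<longlonglongrightarrow> c * 0"
    by (intro tendsto_mult tendsto_const LIMSEQ_inverse_real_of_nat)
  then have z: "(\<lambda>n. c * inverse (real (Suc n))) \<longlonglongrightarrow> 0" by simp
  have "(\<lambda>n. sar n (G n) w - sar n F w) \<longlonglongrightarrow> 0"
    by (rule Lim_null_comparison[OF _ z]) (intro always_eventually allI diff)
  from tendsto_add[OF this L] show ?thesis by (auto simp: convergent_def)
qed

text \<open>A general \<open>F l\<close> is no multiplier, so \<open>isar_kern_column\<close> does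
  not apply to it. It is applied to kernel combinations \<open>G n l\<close>, and the resulting
  estimates pass to the pointwise limit. The bound \<open>Re \<ge> 1/2\<close> survives as well, so
  the limit of \<open>sar n (G n)\<close> has no zeros and \<open>1 - \<psi>\<close> is its
  reciprocal.\<close>

theorem column_factorization:
  assumes F: "\<And>l. F l \<in> H" and sF: "summable (\<lambda>l. (nrm (F l))\<^sup>2)"
  obtains \<psi> where "\<psi> \<in> M" "mbound \<psi> 1" "\<And>z. z \<in> X \<Longrightarrow> \<psi> z \<noteq> 1"
    "\<And>h l. h \<in> H \<Longrightarrow> (\<lambda>z. (one z - \<psi> z) * F l z * h z) \<in> H"
    "\<And>h N. h \<in> H \<Longrightarrow> (\<Sum>l<N. (nrm (\<lambda>z. (one z - \<psi> z) * F l z * h z))\<^sup>2) \<le> (nrm h)\<^sup>2"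
proof -
  define v where "v n l = (SOME v. v \<in> V \<and> nrm (\<lambda>z. kern v z - F l z) \<le> inverse (real (Suc n)) ^ 2)" for n l
  have "\<exists>v. v \<in> V \<and> nrm (\<lambda>z. kern v z - F l z) \<le> inverse (real (Suc n)) ^ 2" for n l
  proof -
    obtain v where v: "v \<in> V" "nrm (\<lambda>z. F l z - kern v z) < inverse (real (Suc n)) ^ 2"
      by (rule kern_dense[OF F, of "inverse (real (Suc n)) ^ 2" l]) (simp, rule that)
    then show ?thesis using nrm_minus_commute[OF F kern_H[OF v(1)], of l] by (intro exI[of _ v]) simp
  qed
  from someI_ex[OF this]
  have v: "v n l \<in> V" "nrm (\<lambda>z. kern (v n l) z - F l z) \<le> inverse (real (Suc n)) ^ 2" for n l
    unfolding v_def by blast+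
  define G where "G n l = kern (v n l)" for n l
  have G: "G n l \<in> H" for n l unfolding G_def by (intro kern_H v)
  have close: "nrm (\<lambda>z. G n l z - F l z) \<le> inverse (real (Suc n)) ^ 2" for n l unfolding G_def by (rule v)
  define x where "x z = lim (\<lambda>n. sar n (G n) z)" for z
  have x: "(\<lambda>n. sar n (G n) z) \<longlonglongrightarrow> x z" if "z \<in> X" for z
    unfolding x_def using sar_LIMSEQ[of F G z, OF F sF G close that] by (simp add: convergent_LIMSEQ_iff)
  have Rex: "1/2 \<le> Re (x z)" if "z \<in> X" for z
    by (rule LIMSEQ_le_const[OF tendsto_Re[OF x[OF that]]]) (use sar_Re[of "G _" z, OF G that] in blast)
  have xnz: "x z \<noteq> 0" if "z \<in> X" for z using Rex[OF that] by auto
  define ix where "ix = (\<lambda>z. if z \<in> X then 1 / x z else 0)"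
  define \<psi> where "\<psi> = (\<lambda>z. one z - ix z)"
  have ilim: "(\<lambda>n. isar n (G n) z) \<longlonglongrightarrow> ix z" if "z \<in> X" for z
    unfolding isar_def ix_def using that by (simp) (intro tendsto_intros x xnz)
  have G_lim: "(\<lambda>n. G n l z) \<longlonglongrightarrow> F l z" if z: "z \<in> X" for l z
  proof -
    have "(\<lambda>n. inverse (real (Suc n)) ^ 2 * sqrt (Re (k z z))) \<longlonglongrightarrow> 0 ^ 2 * sqrt (Re (k z z))"
      by (intro tendsto_mult tendsto_const tendsto_power LIMSEQ_inverse_real_of_nat)
    then have lim0: "(\<lambda>n. inverse (real (Suc n)) ^ 2 * sqrt (Re (k z z))) \<longlonglongrightarrow> 0" by simp
    have "cmod (G n l z - F l z) \<le> inverse (real (Suc n)) ^ 2 * sqrt (Re (k z z))" for n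
      using eval_le[OF H_diff[OF G F] z, of n l l] close[of n l] k_pos[OF z]
      by (meson less_imp_le mult_right_mono order_trans real_sqrt_ge_zero)
    then have "(\<lambda>n. G n l z - F l z) \<longlonglongrightarrow> 0"
      by (intro Lim_null_comparison[OF _ lim0]) auto
    then show ?thesis by (simp add: LIM_zero_iff)
  qed
  have off: "ix z = 0" "\<psi> z = 0" if "z \<notin> X" for z using that by (simp_all add: ix_def \<psi>_def one_def)
  have psi: "(\<lambda>z. \<psi> z * h z) \<in> H \<and> nrm (\<lambda>z. \<psi> z * h z) \<le> 1 * nrm h" if h: "h \<in> H" for h
  proof -
    have c: "(\<lambda>z. (one z - isar n (G n) z) * h z) \<in> H" "nrm (\<lambda>z. (one z - isar n (G n) z) * h z) \<le> 1 * nrm h" for n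
      using M_H[OF isar_contractive(1)[of "G n" n, OF G] h] mboundD[OF isar_contractive(2)[of "G n" n, OF G] h] by auto
    have "(\<lambda>n. (one z - isar n (G n) z) * h z) \<longlonglongrightarrow> \<psi> z * h z" if "z \<in> X" for z
      unfolding \<psi>_def by (intro tendsto_intros ilim that)
    from H_pointwise_limit[of "\<lambda>n z. (one z - isar n (G n) z) * h z", OF c this] off(2)
    show ?thesis by simp
  qed
  have iM: "isar n (G n) \<in> M" for n
    using M_diff[OF one_M isar_contractive(1)[of "G n" n, OF G]] by simp
  have GM: "G n l \<in> M" for n l unfolding G_def by (intro kern_M v)
  have fH: "(\<lambda>z. isar n (G n) z * G n l z * h z) \<in> H" if "h \<in> H" for h n l
    by (rule M_H[OF M_mult[OF iM GM] that])
  have flim: "(\<lambda>n. isar n (G n) z * G n l z * h z) \<longlonglongrightarrow> ix z * F l z * h z" if "z \<in> X" for z l h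
    by (intro tendsto_mult tendsto_const ilim G_lim that)
  have col: "(\<Sum>l<n. (nrm (\<lambda>z. isar n (G n) z * G n l z * h z))\<^sup>2) \<le> (nrm h)\<^sup>2" if "h \<in> H" for h n
    using isar_kern_column[of "v n" h n, OF v(1) that] unfolding G_def .
  have colN: "(\<Sum>l<N. (nrm (\<lambda>z. isar n (G n) z * G n l z * h z))\<^sup>2) \<le> (nrm h)\<^sup>2" if "h \<in> H" "n \<ge> N" for h n N
    by (rule order_trans[OF sum_mono2 col[OF that(1), of n]]) (use that in auto)
  \<comment> \<open>The sequence is shifted by \<open>Suc l\<close> because the column at stage
    \<open>n\<close> contains entry \<open>l\<close> only if \<open>l < n\<close>.\<close>
  have gH: "(\<lambda>z. ix z * F l z * h z) \<in> H" if h: "h \<in> H" for h l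
  proof (rule H_pointwise_limit(1))
    show "(\<lambda>z. isar (n + Suc l) (G (n + Suc l)) z * G (n + Suc l) l z * h z) \<in> H" for n by (rule fH[OF h])
    show "nrm (\<lambda>z. isar (n + Suc l) (G (n + Suc l)) z * G (n + Suc l) l z * h z) \<le> nrm h" for n
    proof -
      have "(\<Sum>i\<in>{l}. (nrm (\<lambda>z. isar (n + Suc l) (G (n + Suc l)) z * G (n + Suc l) i z * h z))\<^sup>2) \<le> (nrm h)\<^sup>2"
        by (rule order_trans[OF sum_mono2 col[OF h, of "n + Suc l"]]) auto
      then show ?thesis using nrm_nonneg[OF h] by (auto intro: power2_le_imp_le)
    qed
    show "(\<lambda>n. isar (n + Suc l) (G (n + Suc l)) z * G (n + Suc l) l z * h z) \<longlonglongrightarrow> ix z * F l z * h z" if "z \<in> X" for z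
      by (rule LIMSEQ_ignore_initial_segment[OF flim[OF that]])
  qed (simp add: off)
  have eq: "(\<lambda>z. (one z - \<psi> z) * F l z * h z) = (\<lambda>z. ix z * F l z * h z)" for l h by (simp add: \<psi>_def)
  show ?thesis
  proof (rule that)
    show "\<psi> \<in> M" by (rule MI) (use psi off in auto)
    show "mbound \<psi> 1" using psi by (simp add: mbound_def)
    show "\<psi> z \<noteq> 1" if "z \<in> X" for z using that xnz by (simp add: \<psi>_def one_def ix_def)
    show "(\<lambda>z. (one z - \<psi> z) * F l z * h z) \<in> H" if "h \<in> H" for h l unfolding eq by (rule gH[OF that])
    show "(\<Sum>l<N. (nrm (\<lambda>z. (one z - \<psi> z) * F l z * h z))\<^sup>2) \<le> (nrm h)\<^sup>2" if h: "h \<in> H" for h N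
      unfolding eq
      by (rule sum_nrm_sq_pointwise_limit[where f = "\<lambda>n l z. isar n (G n) z * G n l z * h z" and m = N])
        (auto intro!: fH gH flim colN h simp del: sum_mono2)
  qed
qed

end

section \<open>Characters of the multiplier algebra\<close>

context pick_space
begin

definition mideal :: "('a \<Rightarrow> complex) set \<Rightarrow> bool" where
  "mideal J \<longleftrightarrow> J \<subseteq> M \<and> (\<lambda>z. 0) \<in> J \<and> (\<forall>f\<in>J. \<forall>g\<in>J. (\<lambda>z. f z + g z) \<in> J) \<and>
     (\<forall>f\<in>J. \<forall>g\<in>M. (\<lambda>z. g z * f z) \<in> J)"

lemma M_eqI: "a \<in> M \<Longrightarrow> b \<in> M \<Longrightarrow> (\<And>z. z \<in> X \<Longrightarrow> a z = b z) \<Longrightarrow> a = b"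
  using M_off[of a] M_off[of b] by (metis ext)

lemma one_X [simp]: "z \<in> X \<Longrightarrow> one z = 1"
  by (simp add: one_def)

end

locale pick_ideal = pick_space +
  fixes J assumes ideal: "mideal J" and proper: "one \<notin> J"
begin

lemma JM: "f \<in> J \<Longrightarrow> f \<in> M"
  and J_zero: "(\<lambda>z. 0) \<in> J"
  and J_add: "f \<in> J \<Longrightarrow> g \<in> J \<Longrightarrow> (\<lambda>z. f z + g z) \<in> J"
  and J_mult: "g \<in> M \<Longrightarrow> f \<in> J \<Longrightarrow> (\<lambda>z. g z * f z) \<in> J"
  using ideal unfolding mideal_def by blast+

lemma J_cmult: "f \<in> J \<Longrightarrow> (\<lambda>z. c * f z) \<in> J"
proof -
  assume f: "f \<in> J"
  have "(\<lambda>z. (c * one z) * f z) \<in> J" by (intro J_mult M_cmult one_M f)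
  moreover have "(\<lambda>z. (c * one z) * f z) = (\<lambda>z. c * f z)"
    using M_off[OF JM[OF f]] by (auto simp: one_def fun_eq_iff)
  ultimately show ?thesis by simp
qed

lemma J_diff: "f \<in> J \<Longrightarrow> g \<in> J \<Longrightarrow> (\<lambda>z. f z - g z) \<in> J"
  using J_add[OF _ J_cmult, of f g "-1"] by simp

lemma J_sum: "(\<And>i. i \<in> A \<Longrightarrow> f i \<in> J) \<Longrightarrow> (\<lambda>z. \<Sum>i\<in>A. f i z) \<in> J"
  by (induction A rule: infinite_finite_induct) (simp_all add: J_zero J_add)

text \<open>The quotient seminorm modulo \<open>J\<close>. Elements of the quotient are never
  formed: equalities there are statements that a difference lies in \<open>J\<close>, and
  \<open>q_cong\<close> carries them over to \<open>q\<close>.\<close>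

definition q :: "('a \<Rightarrow> complex) \<Rightarrow> real" where
  "q g = Inf ((\<lambda>p. mnorm (\<lambda>z. g z - p z)) ` J)"

lemma q_lower: "g \<in> M \<Longrightarrow> p \<in> J \<Longrightarrow> q g \<le> mnorm (\<lambda>z. g z - p z)"
  unfolding q_def by (rule cINF_lower) (auto intro!: bdd_belowI2[of _ 0] mnorm_nonneg M_diff[OF _ JM])

lemma q_nonneg: "g \<in> M \<Longrightarrow> 0 \<le> q g"
  unfolding q_def by (rule cINF_greatest) (use J_zero in \<open>auto intro!: mnorm_nonneg M_diff[OF _ JM]\<close>)

lemma q_approx:
  assumes "g \<in> M" "e > 0"
  obtains p where "p \<in> J" "mnorm (\<lambda>z. g z - p z) < q g + e"
proof -
  have "\<exists>p\<in>J. mnorm (\<lambda>z. g z - p z) < q g + e"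
  proof (rule ccontr)
    assume "\<not> ?thesis"
    then have "q g + e \<le> q g" unfolding q_def by (intro cINF_greatest) (use J_zero in \<open>auto simp: not_less\<close>)
    then show False using assms(2) by simp
  qed
  then show ?thesis using that by blast
qed

lemma q_add:
  assumes "a \<in> M" "b \<in> M"
  shows "q (\<lambda>z. a z + b z) \<le> q a + q b"
proof (rule field_le_epsilon)
  fix e :: real assume "e > 0"
  then have e: "e / 2 > 0" by simp
  obtain p where p: "p \<in> J" "mnorm (\<lambda>z. a z - p z) < q a + e / 2" by (rule q_approx[OF assms(1) e])
  obtain r where r: "r \<in> J" "mnorm (\<lambda>z. b z - r z) < q b + e / 2" by (rule q_approx[OF assms(2) e])
  have "q (\<lambda>z. a z + b z) \<le> mnorm (\<lambda>z. a z + b z - (p z + r z))" by (intro q_lower M_add assms J_add p r)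
  also have "\<dots> = mnorm (\<lambda>z. (a z - p z) + (b z - r z))" by (simp add: algebra_simps)
  also have "\<dots> \<le> mnorm (\<lambda>z. a z - p z) + mnorm (\<lambda>z. b z - r z)" by (intro mnorm_add_le M_diff assms JM p r)
  finally show "q (\<lambda>z. a z + b z) \<le> q a + q b + e" using p r by simp
qed

lemma q_mult:
  assumes "a \<in> M" "b \<in> M"
  shows "q (\<lambda>z. a z * b z) \<le> q a * q b"
proof (rule LIMSEQ_le_const)
  show "(\<lambda>n. (q a + inverse (real (Suc n))) * (q b + inverse (real (Suc n)))) \<longlonglongrightarrow> q a * q b"
    using tendsto_mult[OF tendsto_add[OF tendsto_const LIMSEQ_inverse_real_of_nat] tendsto_add[OF tendsto_const LIMSEQ_inverse_real_of_nat], of "q a" "q b"]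
    by simp
  have "q (\<lambda>z. a z * b z) \<le> (q a + e) * (q b + e)" if e: "e > 0" for e
  proof -
    obtain p where p: "p \<in> J" "mnorm (\<lambda>z. a z - p z) < q a + e" by (rule q_approx[OF assms(1) e])
    obtain r where r: "r \<in> J" "mnorm (\<lambda>z. b z - r z) < q b + e" by (rule q_approx[OF assms(2) e])
    \<comment> \<open>This element of \<open>J\<close> is the difference between \<open>a b\<close>
      and \<open>(a - p) (b - r)\<close>.\<close>
    have "(\<lambda>z. (a z * r z + b z * p z) - p z * r z) \<in> J"
      by (intro J_diff J_add J_mult assms p r JM)
    from q_lower[OF M_mult[OF assms] this]
    have "q (\<lambda>z. a z * b z) \<le> mnorm (\<lambda>z. (a z - p z) * (b z - r z))" by (simp add: algebra_simps)
    also have "\<dots> \<le> mnorm (\<lambda>z. a z - p z) * mnorm (\<lambda>z. b z - r z)"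
      by (intro mnorm_mult_le M_diff assms JM p r)
    also have "\<dots> \<le> (q a + e) * (q b + e)"
      using p r e q_nonneg[OF assms(1)] by (intro mult_mono mnorm_nonneg M_diff assms JM) auto
    finally show ?thesis .
  qed
  then show "\<exists>N. \<forall>n\<ge>N. q (\<lambda>z. a z * b z) \<le> (q a + inverse (real (Suc n))) * (q b + inverse (real (Suc n)))"
    by (simp del: of_nat_Suc)
qed

lemma q_cmult:
  assumes "a \<in> M"
  shows "q (\<lambda>z. c * a z) \<le> cmod c * q a"
proof -
  have "mnorm one \<le> 1" by (rule mnorm_le[OF mbound_one])
  then have "mnorm (\<lambda>z. c * one z) \<le> cmod c"
    using mnorm_cmult_le[OF one_M, of c] mult_left_mono[of "mnorm one" 1 "cmod c"] by simp
  moreover have "q (\<lambda>z. c * one z) \<le> mnorm (\<lambda>z. c * one z)"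
    using q_lower[OF M_cmult[OF one_M] J_zero] by simp
  ultimately have c1: "q (\<lambda>z. c * one z) \<le> cmod c" by linarith
  have "(\<lambda>z. c * a z) = (\<lambda>z. (c * one z) * a z)"
    by (rule M_eqI) (use assms in \<open>auto intro!: M_mult M_cmult one_M\<close>)
  then have "q (\<lambda>z. c * a z) \<le> q (\<lambda>z. c * one z) * q a"
    using q_mult[OF M_cmult[OF one_M] assms] by simp
  also have "\<dots> \<le> cmod c * q a" by (intro mult_right_mono c1 q_nonneg assms)
  finally show ?thesis .
qed

lemma q_zero: "p \<in> J \<Longrightarrow> q p = 0"
proof -
  assume p: "p \<in> J"
  have "mnorm (\<lambda>z. 0) \<le> 0" by (rule mnorm_le) (simp add: mbound_def)
  then show ?thesis using q_lower[OF JM[OF p] p] q_nonneg[OF JM[OF p]] by simp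
qed

lemma q_cong:
  assumes "a \<in> M" "b \<in> M" "(\<lambda>z. a z - b z) \<in> J"
  shows "q a \<le> q b"
  using q_add[OF JM[OF assms(3)] assms(2)] q_zero[OF assms(3)] by simp

lemma q_sum_le: "(\<And>i. i \<in> A \<Longrightarrow> f i \<in> M) \<Longrightarrow> q (\<lambda>z. \<Sum>i\<in>A. f i z) \<le> (\<Sum>i\<in>A. q (f i))"
proof (induction A rule: infinite_finite_induct)
  case (insert i A)
  have "q (\<lambda>z. f i z + (\<Sum>i\<in>A. f i z)) \<le> q (f i) + q (\<lambda>z. \<Sum>i\<in>A. f i z)"
    using insert.prems by (intro q_add M_sum) auto
  then show ?case using insert by simp
qed (simp_all add: q_zero J_zero)

text \<open>An element of \<open>J\<close> closer than \<open>1\<close> to the unit would be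
  invertible by the Neumann series, and \<open>J\<close> would contain \<open>one\<close>.\<close>

lemma q_one: "1 \<le> q one"
proof (rule ccontr)
  assume "\<not> ?thesis"
  then have "(1 - q one) > 0" by simp
  then obtain p where p: "p \<in> J" "mnorm (\<lambda>z. one z - p z) < q one + (1 - q one)" by (rule q_approx[OF one_M])
  have d: "(\<lambda>z. one z - p z) \<in> M" by (intro M_diff one_M JM p)
  have C: "mnorm (\<lambda>z. one z - p z) < 1" using p(2) by simp
  let ?g = "\<lambda>z. if z \<in> X then 1 / (1 - (one z - p z)) else 0"
  have g: "?g \<in> M" by (rule Neumann_inverse(1)[OF d mbound_mnorm[OF d] C])
  have pnz: "p z \<noteq> 0" if "z \<in> X" for z
    using cmod_le_mnorm[OF d that] C that by auto
  have "(\<lambda>z. ?g z * p z) = one"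
    by (rule M_eqI) (use g JM[OF p(1)] pnz in \<open>auto intro!: M_mult\<close>)
  then have "one \<in> J" using J_mult[OF g p(1)] by simp
  then show False using proper by simp
qed

end

lemma sum_roots_of_unity:
  assumes "0 < j" "j < n"
  shows "(\<Sum>i<n. exp (2 * of_real pi * \<i> * of_nat i / of_nat n) ^ j) = (0::complex)"
proof -
  define r :: complex where "r = exp (2 * of_real pi * \<i> * of_nat j / of_nat n)"
  have "exp (2 * of_real pi * \<i> * of_nat i / of_nat n) ^ j = r ^ i" for i
    unfolding r_def exp_of_nat_mult[symmetric] by (simp add: mult_ac)
  moreover have "r \<noteq> 1" unfolding r_def
    using complex_root_unity_eq_1[of n j] assms by (auto dest: dvd_imp_le)
  moreover have "r ^ n = 1" unfolding r_def using assms by (intro complex_root_unity) simp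
  ultimately show ?thesis by (simp add: sum_gp_strict)
qed

context pick_ideal
begin

text \<open>Rickart's form of the Gelfand--Mazur argument: averaging \<open>(1 - \<omega> t f)\<^sup>-\<^sup>1\<close> over the \<open>n\<close>-th roots of unity \<open>\<omega>\<close>
  gives \<open>(1 - t\<^sup>n f\<^sup>n)\<^sup>-\<^sup>1\<close>. If the spectrum were empty, these averages would be equicontinuous in \<open>t\<close>,
  hence tend to \<open>1\<close> for all \<open>t\<close>, although they are small for large \<open>t\<close>.\<close>
lemma spectrum_nonempty:
  assumes f: "f \<in> M"
  shows "\<exists>c. \<forall>g\<in>M. (\<lambda>z. (f z - c * one z) * g z - one z) \<notin> J"
proof (rule ccontr)
  assume "\<not> ?thesis"
  then have inv: "\<exists>g\<in>M. (\<lambda>z. (f z - c * one z) * g z - one z) \<in> J" for c by blast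
  \<comment> \<open>Inverses of \<open>f - c\<close> are traded for inverses of
    \<open>1 - t f\<close>, which exist for \<open>t = 0\<close> too; \<open>S t\<close> is one
    choice of such an inverse modulo \<open>J\<close>.\<close>
  have "\<exists>g\<in>M. (\<lambda>z. (one z - t * f z) * g z - one z) \<in> J" for t
  proof (cases "t = 0")
    case True
    have "(\<lambda>z. (one z - t * f z) * one z - one z) = (\<lambda>z. 0)"
      using True by (intro M_eqI M_diff M_mult M_cmult one_M f M_zero) simp
    then show ?thesis using J_zero one_M by metis
  next
    case False
    obtain g where g: "g \<in> M" "(\<lambda>z. (f z - (1 / t) * one z) * g z - one z) \<in> J" using inv by blast
    have "(\<lambda>z. (one z - t * f z) * ((- 1 / t) * g z) - one z) = (\<lambda>z. (f z - (1 / t) * one z) * g z - one z)"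
      using False by (intro M_eqI M_diff M_mult M_cmult one_M f g) (simp add: field_simps)
    then have "(\<lambda>z. (one z - t * f z) * ((- 1 / t) * g z) - one z) \<in> J" using g(2) by (simp only:)
    then show ?thesis using M_cmult[OF g(1), of "- 1 / t"] by (intro bexI[of _ "\<lambda>z. (- 1 / t) * g z"])
  qed
  then have ex: "\<exists>g. g \<in> M \<and> (\<lambda>z. (one z - t * f z) * g z - one z) \<in> J" for t by blast
  define S where "S t = (SOME g. g \<in> M \<and> (\<lambda>z. (one z - t * f z) * g z - one z) \<in> J)" for t
  have S: "S t \<in> M" and SJ: "(\<lambda>z. (one z - t * f z) * S t z - one z) \<in> J" for t
    using someI_ex[OF ex[of t]] unfolding S_def[symmetric] by blast+
  \<comment> \<open>An inverse of \<open>f\<close> itself; it governs \<open>S t\<close> for large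
    \<open>t\<close>.\<close>
  obtain g0 where g0: "g0 \<in> M" "(\<lambda>z. (f z - 0 * one z) * g0 z - one z) \<in> J" using inv by blast

  define qf where "qf = q f"
  have qf: "qf \<ge> 0" unfolding qf_def by (rule q_nonneg[OF f])
  have resolvent: "q (\<lambda>z. S t z - S t' z) \<le> cmod (t - t') * (qf * (q (S t) * q (S t')))" for t t'
  proof -
    have "q (\<lambda>z. S t z - S t' z) \<le> q (\<lambda>z. (t - t') * (f z * (S t z * S t' z)))"
    proof (rule q_cong)
      have "(\<lambda>z. S t' z * ((one z - t * f z) * S t z - one z) - S t z * ((one z - t' * f z) * S t' z - one z)) \<in> J"
        by (intro J_diff J_mult S SJ)
      moreover have "(\<lambda>z. S t' z * ((one z - t * f z) * S t z - one z) - S t z * ((one z - t' * f z) * S t' z - one z))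
        = (\<lambda>z. S t z - S t' z - (t - t') * (f z * (S t z * S t' z)))"
        by (intro M_eqI M_diff M_mult M_cmult one_M f S) (simp add: algebra_simps)
      ultimately show "(\<lambda>z. S t z - S t' z - (t - t') * (f z * (S t z * S t' z))) \<in> J" by simp
    qed (intro M_diff M_mult M_cmult f S)+
    also have "\<dots> \<le> cmod (t - t') * q (\<lambda>z. f z * (S t z * S t' z))" by (intro q_cmult M_mult f S)
    also have "\<dots> \<le> cmod (t - t') * (qf * (q (S t) * q (S t')))"
      unfolding qf_def
      by (intro mult_left_mono order_trans[OF q_mult] q_mult q_nonneg M_mult f S) simp_all
    finally show ?thesis .
  qed
  \<comment> \<open>If \<open>t\<close> is so near to \<open>t'\<close> that the resolvent identity
    costs at most half of \<open>q (S t)\<close>, that half can be absorbed on the left. Compactness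
    of discs then gives uniform bounds.\<close>
  have loc: "q (S t) \<le> 2 * q (S t')" if "cmod (t - t') * qf * q (S t') \<le> 1/2" for t t'
  proof -
    have "q (\<lambda>z. (S t z - S t' z) + S t' z) \<le> q (\<lambda>z. S t z - S t' z) + q (S t')"
      by (intro q_add M_diff S)
    then have "q (S t) \<le> (cmod (t - t') * qf * q (S t')) * q (S t) + q (S t')"
      using resolvent[of t t'] by (simp add: mult_ac)
    also have "\<dots> \<le> (1/2) * q (S t) + q (S t')"
      by (intro add_right_mono mult_right_mono that q_nonneg S)
    finally show ?thesis by simp
  qed
  have bnd: "\<exists>R. \<forall>t\<in>cball 0 T. q (S t) \<le> R" for T
  proof -
    define d where "d t = 1 / (2 * (qf * q (S t) + 1))" for t
    have dpos: "d t > 0" for t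
      unfolding d_def using qf q_nonneg[OF S, of t] by (intro divide_pos_pos mult_pos_pos add_nonneg_pos mult_nonneg_nonneg) auto
    obtain C where C: "C \<subseteq> cball 0 T" "finite C" "cball 0 T \<subseteq> (\<Union>t\<in>C. ball t (d t))"
      by (rule compactE_image[OF compact_cball[of "0::complex" T], of "cball 0 T" "\<lambda>t. ball t (d t)"])
        (use dpos in auto)
    have "q (S t) \<le> (\<Sum>s\<in>C. 2 * q (S s))" if "t \<in> cball 0 T" for t
    proof -
      obtain s where s: "s \<in> C" "t \<in> ball s (d s)" using C(3) \<open>t \<in> cball 0 T\<close> by auto
      have nn: "0 \<le> qf * q (S s)" using qf q_nonneg[OF S] by simp
      have "cmod (t - s) * (qf * q (S s)) \<le> d s * (qf * q (S s) + 1)"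
        using s(2) nn less_imp_le[OF dpos[of s]] by (intro mult_mono) (auto simp: dist_norm norm_minus_commute)
      also have "\<dots> = 1/2" using nn by (simp add: d_def)
      finally have "q (S t) \<le> 2 * q (S s)" by (intro loc) (simp add: mult_ac)
      also have "\<dots> \<le> (\<Sum>s\<in>C. 2 * q (S s))"
        by (rule member_le_sum[OF s(1)]) (use q_nonneg[OF S] C(2) in auto)
      finally show ?thesis .
    qed
    then show ?thesis by blast
  qed

  \<comment> \<open>Modulo \<open>J\<close>, \<open>S t\<close> equals
    \<open>(1 / t) g0 (S t - 1)\<close>. For \<open>|t| = T\<close> this gives
    \<open>q (S t) \<le> (q (S t) + 1) / 4\<close>, hence the bound \<open>1/3\<close>.\<close>
  define T where "T = 4 * q g0 + 1"
  have T: "T > 0" unfolding T_def using q_nonneg[OF g0(1)] by linarith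
  have small: "q (S t) \<le> 1/3" if "cmod t = T" for t
  proof -
    have tnz: "t \<noteq> 0" using that T by auto
    have "q (\<lambda>z. S t z) \<le> q (\<lambda>z. (1 / t) * (g0 z * (S t z - one z)))"
    proof (rule q_cong)
      have "(\<lambda>z. (- 1 / t) * (g0 z * ((one z - t * f z) * S t z - one z)) - S t z * ((f z - 0 * one z) * g0 z - one z)) \<in> J"
        by (intro J_diff J_cmult J_mult g0 S SJ)
      moreover have "(\<lambda>z. (- 1 / t) * (g0 z * ((one z - t * f z) * S t z - one z)) - S t z * ((f z - 0 * one z) * g0 z - one z))
        = (\<lambda>z. S t z - (1 / t) * (g0 z * (S t z - one z)))"
        using tnz by (intro M_eqI M_diff M_mult M_cmult one_M f S g0) (simp add: field_simps)
      ultimately show "(\<lambda>z. S t z - (1 / t) * (g0 z * (S t z - one z))) \<in> J" by simp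
    qed (intro M_cmult M_mult M_diff g0 S one_M)+
    also have "\<dots> \<le> cmod (1 / t) * q (\<lambda>z. g0 z * (S t z - one z))" by (intro q_cmult M_mult M_diff g0 S one_M)
    also have "\<dots> \<le> cmod (1 / t) * (q g0 * q (\<lambda>z. S t z - one z))"
      by (intro mult_left_mono q_mult M_diff g0 S one_M) simp
    also have "q (\<lambda>z. S t z - one z) \<le> q (S t) + 1"
    proof -
      have "q (\<lambda>z. - 1 * one z) \<le> 1"
        using q_cmult[OF one_M, of "-1"] q_lower[OF one_M J_zero] mnorm_le[OF mbound_one] by simp
      then show ?thesis using q_add[OF S M_cmult[OF one_M], of t "-1"] by simp
    qed
    finally have "q (S t) \<le> cmod (1 / t) * (q g0 * (q (S t) + 1))"
      using q_nonneg[OF g0(1)] by (simp add: mult_left_mono divide_right_mono)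
    also have "\<dots> = (q g0 / T) * (q (S t) + 1)" using that by (simp add: norm_divide)
    also have "\<dots> \<le> (1/4) * (q (S t) + 1)"
      using q_nonneg[OF g0(1)] q_nonneg[OF S, of t] T by (intro mult_right_mono) (auto simp: T_def field_simps)
    finally show ?thesis by simp
  qed

  obtain R0 where "\<forall>t\<in>cball 0 (T + 1). q (S t) \<le> R0" using bnd[of "T + 1"] by blast
  then have R0: "q (S t) \<le> R0" if "cmod t \<le> T + 1" for t using that by simp
  define R where "R = max R0 1"
  have R: "q (S t) \<le> R" if "cmod t \<le> T + 1" for t using R0[OF that] by (simp add: R_def)
  have R1: "R \<ge> 1" by (simp add: R_def)
  define L where "L = qf * (R * R) + 1"
  have L: "L > 0" unfolding L_def using qf R1 by (intro add_nonneg_pos mult_nonneg_nonneg) auto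
  have Lip: "q (\<lambda>z. S t z - S t' z) \<le> L * cmod (t - t')" if "cmod t \<le> T + 1" "cmod t' \<le> T + 1" for t t'
  proof -
    have "q (\<lambda>z. S t z - S t' z) \<le> cmod (t - t') * (qf * (q (S t) * q (S t')))" by (rule resolvent)
    also have "\<dots> \<le> cmod (t - t') * (qf * (R * R))"
      using R1 by (intro mult_left_mono mult_mono R that q_nonneg S qf) auto
    also have "\<dots> \<le> cmod (t - t') * L" unfolding L_def by (intro mult_left_mono) auto
    finally show ?thesis by (simp add: mult_ac)
  qed

  define om :: "nat \<Rightarrow> nat \<Rightarrow> complex" where "om n i = exp (2 * of_real pi * \<i> * of_nat i / of_nat n)" for n i
  have om1: "cmod (om n i) = 1" for n i
  proof -
    have "om n i = exp (\<i> * of_real (2 * pi * real i / real n))" unfolding om_def by (simp add: mult_ac)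
    then show ?thesis by (simp only: norm_exp_i_times)
  qed
  define E where "E n t = (\<lambda>z. (1 / of_nat n) * (\<Sum>i<n. S (om n i * t) z))" for n t
  have E: "E n t \<in> M" for n t unfolding E_def by (intro M_cmult M_sum S)
  define a where "a n = q (\<lambda>z. one z * f z ^ n)" for n
  have pw: "(\<lambda>z. one z * f z ^ n) \<in> M" for n
  proof (induction n)
    case (Suc n)
    then have "(\<lambda>z. f z * (one z * f z ^ n)) \<in> M" by (rule M_mult[OF f])
    then show ?case by (simp add: mult_ac)
  qed simp
  have a: "a n \<ge> 0" for n unfolding a_def by (rule q_nonneg[OF pw])
  \<comment> \<open>For each root of unity the polynomial \<open>?P i\<close> is the cofactor of
    \<open>1 - \<omega> t f\<close> in \<open>1 - t^n f^n\<close>. The \<open>?P i\<close> sum to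
    the constant \<open>n\<close>, since the sums of the nontrivial powers of the roots
    vanish.\<close>
  have EJ: "(\<lambda>z. (one z - t ^ n * (one z * f z ^ n)) * E n t z - one z) \<in> J" if n: "n > 0" for n t
  proof -
    let ?P = "\<lambda>i z. \<Sum>j<n. (om n i * t) ^ j * (one z * f z ^ j)"
    have PM: "?P i \<in> M" for i by (intro M_sum M_cmult pw)
    have "(\<lambda>z. (1 / of_nat n) * (\<Sum>i<n. ?P i z * ((one z - (om n i * t) * f z) * S (om n i * t) z - one z))) \<in> J"
      by (intro J_cmult J_sum J_mult PM SJ)
    moreover have "(\<lambda>z. (1 / of_nat n) * (\<Sum>i<n. ?P i z * ((one z - (om n i * t) * f z) * S (om n i * t) z - one z)))
      = (\<lambda>z. (one z - t ^ n * (one z * f z ^ n)) * E n t z - one z)"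
    proof (rule M_eqI)
      fix z assume z: "z \<in> X"
      have omn: "om n i ^ n = 1" for i unfolding om_def using n by (intro complex_root_unity) simp
      have 1: "?P i z * ((one z - (om n i * t) * f z) * S (om n i * t) z - one z)
         = (1 - t ^ n * f z ^ n) * S (om n i * t) z - ?P i z" for i
      proof -
        have P: "?P i z = (\<Sum>j<n. (om n i * t * f z) ^ j)" using z by (simp add: power_mult_distrib)
        have "(1 - om n i * t * f z) * ?P i z = 1 - (om n i * t * f z) ^ n"
          unfolding P by (rule one_diff_power_eq[symmetric])
        also have "\<dots> = 1 - t ^ n * f z ^ n" by (simp add: power_mult_distrib omn)
        finally have "(1 - om n i * t * f z) * ?P i z * S (om n i * t) z = (1 - t ^ n * f z ^ n) * S (om n i * t) z" by simp
        then show ?thesis using z by (simp add: algebra_simps)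
      qed
      have 2: "(\<Sum>i<n. ?P i z) = of_nat n"
      proof -
        have "(\<Sum>i<n. ?P i z) = (\<Sum>j<n. (\<Sum>i<n. om n i ^ j) * (t * f z) ^ j)"
          using z by (subst sum.swap) (simp add: power_mult_distrib sum_distrib_left sum_distrib_right mult_ac)
        also have "\<dots> = (\<Sum>j<n. if j = 0 then of_nat n else 0)"
        proof (intro sum.cong refl)
          fix j assume j: "j \<in> {..<n}"
          show "(\<Sum>i<n. om n i ^ j) * (t * f z) ^ j = (if j = 0 then of_nat n else 0)"
            using sum_roots_of_unity[of j n] j unfolding om_def by (cases "j = 0") auto
        qed
        also have "\<dots> = of_nat n" using n by simp
        finally show ?thesis .
      qed
      have "(1 / of_nat n) * (\<Sum>i<n. ?P i z * ((one z - (om n i * t) * f z) * S (om n i * t) z - one z))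
         = (1 / of_nat n) * ((1 - t ^ n * f z ^ n) * (\<Sum>i<n. S (om n i * t) z) - of_nat n)"
        unfolding 1 sum_subtractf 2 sum_distrib_left[symmetric] ..
      also have "\<dots> = (one z - t ^ n * (one z * f z ^ n)) * E n t z - one z"
        using z n by (simp add: E_def field_simps)
      finally show "(1 / of_nat n) * (\<Sum>i<n. ?P i z * ((one z - (om n i * t) * f z) * S (om n i * t) z - one z))
         = (one z - t ^ n * (one z * f z ^ n)) * E n t z - one z" .
    qed (intro M_cmult M_sum M_mult M_diff PM one_M f S pw E)+
    ultimately show ?thesis by simp
  qed
  have Ebd: "q (E n t) \<le> c" if "\<And>i. q (S (om n i * t)) \<le> c" "n > 0" for n t c
  proof -
    have "q (E n t) \<le> cmod (1 / of_nat n) * q (\<lambda>z. \<Sum>i<n. S (om n i * t) z)"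
      unfolding E_def by (intro q_cmult M_sum S)
    also have "\<dots> \<le> cmod (1 / of_nat n) * (\<Sum>i<n. c)"
      by (intro mult_left_mono order_trans[OF q_sum_le sum_mono] that S) simp
    also have "\<dots> = c" using that(2) by (simp add: norm_divide)
    finally show ?thesis .
  qed
  have ELip: "q (\<lambda>z. E n t z - E n t' z) \<le> L * cmod (t - t')"
    if "cmod t \<le> T + 1" "cmod t' \<le> T + 1" "n > 0" for n t t'
  proof -
    have eq: "(\<lambda>z. E n t z - E n t' z) = (\<lambda>z. (1 / of_nat n) * (\<Sum>i<n. S (om n i * t) z - S (om n i * t') z))"
      by (simp add: E_def sum_subtractf right_diff_distrib)
    have "q (\<lambda>z. E n t z - E n t' z) \<le> cmod (1 / of_nat n) * q (\<lambda>z. \<Sum>i<n. S (om n i * t) z - S (om n i * t') z)"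
      unfolding eq by (intro q_cmult M_sum M_diff S)
    also have "\<dots> \<le> cmod (1 / of_nat n) * (\<Sum>i<n. L * cmod (t - t'))"
    proof (intro mult_left_mono order_trans[OF q_sum_le sum_mono] M_diff S)
      fix i
      have "q (\<lambda>z. S (om n i * t) z - S (om n i * t') z) \<le> L * cmod (om n i * t - om n i * t')"
        by (intro Lip) (simp_all add: norm_mult om1 that)
      also have "cmod (om n i * t - om n i * t') = cmod (t - t')"
        by (metis mult_1 norm_mult om1 right_diff_distrib)
      finally show "q (\<lambda>z. S (om n i * t) z - S (om n i * t') z) \<le> L * cmod (t - t')" .
    qed simp
    also have "\<dots> = L * cmod (t - t')" using that(3) by (simp add: norm_divide)
    finally show ?thesis .
  qed

  have E1: "q (\<lambda>z. one z - E n (of_real t) z) \<le> (t ^ n * a n) * R" if t: "0 \<le> t" "t \<le> T" "n > 0" for n t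
  proof -
    have "q (\<lambda>z. one z - E n (of_real t) z) \<le> q (\<lambda>z. (- (of_real t ^ n)) * ((one z * f z ^ n) * E n (of_real t) z))"
    proof (rule q_cong)
      have "(\<lambda>z. (-1) * ((one z - of_real t ^ n * (one z * f z ^ n)) * E n (of_real t) z - one z)) \<in> J"
        by (intro J_cmult EJ that)
      moreover have "(\<lambda>z. (-1) * ((one z - of_real t ^ n * (one z * f z ^ n)) * E n (of_real t) z - one z))
        = (\<lambda>z. one z - E n (of_real t) z - (- (of_real t ^ n)) * ((one z * f z ^ n) * E n (of_real t) z))"
        by (intro M_eqI M_diff M_cmult M_mult one_M pw E) (simp add: algebra_simps)
      ultimately show "(\<lambda>z. one z - E n (of_real t) z - (- (of_real t ^ n)) * ((one z * f z ^ n) * E n (of_real t) z)) \<in> J" by simp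
    qed (intro M_diff M_cmult M_mult one_M pw E)+
    also have "\<dots> \<le> cmod (- (of_real t ^ n)) * q (\<lambda>z. (one z * f z ^ n) * E n (of_real t) z)"
      by (intro q_cmult M_mult pw E)
    also have "\<dots> \<le> cmod (- (of_real t ^ n)) * (a n * R)"
    proof (intro mult_left_mono)
      have "q (E n (of_real t)) \<le> R" by (rule Ebd[OF R]) (use t in \<open>auto simp: norm_mult om1\<close>)
      then show "q (\<lambda>z. (one z * f z ^ n) * E n (of_real t) z) \<le> a n * R"
        unfolding a_def by (intro order_trans[OF q_mult[OF pw E]] mult_left_mono q_nonneg pw)
    qed simp
    finally show ?thesis using t by (simp add: norm_power mult.assoc)
  qed
  \<comment> \<open>If \<open>t^n f^n\<close> tends to \<open>0\<close>, the averages at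
    \<open>t\<close> tend to \<open>1\<close>; equicontinuity keeps those at \<open>t'\<close>
    eventually within \<open>1/4 + 1/4\<close> of \<open>1\<close>. With
    \<open>D = 1 - E n t'\<close>, the element \<open>x = t'^n f^n\<close> equals
    \<open>x D - D\<close> modulo \<open>J\<close>, so \<open>q x \<le> (q x + 1) / 2\<close> and
    \<open>q x \<le> 1\<close>. Any smaller \<open>s\<close> then gains a geometric factor.\<close>
  have step: "(\<lambda>n. s ^ n * a n) \<longlonglongrightarrow> 0"
    if t: "(\<lambda>n. t ^ n * a n) \<longlonglongrightarrow> 0" "0 \<le> t" "t \<le> T" and s: "0 \<le> s" "s < t'" and t': "t' \<le> T + 1" "L * \<bar>t' - t\<bar> \<le> 1/4" for t s t'
  proof -
    have "(\<lambda>n. (t ^ n * a n) * R) \<longlonglongrightarrow> 0" using tendsto_mult_left_zero[OF t(1)] .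
    then have "eventually (\<lambda>n. (t ^ n * a n) * R < 1/4) sequentially" by (rule order_tendstoD) simp
    then have ev: "eventually (\<lambda>n. t' ^ n * a n \<le> 1) sequentially"
      using eventually_gt_at_top[of 0]
    proof eventually_elim
      case (elim n)
      let ?D = "\<lambda>z. one z - E n (of_real t') z" and ?x = "\<lambda>z. of_real t' ^ n * (one z * f z ^ n)"
      have DM: "?D \<in> M" by (intro M_diff one_M E)
      have xM: "?x \<in> M" by (intro M_cmult pw)
      have "q (\<lambda>z. (one z - E n (of_real t) z) + (E n (of_real t) z - E n (of_real t') z))
        \<le> q (\<lambda>z. one z - E n (of_real t) z) + q (\<lambda>z. E n (of_real t) z - E n (of_real t') z)"
        by (intro q_add M_diff one_M E)
      moreover have "q (\<lambda>z. E n (of_real t) z - E n (of_real t') z) \<le> L * cmod (of_real t - of_real t')"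
        using t s t' elim by (intro ELip) auto
      moreover have "cmod (of_real t - of_real t') = \<bar>t' - t\<bar>"
        by (metis norm_of_real of_real_diff abs_minus_commute)
      ultimately have D: "q ?D \<le> 1/2" using E1[OF t(2,3) elim(2)] elim(1) t'(2) by simp
      have "q ?x \<le> q (\<lambda>z. ?x z * ?D z + (-1) * ?D z)"
      proof (rule q_cong)
        have "(\<lambda>z. (-1) * ((one z - of_real t' ^ n * (one z * f z ^ n)) * E n (of_real t') z - one z)) \<in> J"
          by (intro J_cmult EJ elim)
        moreover have "(\<lambda>z. (-1) * ((one z - of_real t' ^ n * (one z * f z ^ n)) * E n (of_real t') z - one z))
          = (\<lambda>z. ?x z - (?x z * ?D z + (-1) * ?D z))"
          by (intro M_eqI M_diff M_cmult M_add M_mult one_M pw E) (simp add: algebra_simps)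
        ultimately show "(\<lambda>z. ?x z - (?x z * ?D z + (-1) * ?D z)) \<in> J" by simp
      qed (intro M_add M_mult M_cmult DM xM)+
      also have "\<dots> \<le> q (\<lambda>z. ?x z * ?D z) + q (\<lambda>z. (-1) * ?D z)"
        by (intro q_add M_mult M_cmult DM xM)
      also have "\<dots> \<le> q ?x * q ?D + q ?D"
        using q_mult[OF xM DM] q_cmult[OF DM, of "-1"] by simp
      also have "\<dots> \<le> q ?x * (1/2) + 1/2"
        using D q_nonneg[OF xM] by (intro add_mono mult_left_mono) auto
      finally have x1: "q ?x \<le> 1" by simp
      have "0 < t'" using s by simp
      have "a n \<le> q (\<lambda>z. (1 / of_real t' ^ n) * ?x z)"
        unfolding a_def using \<open>0 < t'\<close> by simp
      also have "\<dots> \<le> cmod (1 / of_real t' ^ n) * q ?x" by (rule q_cmult[OF xM])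
      also have "\<dots> \<le> cmod (1 / of_real t' ^ n) * 1" by (intro mult_left_mono x1) simp
      finally have "a n \<le> 1 / t' ^ n" using \<open>0 < t'\<close> by (simp add: norm_divide norm_power)
      then show "t' ^ n * a n \<le> 1" using \<open>0 < t'\<close> by (simp add: field_simps)
    qed
    have z: "(\<lambda>n. (s / t') ^ n) \<longlonglongrightarrow> 0" using s by (intro LIMSEQ_power_zero) simp
    show ?thesis
    proof (rule Lim_null_comparison[OF _ z])
      show "eventually (\<lambda>n. norm (s ^ n * a n) \<le> (s / t') ^ n) sequentially"
        using ev
      proof eventually_elim
        case (elim n)
        have "0 < t'" using s by simp
        have "s ^ n * a n = (s / t') ^ n * (t' ^ n * a n)" using \<open>0 < t'\<close> by (simp add: power_divide)
        also have "\<dots> \<le> (s / t') ^ n * 1" using s by (intro mult_left_mono elim) auto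
        finally show ?case using s a[of n] by simp
      qed
    qed
  qed
  \<comment> \<open>Each step of the chain advances by \<open>d = T / N\<close> through the
    intermediate radius \<open>t' = j d + 2 d\<close>. The constant \<open>8 * L + 2\<close> ensures
    \<open>L * (2 * d) \<le> 1/4\<close> and \<open>2 * d \<le> 1\<close>, so that \<open>t'\<close>
    stays below \<open>T + 1\<close>, where the Lipschitz bound holds.\<close>
  obtain N :: nat where N: "T * (8 * L + 2) < real N" using reals_Archimedean2 by blast
  have Npos: "N > 0"
  proof (rule ccontr)
    assume "\<not> N > 0"
    then have "T * (8 * L + 2) < 0" using N by simp
    then show False using T L by (simp add: mult_less_0_iff)
  qed
  define d where "d = T / real N"
  have d: "d > 0" unfolding d_def using T Npos by simp
  have dT: "T * (8 * L + 2) < T / d" using N T Npos by (simp add: d_def)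
  then have "T * ((8 * L + 2) * d) < T * 1" using d by (simp add: field_simps)
  then have "(8 * L + 2) * d < 1" using T by (simp only: mult_less_cancel_left_pos)
  then have d8: "8 * (L * d) + 2 * d < 1" by (simp add: algebra_simps)
  have "0 < L * d" using L d by simp
  then have dL: "L * (2 * d) \<le> 1/4" "2 * d \<le> 1" using d8 d by linarith+
  have chain: "(\<lambda>n. (real j * d) ^ n * a n) \<longlonglongrightarrow> 0" if "j \<le> N" for j
    using that
  proof (induction j)
    case 0
    have "eventually (\<lambda>n. (real 0 * d) ^ n * a n = 0) sequentially"
      using eventually_gt_at_top[of 0] by eventually_elim simp
    then show ?case by (simp add: tendsto_eventually)
  next
    case (Suc j)
    have "real j * d \<le> real N * d" using Suc.prems d by simp
    also have "real N * d = T" using Npos by (simp add: d_def)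
    finally have jT: "real j * d \<le> T" .
    show ?case
      by (rule step[of "real j * d" _ "real j * d + 2 * d"])
        (use Suc jT d dL in \<open>auto simp: algebra_simps\<close>)
  qed
  have "real N * d = T" using Npos by (simp add: d_def)
  then have "(\<lambda>n. T ^ n * a n) \<longlonglongrightarrow> 0" using chain[of N] by simp
  then have "(\<lambda>n. (T ^ n * a n) * R) \<longlonglongrightarrow> 0" by (rule tendsto_mult_left_zero)
  then have "eventually (\<lambda>n. (T ^ n * a n) * R < 1/3) sequentially" by (rule order_tendstoD) simp
  then have "eventually (\<lambda>n. False) sequentially"
    using eventually_gt_at_top[of 0]
  proof eventually_elim
    case (elim n)
    \<comment> \<open>At radius \<open>T\<close> the averages are at most \<open>1/3\<close> by
      \<open>small\<close> and within \<open>1/3\<close> of the unit by the chain, so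
      \<open>q one < 1\<close>.\<close>
    have "q (E n (of_real T)) \<le> 1/3" by (rule Ebd[OF small]) (use T elim in \<open>auto simp: norm_mult om1\<close>)
    moreover have "q (\<lambda>z. one z - E n (of_real T) z) \<le> (T ^ n * a n) * R" by (rule E1) (use T elim in auto)
    moreover have "q (\<lambda>z. (one z - E n (of_real T) z) + E n (of_real T) z) \<le> q (\<lambda>z. one z - E n (of_real T) z) + q (E n (of_real T))"
      by (intro q_add M_diff one_M E)
    ultimately show False using q_one elim(1) by simp
  qed
  then show False by simp
qed

end

context pick_space
begin

lemma mideal_extend:
  assumes J: "mideal J" and f: "f \<in> M"
  shows "mideal {\<lambda>z. p z + g z * f z | p g. p \<in> J \<and> g \<in> M}"
    and "J \<subseteq> {\<lambda>z. p z + g z * f z | p g. p \<in> J \<and> g \<in> M}" "f \<in> {\<lambda>z. p z + g z * f z | p g. p \<in> J \<and> g \<in> M}"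
proof -
  let ?J' = "{\<lambda>z. p z + g z * f z | p g. p \<in> J \<and> g \<in> M}"
  have J0: "J \<subseteq> M" "(\<lambda>z. 0) \<in> J" and Jadd: "\<And>f g. f \<in> J \<Longrightarrow> g \<in> J \<Longrightarrow> (\<lambda>z. f z + g z) \<in> J"
    and Jmult: "\<And>f g. f \<in> J \<Longrightarrow> g \<in> M \<Longrightarrow> (\<lambda>z. g z * f z) \<in> J" using J unfolding mideal_def by blast+
  have I: "(\<lambda>z. p z + g z * f z) \<in> ?J'" if "p \<in> J" "g \<in> M" for p g using that by blast
  show "J \<subseteq> ?J'"
  proof
    fix p assume "p \<in> J"
    from I[OF this M_zero] show "p \<in> ?J'" by simp
  qed
  have "(\<lambda>z. 0 + one z * f z) = f" by (intro M_eqI M_add M_mult M_zero one_M f) simp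
  then show "f \<in> ?J'" using I[OF J0(2) one_M] by simp
  show "mideal ?J'" unfolding mideal_def
  proof (intro conjI ballI)
    show "?J' \<subseteq> M" using J0(1) f by (auto intro!: M_add M_mult)
    show "(\<lambda>z. 0) \<in> ?J'" using I[OF J0(2) M_zero] by simp
  next
    fix a b assume "a \<in> ?J'" "b \<in> ?J'"
    then obtain p g p' g' where *: "a = (\<lambda>z. p z + g z * f z)" "p \<in> J" "g \<in> M" "b = (\<lambda>z. p' z + g' z * f z)" "p' \<in> J" "g' \<in> M"
      by blast
    have "(\<lambda>z. (p z + p' z) + (g z + g' z) * f z) \<in> ?J'" by (rule I) (intro Jadd M_add *)+
    then show "(\<lambda>z. a z + b z) \<in> ?J'" unfolding * by (simp add: algebra_simps)
  next
    fix a b assume "a \<in> ?J'" and b: "b \<in> M"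
    then obtain p g where *: "a = (\<lambda>z. p z + g z * f z)" "p \<in> J" "g \<in> M" by blast
    have "(\<lambda>z. (b z * p z) + (b z * g z) * f z) \<in> ?J'" by (rule I) (intro Jmult M_mult * b)+
    then show "(\<lambda>z. b z * a z) \<in> ?J'" unfolding * by (simp add: algebra_simps)
  qed
qed

lemma maximal_ideal_exists:
  assumes J: "mideal J" "one \<notin> J"
  obtains m where "mideal m" "J \<subseteq> m" "one \<notin> m" "\<And>f. f \<in> M \<Longrightarrow> f \<notin> m \<Longrightarrow> \<exists>g\<in>M. (\<lambda>z. f z * g z - one z) \<in> m"
proof -
  define A where "A = {m. mideal m \<and> J \<subseteq> m \<and> one \<notin> m}"
  have "\<exists>m\<in>A. \<forall>X\<in>A. m \<subseteq> X \<longrightarrow> X = m"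
  proof (rule subset_Zorn_nonempty)
    show "A \<noteq> {}" using J by (auto simp: A_def)
    fix C assume C: "C \<noteq> {}" "subset.chain A C"
    have CA: "C \<subseteq> A" and tot: "\<And>x y. x \<in> C \<Longrightarrow> y \<in> C \<Longrightarrow> x \<subseteq> y \<or> y \<subseteq> x"
      using C(2) by (auto simp: subset_chain_def)
    have Cm: "mideal m" "J \<subseteq> m" "one \<notin> m" if "m \<in> C" for m using that CA by (auto simp: A_def)
    have "mideal (\<Union>C)" unfolding mideal_def
    proof (intro conjI ballI)
      show "\<Union>C \<subseteq> M" using Cm(1) unfolding mideal_def by blast
      show "(\<lambda>z. 0) \<in> \<Union>C" using Cm(1) C(1) unfolding mideal_def by blast
    next
      fix f g assume "f \<in> \<Union>C" "g \<in> \<Union>C"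
      then obtain x y where xy: "x \<in> C" "f \<in> x" "y \<in> C" "g \<in> y" by blast
      then obtain w where "w \<in> C" "f \<in> w" "g \<in> w" using tot[of x y] by blast
      then show "(\<lambda>z. f z + g z) \<in> \<Union>C" using Cm(1)[of w] unfolding mideal_def by blast
    next
      fix f g assume "f \<in> \<Union>C" "g \<in> M"
      then show "(\<lambda>z. g z * f z) \<in> \<Union>C" using Cm(1) unfolding mideal_def by blast
    qed
    then show "\<Union>C \<in> A" using Cm(2,3) C(1) by (auto simp: A_def)
  qed
  then obtain m where m: "m \<in> A" "\<And>X. X \<in> A \<Longrightarrow> m \<subseteq> X \<Longrightarrow> X = m" by blast
  have mi: "mideal m" "J \<subseteq> m" "one \<notin> m" using m(1) by (auto simp: A_def)
  have "\<exists>g\<in>M. (\<lambda>z. f z * g z - one z) \<in> m" if f: "f \<in> M" "f \<notin> m" for f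
  proof -
    let ?J' = "{\<lambda>z. p z + g z * f z | p g. p \<in> m \<and> g \<in> M}"
    note ext = mideal_extend[OF mi(1) f(1)]
    have "one \<in> ?J'"
    proof (rule ccontr)
      assume "one \<notin> ?J'"
      then have "?J' \<in> A" using ext(1,2) mi(2) unfolding A_def by blast
      from m(2)[OF this ext(2)] ext(3) f(2) show False by simp
    qed
    then obtain p g where pg: "one = (\<lambda>z. p z + g z * f z)" "p \<in> m" "g \<in> M" by blast
    interpret pick_ideal X k m by unfold_locales (rule mi)+
    have "(\<lambda>z. (-1) * p z) \<in> m" by (intro J_cmult pg)
    moreover have "(\<lambda>z. (-1) * p z) = (\<lambda>z. f z * g z - one z)" using pg(1) by (simp add: fun_eq_iff mult.commute)
    ultimately show ?thesis using pg(3) by metis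
  qed
  with mi show ?thesis by (rule that)
qed

text \<open>Modulo a maximal ideal every element outside it is invertible, while
  \<open>spectrum_nonempty\<close> yields a scalar \<open>c\<close> with \<open>f - c\<close> not
  invertible. Hence \<open>f - c\<close> lies in the ideal, and this unique \<open>c\<close> is the
  value of the character.\<close>

theorem character_exists:
  assumes J: "mideal J" "one \<notin> J"
  obtains chr where "chr one = 1" "\<And>f. f \<in> J \<Longrightarrow> chr f = 0"
    "\<And>f g c. f \<in> M \<Longrightarrow> g \<in> M \<Longrightarrow> chr (\<lambda>z. c * f z + g z) = c * chr f + chr g"
    "\<And>f g. f \<in> M \<Longrightarrow> g \<in> M \<Longrightarrow> chr (\<lambda>z. f z * g z) = chr f * chr g"
proof -
  obtain m where m: "mideal m" "J \<subseteq> m" "one \<notin> m" "\<And>f. f \<in> M \<Longrightarrow> f \<notin> m \<Longrightarrow> \<exists>g\<in>M. (\<lambda>z. f z * g z - one z) \<in> m"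
    by (rule maximal_ideal_exists[OF J]) (rule that)
  interpret m: pick_ideal X k m by unfold_locales (rule m)+
  have ex: "\<exists>c. (\<lambda>z. f z - c * one z) \<in> m" if f: "f \<in> M" for f
  proof -
    obtain c where c: "\<forall>g\<in>M. (\<lambda>z. (f z - c * one z) * g z - one z) \<notin> m" using m.spectrum_nonempty[OF f] by blast
    have "(\<lambda>z. f z - c * one z) \<in> M" by (intro M_diff M_cmult f one_M)
    then have "(\<lambda>z. f z - c * one z) \<in> m" using m(4)[of "\<lambda>z. f z - c * one z"] c by blast
    then show ?thesis by blast
  qed
  define chr where "chr f = (SOME c. (\<lambda>z. f z - c * one z) \<in> m)" for f
  have chr: "(\<lambda>z. f z - chr f * one z) \<in> m" if "f \<in> M" for f
    unfolding chr_def using ex[OF that] by (rule someI_ex)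
  have uniq: "chr f = c" if "f \<in> M" "(\<lambda>z. f z - c * one z) \<in> m" for f c
  proof (rule ccontr)
    assume "chr f \<noteq> c"
    then have ne: "c - chr f \<noteq> 0" by simp
    have "(\<lambda>z. (1 / (c - chr f)) * ((f z - chr f * one z) - (f z - c * one z))) \<in> m"
      by (intro m.J_cmult m.J_diff chr that)
    moreover have "(\<lambda>z. (1 / (c - chr f)) * ((f z - chr f * one z) - (f z - c * one z))) = one"
      using ne by (simp add: fun_eq_iff left_diff_distrib[symmetric])
    ultimately show False using m(3) by simp
  qed
  show ?thesis
  proof (rule that[of chr])
    show "chr one = 1" by (rule uniq[OF one_M]) (simp add: m.J_zero)
    show "chr f = 0" if "f \<in> J" for f
      using that m(2) m.JM by (intro uniq) auto
    show "chr (\<lambda>z. c * f z + g z) = c * chr f + chr g" if "f \<in> M" "g \<in> M" for f g c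
    proof (rule uniq)
      have "(\<lambda>z. c * (f z - chr f * one z) + (g z - chr g * one z)) \<in> m"
        by (intro m.J_add m.J_cmult chr that)
      then show "(\<lambda>z. c * f z + g z - (c * chr f + chr g) * one z) \<in> m" by (simp add: algebra_simps)
    qed (intro M_add M_cmult that)
    show "chr (\<lambda>z. f z * g z) = chr f * chr g" if fg: "f \<in> M" "g \<in> M" for f g
    proof (rule uniq)
      have "(\<lambda>z. g z * (f z - chr f * one z) + chr f * (g z - chr g * one z)) \<in> m"
        by (intro m.J_add m.J_mult m.J_cmult chr fg)
      moreover have "(\<lambda>z. g z * (f z - chr f * one z) + chr f * (g z - chr g * one z)) = (\<lambda>z. f z * g z - chr f * chr g * one z)"
        by (intro M_eqI M_add M_mult M_diff M_cmult fg one_M) (simp add: algebra_simps)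
      ultimately show "(\<lambda>z. f z * g z - chr f * chr g * one z) \<in> m" by simp
    qed (intro M_mult fg)
  qed
qed

end

section \<open>Weak-* approximation\<close>

context pick_space
begin

text \<open>The norm bound reduces the claim to kernel combinations in place of \<open>y\<close>,
  against which the inner product is a finite sum of point values.\<close>

lemma weakly_null:
  assumes a: "\<And>n::nat. a n \<in> H" "\<And>n. nrm (a n) \<le> C" "\<And>z. z \<in> X \<Longrightarrow> (\<lambda>n. a n z) \<longlonglongrightarrow> 0" and y: "y \<in> H"
  shows "(\<lambda>n. inn (a n) y) \<longlonglongrightarrow> 0"
proof (rule LIMSEQ_I)
  fix e :: real assume e: "e > 0"
  have C: "C \<ge> 0" using a(2)[of 0] nrm_nonneg[OF a(1)[of 0]] by linarith
  then have "e / (2 * (C + 1)) > 0" using e by simp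
  then obtain v where v: "v \<in> V" "nrm (\<lambda>z. y z - kern v z) < e / (2 * (C + 1))" by (rule kern_dense[OF y])
  have "(\<lambda>n. ev (a n) v) \<longlonglongrightarrow> ev (\<lambda>z. 0) v"
    using v(1) by (intro tendsto_ev a(3)) (auto simp: in_lists_conv_set)
  then obtain N where N: "\<And>n. n \<ge> N \<Longrightarrow> cmod (ev (a n) v) < e / 2"
    using LIMSEQ_D[of "\<lambda>n. ev (a n) v" 0 "e / 2"] e by auto
  have "norm (inn (a n) y - 0) < e" if "n \<ge> N" for n
  proof -
    have "inn (a n) y = inn (a n) (kern v) + inn (a n) (\<lambda>z. y z - kern v z)"
      using inn_diff_right[OF a(1)[of n] y kern_H[OF v(1)]] by simp
    then have "cmod (inn (a n) y) \<le> cmod (ev (a n) v) + cmod (inn (a n) (\<lambda>z. y z - kern v z))"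
      using norm_triangle_ineq[of "inn (a n) (kern v)" "inn (a n) (\<lambda>z. y z - kern v z)"] by (simp add: inn_kern[OF a(1) v(1)] del: in_lists_conv_set)
    moreover have "cmod (inn (a n) (\<lambda>z. y z - kern v z)) \<le> e / 2"
    proof -
      have "cmod (inn (a n) (\<lambda>z. y z - kern v z)) \<le> nrm (a n) * nrm (\<lambda>z. y z - kern v z)"
        by (intro inn_le a H_diff y kern_H v)
      also have "\<dots> \<le> (C + 1) * (e / (2 * (C + 1)))"
        using a(2)[of n] v(2) C by (intro mult_mono nrm_nonneg H_diff y kern_H v(1)) auto
      also have "\<dots> = e / 2"
      proof -
        have "D * (e / (2 * D)) = e / 2" if "D > 0" for D :: real using that by simp
        from this[of "C + 1"] C show ?thesis by simp
      qed
      finally show ?thesis .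
    qed
    ultimately show ?thesis using N[OF that] by simp
  qed
  then show "\<exists>N. \<forall>n\<ge>N. norm (inn (a n) y - 0) < e" by blast
qed

lemma summable_nrm_mult:
  assumes "\<And>k. x k \<in> H" "\<And>k. y k \<in> H" "summable (\<lambda>k. (nrm (x k))\<^sup>2)" "summable (\<lambda>k. (nrm (y k))\<^sup>2)"
  shows "summable (\<lambda>k. nrm (x k) * nrm (y k))"
proof (rule summable_comparison_test'[OF summable_add[OF assms(3,4)], of 0])
  fix k
  have "0 \<le> (nrm (x k) - nrm (y k))\<^sup>2" "0 \<le> nrm (x k) * nrm (y k)" using nrm_nonneg assms by simp_all
  then show "norm (nrm (x k) * nrm (y k)) \<le> (nrm (x k))\<^sup>2 + (nrm (y k))\<^sup>2" by (simp add: power2_diff)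
qed

lemma inn_mult_le:
  assumes "\<phi> \<in> M" "x \<in> H" "y \<in> H"
  shows "cmod (inn (\<lambda>z. \<phi> z * x z) y) \<le> mnorm \<phi> * (nrm x * nrm y)"
proof -
  have "cmod (inn (\<lambda>z. \<phi> z * x z) y) \<le> nrm (\<lambda>z. \<phi> z * x z) * nrm y" by (intro inn_le M_H assms)
  also have "\<dots> \<le> (mnorm \<phi> * nrm x) * nrm y" by (intro mult_right_mono nrm_mult_le nrm_nonneg assms)
  finally show ?thesis by (simp add: mult.assoc)
qed

lemma summable_inn_mult:
  assumes "\<phi> \<in> M" "\<And>k. x k \<in> H" "\<And>k. y k \<in> H" "summable (\<lambda>k. (nrm (x k))\<^sup>2)" "summable (\<lambda>k. (nrm (y k))\<^sup>2)"
  shows "summable (\<lambda>k. inn (\<lambda>z. \<phi> z * x k z) (y k))"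
  by (rule summable_comparison_test'[OF summable_mult[OF summable_nrm_mult[OF assms(2-5)], of "mnorm \<phi>"], of 0])
    (intro inn_mult_le assms)

text \<open>Here \<open>G n = 1 / (1 - r n \<psi>)\<close>, and
  \<open>E n = (1 - r n) \<psi> G n\<close> is what \<open>(1 - \<psi>) G n\<close> lacks to be the
  unit. The factor \<open>1 - r n\<close> just balances the Neumann bound of \<open>G n\<close>, so
  the \<open>E n\<close> stay contractive; they vanish pointwise in the limit because
  \<open>\<psi>\<close> avoids the value \<open>1\<close>.\<close>

lemma Abel_multipliers:
  assumes psi: "\<psi> \<in> M" "mbound \<psi> 1" "\<And>z. z \<in> X \<Longrightarrow> \<psi> z \<noteq> 1"
  obtains G E :: "nat \<Rightarrow> 'a \<Rightarrow> complex" where "\<And>n. G n \<in> M" "\<And>n. E n \<in> M" "\<And>n. mbound (E n) 1"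
    "\<And>z. z \<in> X \<Longrightarrow> (\<lambda>n. E n z) \<longlonglongrightarrow> 0" "\<And>n z. (one z - \<psi> z) * G n z + E n z = one z"
proof -
  define r where "r n = 1 - inverse (real (Suc n))" for n
  have r: "0 \<le> r n" "r n < 1" for n by (simp_all add: r_def field_simps)
  have rM: "(\<lambda>z. of_real (r n) * \<psi> z) \<in> M" for n by (intro M_cmult psi)
  have rb: "mbound (\<lambda>z. of_real (r n) * \<psi> z) (r n)" for n
    unfolding mbound_def
  proof (intro conjI ballI r)
    fix f assume f: "f \<in> H"
    have "nrm (\<lambda>z. of_real (r n) * (\<psi> z * f z)) = r n * nrm (\<lambda>z. \<psi> z * f z)"
      by (subst nrm_cmult) (use r M_H[OF psi(1) f] in auto)
    also have "\<dots> \<le> r n * nrm f" using mboundD[OF psi(2) f] r by (intro mult_left_mono) auto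
    finally show "nrm (\<lambda>z. of_real (r n) * \<psi> z * f z) \<le> r n * nrm f" by (simp add: mult.assoc)
  qed
  define G where "G n = (\<lambda>z. if z \<in> X then 1 / (1 - of_real (r n) * \<psi> z) else 0)" for n
  have G: "G n \<in> M" "mbound (G n) (1 / (1 - r n))" for n
    unfolding G_def by (rule Neumann_inverse[OF rM rb r(2)])+
  define E where "E n = (\<lambda>z. of_real (1 - r n) * (\<psi> z * G n z))" for n
  have E: "E n \<in> M" for n unfolding E_def by (intro M_cmult M_mult psi G)
  have nz: "1 - of_real (r n) * \<psi> z \<noteq> 0" if "z \<in> X" for n z
  proof -
    have "cmod (of_real (r n) * \<psi> z) \<le> r n" by (rule cmod_le_mbound[OF rM rb that])
    then show ?thesis using r(2)[of n] by auto
  qed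
  show ?thesis
  proof (rule that[of G E])
    show "mbound (E n) 1" for n
      unfolding mbound_def
    proof (intro conjI ballI)
      fix f assume f: "f \<in> H"
      have Gf: "(\<lambda>z. G n z * f z) \<in> H" by (intro M_H G f)
      have "nrm (\<lambda>z. of_real (1 - r n) * (\<psi> z * (G n z * f z))) = (1 - r n) * nrm (\<lambda>z. \<psi> z * (G n z * f z))"
        by (subst nrm_cmult) (use r(2)[of n] M_H[OF psi(1) Gf] in \<open>auto simp del: of_real_diff\<close>)
      also have "\<dots> \<le> (1 - r n) * (1 * ((1 / (1 - r n)) * nrm f))"
        using r(2)[of n] mboundD[OF psi(2) Gf] mboundD[OF G(2) f, of n] by (intro mult_left_mono) linarith+
      also have "\<dots> = nrm f" using r(2)[of n] by simp
      finally show "nrm (\<lambda>z. E n z * f z) \<le> 1 * nrm f" by (simp add: E_def mult.assoc)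
    qed simp
    show "(\<lambda>n. E n z) \<longlonglongrightarrow> 0" if z: "z \<in> X" for z
    proof -
      have "r \<longlonglongrightarrow> 1 - 0" unfolding r_def by (intro tendsto_intros LIMSEQ_inverse_real_of_nat)
      then have "(\<lambda>n. of_real (1 - r n) * (\<psi> z * (1 / (1 - of_real (r n) * \<psi> z)))) \<longlonglongrightarrow> of_real (1 - 1) * (\<psi> z * (1 / (1 - of_real 1 * \<psi> z)))"
        using psi(3)[OF z] by (intro tendsto_intros) auto
      then show ?thesis using z by (simp add: E_def G_def)
    qed
    show "(one z - \<psi> z) * G n z + E n z = one z" for n z
    proof (cases "z \<in> X")
      case True
      have "(1 - \<psi> z) * G n z + E n z = (1 - of_real (r n) * \<psi> z) * G n z"
        by (simp add: E_def algebra_simps)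
      also have "\<dots> = 1" using nz[OF True, of n] True by (simp add: G_def)
      finally show ?thesis using True by simp
    next
      case False
      then show ?thesis using M_off[OF psi(1)] by (simp add: E_def one_def)
    qed
  qed (fact G E)+
qed

text \<open>One \<open>\<psi>\<close> must serve all \<open>m\<close> functionals of a weak-*
  neighbourhood simultaneously, so the \<open>m\<close> sequences are interleaved into one through
  the pairing of natural numbers.\<close>

lemma column_family:
  fixes x :: "nat \<Rightarrow> nat \<Rightarrow> 'a \<Rightarrow> complex"
  assumes x: "\<And>i k. i < m \<Longrightarrow> x i k \<in> H" and sx: "\<And>i. i < m \<Longrightarrow> summable (\<lambda>k. (nrm (x i k))\<^sup>2)"
  obtains \<psi> where "\<psi> \<in> M" "mbound \<psi> 1" "\<And>z. z \<in> X \<Longrightarrow> \<psi> z \<noteq> 1"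
    "\<And>h i k. h \<in> H \<Longrightarrow> i < m \<Longrightarrow> (\<lambda>z. (one z - \<psi> z) * x i k z * h z) \<in> H"
    "\<And>h i N. h \<in> H \<Longrightarrow> i < m \<Longrightarrow> (\<Sum>k<N. (nrm (\<lambda>z. (one z - \<psi> z) * x i k z * h z))\<^sup>2) \<le> (nrm h)\<^sup>2"
proof -
  define F where "F l = (if fst (prod_decode l) < m then x (fst (prod_decode l)) (snd (prod_decode l)) else (\<lambda>z. 0))" for l
  have F: "F l \<in> H" for l using x by (simp add: F_def)
  have Fx: "F (prod_encode (i, k)) = x i k" if "i < m" for i k using that by (simp add: F_def)
  have sF: "summable (\<lambda>l. (nrm (F l))\<^sup>2)"
  proof (rule summableI_nonneg_bounded)
    fix n
    define A where "A = prod_decode ` {..<n}"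
    define w where "w p = (if fst p < m then (nrm (x (fst p) (snd p)))\<^sup>2 else 0)" for p
    have "(\<Sum>l<n. (nrm (F l))\<^sup>2) = (\<Sum>l<n. w (prod_decode l))"
      by (intro sum.cong refl) (simp add: F_def w_def)
    also have "\<dots> = (\<Sum>p\<in>A. w p)"
      unfolding A_def by (subst sum.reindex) (auto intro: inj_on_subset[OF inj_prod_decode])
    also have "\<dots> = (\<Sum>p\<in>{p\<in>A. fst p < m}. w p)"
      by (rule sum.mono_neutral_right) (auto simp: A_def w_def)
    also have "\<dots> \<le> (\<Sum>p\<in>{..<m} \<times> snd ` A. w p)"
    proof (rule sum_mono2)
      show "{p \<in> A. fst p < m} \<subseteq> {..<m} \<times> snd ` A" by force
    qed (auto simp: A_def w_def)
    also have "\<dots> = (\<Sum>i<m. \<Sum>k\<in>snd ` A. (nrm (x i k))\<^sup>2)"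
      unfolding sum.cartesian_product[symmetric]
      by (subst sum.cartesian_product, intro sum.cong refl) (auto simp: w_def)
    also have "\<dots> \<le> (\<Sum>i<m. suminf (\<lambda>k. (nrm (x i k))\<^sup>2))"
      by (intro sum_mono sum_le_suminf sx) (auto simp: A_def)
    finally show "(\<Sum>l<n. (nrm (F l))\<^sup>2) \<le> (\<Sum>i<m. suminf (\<lambda>k. (nrm (x i k))\<^sup>2))" .
  qed simp
  obtain \<psi> where psi: "\<psi> \<in> M" "mbound \<psi> 1" "\<And>z. z \<in> X \<Longrightarrow> \<psi> z \<noteq> 1"
    "\<And>h l. h \<in> H \<Longrightarrow> (\<lambda>z. (one z - \<psi> z) * F l z * h z) \<in> H"
    "\<And>h N. h \<in> H \<Longrightarrow> (\<Sum>l<N. (nrm (\<lambda>z. (one z - \<psi> z) * F l z * h z))\<^sup>2) \<le> (nrm h)\<^sup>2"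
    by (rule column_factorization[of F, OF F sF]) (rule that)
  show ?thesis
  proof (rule that[OF psi(1-3)])
    show "(\<lambda>z. (one z - \<psi> z) * x i k z * h z) \<in> H" if "h \<in> H" "i < m" for h i k
      using psi(4)[OF that(1), of "prod_encode (i, k)"] by (simp add: Fx that)
    show "(\<Sum>k<N. (nrm (\<lambda>z. (one z - \<psi> z) * x i k z * h z))\<^sup>2) \<le> (nrm h)\<^sup>2" if "h \<in> H" "i < m" for h i N
    proof -
      let ?A = "(\<lambda>k. prod_encode (i, k)) ` {..<N}"
      have "(\<Sum>k<N. (nrm (\<lambda>z. (one z - \<psi> z) * x i k z * h z))\<^sup>2) = (\<Sum>l\<in>?A. (nrm (\<lambda>z. (one z - \<psi> z) * F l z * h z))\<^sup>2)"
        by (subst sum.reindex) (auto simp: inj_on_def Fx that)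
      also have "\<dots> \<le> (\<Sum>l<Suc (Max ?A). (nrm (\<lambda>z. (one z - \<psi> z) * F l z * h z))\<^sup>2)"
        by (rule sum_mono2) (auto simp: less_Suc_eq_le)
      also have "\<dots> \<le> (nrm h)\<^sup>2" by (rule psi(5)[OF that(1)])
      finally show ?thesis .
    qed
  qed
qed

text \<open>The splitting is \<open>f = (1 - \<psi>) g' + (1 - \<psi>) p + f E n\<close> with
  \<open>p = f G n - g'\<close>. The contractive \<open>E n\<close> give the domination for
  Tannery's theorem. The order of choices matters: \<open>n\<close> is fixed first, and
  \<open>g'\<close> is then chosen for this particular \<open>G n\<close>.\<close>

theorem weak_star_approximation:
  fixes x y :: "nat \<Rightarrow> nat \<Rightarrow> 'a \<Rightarrow> complex"
  assumes I: "I \<subseteq> M" "\<And>g h. g \<in> I \<Longrightarrow> h \<in> M \<Longrightarrow> (\<lambda>z. h z * g z) \<in> I"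
    and f: "f \<in> M" and dense: "\<And>h e. h \<in> M \<Longrightarrow> e > 0 \<Longrightarrow> \<exists>g\<in>I. nrm (\<lambda>z. f z * h z - g z) < e"
    and x: "\<And>i k. i < m \<Longrightarrow> x i k \<in> H" and y: "\<And>i k. i < m \<Longrightarrow> y i k \<in> H"
    and sx: "\<And>i. i < m \<Longrightarrow> summable (\<lambda>k. (nrm (x i k))\<^sup>2)" and sy: "\<And>i. i < m \<Longrightarrow> summable (\<lambda>k. (nrm (y i k))\<^sup>2)"
    and e: "e > 0"
  shows "\<exists>g\<in>I. \<forall>i<m. cmod ((\<Sum>k. inn (\<lambda>z. g z * x i k z) (y i k)) - (\<Sum>k. inn (\<lambda>z. f z * x i k z) (y i k))) < e"
proof -
  obtain \<psi> where psi: "\<psi> \<in> M" "mbound \<psi> 1" "\<And>z. z \<in> X \<Longrightarrow> \<psi> z \<noteq> 1"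
    "\<And>h i k. h \<in> H \<Longrightarrow> i < m \<Longrightarrow> (\<lambda>z. (one z - \<psi> z) * x i k z * h z) \<in> H"
    "\<And>h i N. h \<in> H \<Longrightarrow> i < m \<Longrightarrow> (\<Sum>k<N. (nrm (\<lambda>z. (one z - \<psi> z) * x i k z * h z))\<^sup>2) \<le> (nrm h)\<^sup>2"
    by (rule column_family[of m x, OF x sx]) (assumption | rule that)+
  obtain G E :: "nat \<Rightarrow> 'a \<Rightarrow> complex" where GE: "\<And>n. G n \<in> M" "\<And>n. E n \<in> M" "\<And>n. mbound (E n) 1"
    "\<And>z. z \<in> X \<Longrightarrow> (\<lambda>n. E n z) \<longlonglongrightarrow> 0" "\<And>n z. (one z - \<psi> z) * G n z + E n z = one z"
    by (rule Abel_multipliers[OF psi(1-3)]) (assumption | rule that)+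
  have "(\<lambda>n. \<Sum>k. inn (\<lambda>z. f z * E n z * x i k z) (y i k)) \<longlonglongrightarrow> 0" if i: "i < m" for i
  proof -
    have lim: "(\<lambda>n. inn (\<lambda>z. f z * E n z * x i k z) (y i k)) \<longlonglongrightarrow> 0" for k
    proof (rule weakly_null)
      show "(\<lambda>z. f z * E n z * x i k z) \<in> H" for n by (intro M_H M_mult f GE x i)
      show "nrm (\<lambda>z. f z * E n z * x i k z) \<le> mnorm f * nrm (x i k)" for n
      proof -
        have "nrm (\<lambda>z. f z * (E n z * x i k z)) \<le> mnorm f * nrm (\<lambda>z. E n z * x i k z)"
          by (intro nrm_mult_le f M_H GE x i)
        also have "\<dots> \<le> mnorm f * nrm (x i k)"
          using mboundD[OF GE(3) x[OF i]] by (intro mult_left_mono mnorm_nonneg f) simp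
        finally show ?thesis by (simp add: mult.assoc)
      qed
      show "(\<lambda>n. f z * E n z * x i k z) \<longlonglongrightarrow> 0" if "z \<in> X" for z
        using tendsto_mult[OF tendsto_mult[OF tendsto_const GE(4)[OF that]] tendsto_const, of "f z" "x i k z"] by simp
      show "y i k \<in> H" by (rule y[OF i])
    qed
    have bd: "norm (inn (\<lambda>z. f z * E n z * x i k z) (y i k)) \<le> mnorm f * (nrm (x i k) * nrm (y i k))" for k n
    proof -
      have "norm (inn (\<lambda>z. f z * E n z * x i k z) (y i k)) \<le> mnorm (\<lambda>z. f z * E n z) * (nrm (x i k) * nrm (y i k))"
        by (intro inn_mult_le M_mult f GE x y i)
      also have "\<dots> \<le> mnorm f * (nrm (x i k) * nrm (y i k))"
      proof (intro mult_right_mono mult_nonneg_nonneg nrm_nonneg x y i)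
        have "mnorm (\<lambda>z. f z * E n z) \<le> mnorm f * mnorm (E n)" by (intro mnorm_mult_le f GE)
        also have "\<dots> \<le> mnorm f * 1" by (intro mult_left_mono mnorm_le GE mnorm_nonneg f)
        finally show "mnorm (\<lambda>z. f z * E n z) \<le> mnorm f" by simp
      qed
      finally show ?thesis .
    qed
    have sM: "summable (\<lambda>k. mnorm f * (nrm (x i k) * nrm (y i k)))"
      by (intro summable_mult summable_nrm_mult x y i sx sy)
    have "(\<lambda>n. \<Sum>k. inn (\<lambda>z. f z * E n z * x i k z) (y i k)) \<longlonglongrightarrow> (\<Sum>k. 0)"
      by (rule tannerys_theorem[THEN conjunct2, THEN conjunct2, OF lim _ sM])
        (use bd i in \<open>auto intro!: always_eventually\<close>)
    then show ?thesis by simp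
  qed
  then have "\<forall>i\<in>{..<m}. eventually (\<lambda>n. cmod (\<Sum>k. inn (\<lambda>z. f z * E n z * x i k z) (y i k)) < e / 2) sequentially"
    using e by (intro ballI order_tendstoD(2)[where y=0, simplified] tendsto_norm_zero) auto
  then have "eventually (\<lambda>n. \<forall>i\<in>{..<m}. cmod (\<Sum>k. inn (\<lambda>z. f z * E n z * x i k z) (y i k)) < e / 2) sequentially"
    by (simp add: eventually_ball_finite)
  then obtain n where n: "\<And>i. i < m \<Longrightarrow> cmod (\<Sum>k. inn (\<lambda>z. f z * E n z * x i k z) (y i k)) < e / 2"
    by (auto simp: eventually_sequentially)
  define Y where "Y = (\<Sum>i<m. \<Sum>k. (nrm (y i k))\<^sup>2)"
  have Yi: "(\<Sum>k. (nrm (y i k))\<^sup>2) \<le> Y" if "i < m" for i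
    unfolding Y_def by (rule member_le_sum) (use that sy in \<open>auto intro!: suminf_nonneg\<close>)
  have Y0: "Y \<ge> 0" unfolding Y_def by (intro sum_nonneg suminf_nonneg sy) auto
  \<comment> \<open>Chosen so that the column estimate \<open>d * (1 + Y)\<close> for the middle
    term equals \<open>e / 2\<close>; the other half was spent on the term with
    \<open>E n\<close>.\<close>
  define d where "d = e / (2 * (1 + Y))"
  have d: "d > 0" unfolding d_def using e Y0 by simp
  obtain g' where g': "g' \<in> I" "nrm (\<lambda>z. f z * G n z - g' z) < d" using dense[OF GE(1) d] by blast
  have g'M: "g' \<in> M" using I(1) g'(1) by blast
  define p where "p = (\<lambda>z. f z * G n z - g' z)"
  have pH: "p \<in> H" unfolding p_def by (intro M_subset_H M_diff M_mult f GE g'M)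
  define g where "g = (\<lambda>z. (one z - \<psi> z) * g' z)"
  have gI: "g \<in> I" unfolding g_def by (intro I(2) g' M_diff one_M psi)
  have gM: "g \<in> M" using I(1) gI by blast
  have "cmod ((\<Sum>k. inn (\<lambda>z. g z * x i k z) (y i k)) - (\<Sum>k. inn (\<lambda>z. f z * x i k z) (y i k))) < e" if i: "i < m" for i
  proof -
    let ?A = "\<lambda>k. \<lambda>z. (one z - \<psi> z) * x i k z * p z"
    have AH: "?A k \<in> H" for k by (rule psi(4)[OF pH i])
    have EM: "(\<lambda>z. f z * E n z) \<in> M" by (intro M_mult f GE)
    have id: "inn (\<lambda>z. f z * x i k z) (y i k) = inn (\<lambda>z. g z * x i k z) (y i k) + (inn (?A k) (y i k) + inn (\<lambda>z. f z * E n z * x i k z) (y i k))" for k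
    proof -
      have "f z * x i k z = g z * x i k z + (?A k z + f z * E n z * x i k z)" for z
      proof -
        have "f z * x i k z = (f z * one z) * x i k z" by (simp add: mult_one f)
        also have "\<dots> = f z * ((one z - \<psi> z) * G n z + E n z) * x i k z" by (simp only: GE(5))
        also have "\<dots> = g z * x i k z + (?A k z + f z * E n z * x i k z)"
          by (simp add: g_def p_def algebra_simps)
        finally show ?thesis .
      qed
      then have "(\<lambda>z. f z * x i k z) = (\<lambda>z. g z * x i k z + (?A k z + f z * E n z * x i k z))" by blast
      then have "inn (\<lambda>z. f z * x i k z) (y i k) = inn (\<lambda>z. g z * x i k z + (?A k z + f z * E n z * x i k z)) (y i k)" by (simp only:)
      also have "\<dots> = inn (\<lambda>z. g z * x i k z) (y i k) + inn (\<lambda>z. ?A k z + f z * E n z * x i k z) (y i k)"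
        by (intro inn_add_left H_add M_H gM EM x y i AH)
      also have "inn (\<lambda>z. ?A k z + f z * E n z * x i k z) (y i k) = inn (?A k) (y i k) + inn (\<lambda>z. f z * E n z * x i k z) (y i k)"
        by (intro inn_add_left H_add M_H gM EM x y i AH)
      finally show ?thesis .
    qed
    have sg: "summable (\<lambda>k. inn (\<lambda>z. g z * x i k z) (y i k))" by (intro summable_inn_mult gM x y i sx sy)
    have sE: "summable (\<lambda>k. inn (\<lambda>z. f z * E n z * x i k z) (y i k))" by (intro summable_inn_mult EM x y i sx sy)
    have sf: "summable (\<lambda>k. inn (\<lambda>z. f z * x i k z) (y i k))" by (intro summable_inn_mult f x y i sx sy)
    have pd: "(nrm p)\<^sup>2 \<le> d\<^sup>2" using g'(2) nrm_nonneg[OF pH] by (intro power_mono) (auto simp: p_def)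
    have part: "(\<Sum>k<N. norm (inn (?A k) (y i k))) \<le> d * (1 + Y)" for N
    proof -
      \<comment> \<open>The weight \<open>d\<close> balances the two sums: the column part is at
        most \<open>d^2 / d\<close> since \<open>nrm p \<le> d\<close>, and the \<open>y\<close>
        part is at most \<open>d * Y\<close>.\<close>
      have "norm (inn (?A k) (y i k)) \<le> (nrm (?A k))\<^sup>2 / d + d * (nrm (y i k))\<^sup>2" for k
      proof -
        have "0 \<le> (nrm (?A k) - d * nrm (y i k))\<^sup>2" by simp
        then have "2 * d * (nrm (?A k) * nrm (y i k)) \<le> (nrm (?A k))\<^sup>2 + d\<^sup>2 * (nrm (y i k))\<^sup>2"
          by (simp add: power2_diff power_mult_distrib mult_ac)
        moreover have "0 \<le> d * (nrm (?A k) * nrm (y i k))" using d nrm_nonneg[OF AH] nrm_nonneg[OF y[OF i]] by simp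
        ultimately have "d * (nrm (?A k) * nrm (y i k)) \<le> (nrm (?A k))\<^sup>2 + d\<^sup>2 * (nrm (y i k))\<^sup>2" by linarith
        then have "nrm (?A k) * nrm (y i k) \<le> (nrm (?A k))\<^sup>2 / d + d * (nrm (y i k))\<^sup>2"
          using d by (simp add: field_simps power2_eq_square)
        then show ?thesis using inn_le[OF AH y[OF i], of k k] by linarith
      qed
      then have "(\<Sum>k<N. norm (inn (?A k) (y i k))) \<le> (\<Sum>k<N. (nrm (?A k))\<^sup>2 / d + d * (nrm (y i k))\<^sup>2)"
        by (intro sum_mono)
      also have "\<dots> = (\<Sum>k<N. (nrm (?A k))\<^sup>2) / d + d * (\<Sum>k<N. (nrm (y i k))\<^sup>2)"
        by (simp add: sum.distrib sum_divide_distrib sum_distrib_left)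
      also have "\<dots> \<le> d\<^sup>2 / d + d * Y"
      proof (intro add_mono divide_right_mono mult_left_mono)
        show "(\<Sum>k<N. (nrm (?A k))\<^sup>2) \<le> d\<^sup>2" using psi(5)[OF pH i, of N] pd by linarith
        have "(\<Sum>k<N. (nrm (y i k))\<^sup>2) \<le> (\<Sum>k. (nrm (y i k))\<^sup>2)" by (intro sum_le_suminf sy i) auto
        then show "(\<Sum>k<N. (nrm (y i k))\<^sup>2) \<le> Y" using Yi[OF i] by linarith
      qed (use d in auto)
      also have "\<dots> = d * (1 + Y)" using d by (simp add: power2_eq_square algebra_simps)
      finally show ?thesis .
    qed
    have sA: "summable (\<lambda>k. norm (inn (?A k) (y i k)))" by (rule summableI_nonneg_bounded[OF _ part]) simp
    have "norm (\<Sum>k. inn (?A k) (y i k)) \<le> (\<Sum>k. norm (inn (?A k) (y i k)))" by (rule summable_norm[OF sA])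
    also have "\<dots> \<le> d * (1 + Y)" by (intro suminf_le_const sA part)
    also have "\<dots> = e / 2"
    proof -
      have "e / (2 * D) * D = e / 2" if "D > 0" for D :: real using that by simp
      from this[of "1 + Y"] Y0 show ?thesis by (simp only: d_def)
    qed
    finally have A: "norm (\<Sum>k. inn (?A k) (y i k)) \<le> e / 2" .
    have "(\<Sum>k. inn (\<lambda>z. f z * x i k z) (y i k)) = (\<Sum>k. inn (\<lambda>z. g z * x i k z) (y i k)) +
       ((\<Sum>k. inn (?A k) (y i k)) + (\<Sum>k. inn (\<lambda>z. f z * E n z * x i k z) (y i k)))"
      unfolding id using suminf_add[OF sg summable_add[OF summable_norm_cancel[OF sA] sE]] suminf_add[OF summable_norm_cancel[OF sA] sE]
      by simp
    then have "(\<Sum>k. inn (\<lambda>z. g z * x i k z) (y i k)) - (\<Sum>k. inn (\<lambda>z. f z * x i k z) (y i k))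
      = - ((\<Sum>k. inn (?A k) (y i k)) + (\<Sum>k. inn (\<lambda>z. f z * E n z * x i k z) (y i k)))"
      by simp
    then have "cmod ((\<Sum>k. inn (\<lambda>z. g z * x i k z) (y i k)) - (\<Sum>k. inn (\<lambda>z. f z * x i k z) (y i k)))
      = cmod ((\<Sum>k. inn (?A k) (y i k)) + (\<Sum>k. inn (\<lambda>z. f z * E n z * x i k z) (y i k)))"
      by (simp only: norm_minus_cancel)
    also have "\<dots> < e"
      using norm_triangle_ineq[of "\<Sum>k. inn (?A k) (y i k)" "\<Sum>k. inn (\<lambda>z. f z * E n z * x i k z) (y i k)"] A n[OF i]
      by linarith
    finally show ?thesis .
  qed
  with gI show ?thesis by blast
qed

end

section \<open>The quotient by an ideal\<close>

lemma cinner_psd: "psd_on S cinner"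
proof -
  have "psd_on S (\<lambda>z w. \<Sum>i\<in>UNIV. z $ i * cnj (w $ i))"
    by (intro psd_on_sum psd_on_rank_one)
  then show ?thesis by (simp add: cinner_def[abs_def])
qed

lemma cinner_self: "cinner z z = of_real ((norm z)\<^sup>2)"
  by (simp add: cinner_def norm_vec_def L2_set_def sum_nonneg complex_norm_square del: of_real_power)

lemma cinner_less_1:
  assumes "z \<in> Bd" "w \<in> Bd"
  shows "cmod (cinner z w) < 1"
proof -
  have n: "norm z < 1" "norm w < 1" using assms by (simp_all add: Bd_def)
  have "(cmod (cinner z w))\<^sup>2 \<le> Re (cinner z z) * Re (cinner w w)"
    by (rule psd_on_Cauchy_Schwarz[OF cinner_psd[of UNIV]]) auto
  also have "\<dots> = (norm z * norm w)\<^sup>2" by (simp add: cinner_self power_mult_distrib del: of_real_power)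
  finally have "cmod (cinner z w) \<le> norm z * norm w" by (simp add: power2_le_iff_abs_le)
  also have "\<dots> \<le> norm z * 1" using n by (intro mult_left_mono) auto
  finally show ?thesis using n by simp
qed

lemma ui_series_summable:
  fixes a :: "nat \<Rightarrow> real" and x :: complex
  assumes pos: "\<forall>n\<ge>1. a n > 0" and lim: "(\<lambda>n. a n / a (Suc n)) \<longlonglongrightarrow> 1" and x: "cmod x < 1"
  shows "summable (\<lambda>n. of_real (a (Suc n)) * x ^ Suc n)"
proof -
  define c where "c = (1 + cmod x) / 2"
  have c: "cmod x < c" "c < 1" "c > 0" using x by (auto simp: c_def add_pos_nonneg)
  have "cmod x / c < 1" using c by simp
  from order_tendstoD(1)[OF lim this] obtain N where N: "\<And>n. n \<ge> N \<Longrightarrow> cmod x / c < a n / a (Suc n)"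
    by (auto simp: eventually_sequentially)
  show ?thesis
  proof (rule summable_ratio_test[OF c(2), of N])
    fix n assume "N \<le> n"
    then have "cmod x / c < a (Suc n) / a (Suc (Suc n))" using N[of "Suc n"] by simp
    moreover have p: "a (Suc n) > 0" "a (Suc (Suc n)) > 0" using pos by simp_all
    ultimately have "a (Suc (Suc n)) * cmod x \<le> c * a (Suc n)" using c by (simp add: field_simps)
    then have "(a (Suc (Suc n)) * cmod x) * cmod x ^ Suc n \<le> (c * a (Suc n)) * cmod x ^ Suc n"
      by (intro mult_right_mono zero_le_power norm_ge_zero)
    then show "norm (of_real (a (Suc (Suc n))) * x ^ Suc (Suc n)) \<le> c * norm (of_real (a (Suc n)) * x ^ Suc n)"
      using p by (simp add: norm_mult norm_power mult_ac)
  qed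
qed

text \<open>Powers of the Euclidean inner product are positive by the Schur product theorem, hence
  so are the partial sums with coefficients \<open>a n > 0\<close> and their limit. On the diagonal
  all terms are nonnegative, so the kernel is at least \<open>1\<close> there.\<close>

lemma ui_kernel_pick_space:
  fixes a :: "nat \<Rightarrow> real"
  assumes "regular_ui_cnp a TYPE('d::finite)"
  shows "pick_space (Bd :: (complex^'d) set) (ui_kernel a)"
proof
  have pos: "\<forall>n\<ge>1. a n > 0" and lim: "(\<lambda>n. a n / a (Suc n)) \<longlonglongrightarrow> 1"
    and pick: "psd_on (Bd :: (complex^'d) set) (\<lambda>z w. 1 - 1 / ui_kernel a z w)"
    using assms by (auto simp: regular_ui_cnp_def)
  have sums: "(\<lambda>N. 1 + (\<Sum>n<N. of_real (a (Suc n)) * cinner z w ^ Suc n)) \<longlonglongrightarrow> ui_kernel a z w"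
    if "z \<in> Bd" "w \<in> Bd" for z w :: "complex^'d"
    unfolding ui_kernel_def
    by (intro tendsto_add tendsto_const summable_LIMSEQ ui_series_summable pos lim cinner_less_1 that)
  show "psd_on (Bd :: (complex^'d) set) (ui_kernel a)"
  proof (rule psd_on_LIMSEQ)
    show "psd_on (Bd :: (complex^'d) set) (\<lambda>z w. 1 + (\<Sum>n<N. of_real (a (Suc n)) * cinner z w ^ Suc n))" for N
      by (intro psd_on_add psd_on_one psd_on_sum psd_on_scale psd_on_power cinner_psd) (use pos in \<open>auto intro: less_imp_le\<close>)
  qed (rule sums)
  show "0 < Re (ui_kernel a z z)" if z: "z \<in> Bd" for z :: "complex^'d"
  proof -
    have "1 \<le> Re (1 + (\<Sum>n<N. of_real (a (Suc n)) * cinner z z ^ Suc n))" for N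
    proof -
      have "1 + (\<Sum>n<N. of_real (a (Suc n)) * cinner z z ^ Suc n) = of_real (1 + (\<Sum>n<N. a (Suc n) * ((norm z)\<^sup>2) ^ Suc n))"
        unfolding cinner_self by simp
      moreover have "0 \<le> (\<Sum>n<N. a (Suc n) * ((norm z)\<^sup>2) ^ Suc n)"
        using pos by (intro sum_nonneg mult_nonneg_nonneg) (auto intro: less_imp_le)
      ultimately show ?thesis by (simp only: Re_complex_of_real le_add_same_cancel1)
    qed
    then have "1 \<le> Re (ui_kernel a z z)"
      by (intro LIMSEQ_le_const[OF tendsto_Re[OF sums[OF z z]]]) blast
    then show ?thesis by simp
  qed
  show "psd_on (Bd :: (complex^'d) set) (\<lambda>z w. 1 - 1 / ui_kernel a z w)" by (rule pick)
qed

lemma Hspace_rk: "Hspace a = rk_space Bd (ui_kernel a)"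
  unfolding Hspace_def rk_space_def ..

lemma Hnorm_rk: "Hnorm a = rk_norm Bd (ui_kernel a)"
  unfolding Hnorm_def[abs_def] rk_norm_def[abs_def] ..

lemma Hinner_rk: "Hinner a = rk_inner Bd (ui_kernel a)"
  unfolding Hinner_def[abs_def] rk_inner_def[abs_def] Hnorm_rk ..

lemma Mult_rk: "Mult a = rk_mult Bd (ui_kernel a)"
  unfolding Mult_def rk_mult_def Hspace_rk ..

locale ui_ideal = pick_space "Bd :: (complex^'d::finite) set" "ui_kernel a" for a :: "nat \<Rightarrow> real" +
  fixes I :: "(complex^'d \<Rightarrow> complex) set"
  assumes I_ideal: "is_ideal a I"
begin

lemma I_M: "f \<in> I \<Longrightarrow> f \<in> M"
  and I_zero: "(\<lambda>z. 0) \<in> I"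
  and I_add: "f \<in> I \<Longrightarrow> g \<in> I \<Longrightarrow> (\<lambda>z. f z + g z) \<in> I"
  and I_cmult: "f \<in> I \<Longrightarrow> (\<lambda>z. c * f z) \<in> I"
  and I_mult: "f \<in> I \<Longrightarrow> g \<in> M \<Longrightarrow> (\<lambda>z. g z * f z) \<in> I"
  using I_ideal unfolding is_ideal_def Mult_rk by blast+

lemma I_sum: "(\<And>i. i \<in> A \<Longrightarrow> f i \<in> I) \<Longrightarrow> (\<lambda>z. \<Sum>i\<in>A. f i z) \<in> I"
  by (induction A rule: infinite_finite_induct) (simp_all add: I_zero I_add)

abbreviation "N \<equiv> aH_closed_span a I"

text \<open>The closed span of the products \<open>f h\<close> is simply the closure of
  \<open>I\<close> in \<open>H\<close>: kernel combinations are dense in \<open>H\<close> and are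
  multipliers, so \<open>h\<close> can be replaced by one of them and the product stays in
  \<open>I\<close>. Conversely \<open>p = p * one\<close> with \<open>one\<close> in
  \<open>H\<close>.\<close>

lemma N_iff: "g \<in> N \<longleftrightarrow> g \<in> H \<and> (\<forall>e>0. \<exists>p\<in>I. nrm (\<lambda>z. g z - p z) < e)"
proof (intro iffI conjI allI impI; (elim conjE)?)
  assume "g \<in> N"
  then show gH: "g \<in> H" by (simp add: aH_closed_span_def Hspace_rk)
  fix e :: real assume e: "e > 0"
  then have "e / 2 > 0" by simp
  with \<open>g \<in> N\<close> obtain n :: nat and c f h where fh: "\<forall>i<n. f i \<in> I \<and> h i \<in> H"
    and le: "nrm (\<lambda>z. g z - (\<Sum>i<n. c i * f i z * h i z)) < e / 2"
    unfolding aH_closed_span_def Hspace_rk Hnorm_rk by blast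
  \<comment> \<open>The tolerance for \<open>h i\<close> shares \<open>e / 2\<close> among the
    \<open>n\<close> terms after multiplication by \<open>c i\<close> and \<open>f i\<close>; both
    summands \<open>1\<close> only keep the denominators positive.\<close>
  define d where "d i = e / (2 * (real n + 1) * (cmod (c i) * mnorm (f i) + 1))" for i
  have nn: "0 \<le> cmod (c i) * mnorm (f i)" if "i < n" for i using fh that mnorm_nonneg I_M by simp
  have d: "d i > 0" if "i < n" for i
    unfolding d_def using nn[OF that] e by (intro divide_pos_pos mult_pos_pos add_nonneg_pos) auto
  have "\<exists>v. v \<in> V \<and> nrm (\<lambda>z. h i z - kern v z) < d i" if "i < n" for i
  proof -
    have hi: "h i \<in> H" using fh that by blast
    show ?thesis by (rule kern_dense[OF hi d[OF that]]) blast
  qed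
  then obtain v where v: "\<And>i. i < n \<Longrightarrow> v i \<in> V \<and> nrm (\<lambda>z. h i z - kern (v i) z) < d i" by metis
  let ?p = "\<lambda>z. \<Sum>i<n. c i * (kern (v i) z * f i z)"
  have pI: "?p \<in> I" by (intro I_sum I_cmult I_mult kern_M) (use fh v in auto)
  have term1: "nrm (\<lambda>z. c i * (f i z * (h i z - kern (v i) z))) \<le> e / (2 * (real n + 1))" if i: "i < n" for i
  proof -
    have fi: "f i \<in> M" and hi: "h i \<in> H" and vi: "v i \<in> V" "nrm (\<lambda>z. h i z - kern (v i) z) < d i"
      using fh v i I_M by blast+
    have dH: "(\<lambda>z. h i z - kern (v i) z) \<in> H" by (intro H_diff hi kern_H vi)
    have "nrm (\<lambda>z. c i * (f i z * (h i z - kern (v i) z))) = cmod (c i) * nrm (\<lambda>z. f i z * (h i z - kern (v i) z))"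
      by (intro nrm_cmult M_H fi dH)
    also have "\<dots> \<le> cmod (c i) * (mnorm (f i) * d i)"
      using vi(2) by (intro mult_left_mono order_trans[OF nrm_mult_le[OF fi dH]] mnorm_nonneg fi) auto
    also have "\<dots> \<le> (cmod (c i) * mnorm (f i) + 1) * d i" using d[OF i] by (simp add: algebra_simps)
    also have "\<dots> = e / (2 * (real n + 1))" using nn[OF i] by (simp add: d_def)
    finally show ?thesis .
  qed
  have tH: "(\<lambda>z. c i * (f i z * (h i z - kern (v i) z))) \<in> H" if "i < n" for i
    using fh v that by (intro H_cmult M_H H_diff kern_H I_M) auto
  have sH: "(\<lambda>z. g z - (\<Sum>i<n. c i * f i z * h i z)) \<in> H"
  proof -
    have "(\<lambda>z. \<Sum>i<n. c i * (f i z * h i z)) \<in> H" using fh by (intro H_sum H_cmult M_H I_M) auto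
    then show ?thesis using H_diff[OF gH] by (simp add: mult.assoc)
  qed
  have "nrm (\<lambda>z. \<Sum>i<n. c i * (f i z * (h i z - kern (v i) z))) \<le> (\<Sum>i<n. e / (2 * (real n + 1)))"
    by (intro order_trans[OF nrm_sum_le sum_mono] tH term1) auto
  also have "\<dots> \<le> e / 2" using e by (simp add: field_simps)
  finally have s: "nrm (\<lambda>z. \<Sum>i<n. c i * (f i z * (h i z - kern (v i) z))) \<le> e / 2" .
  have "(\<lambda>z. g z - ?p z) = (\<lambda>z. (g z - (\<Sum>i<n. c i * f i z * h i z)) + (\<Sum>i<n. c i * (f i z * (h i z - kern (v i) z))))"
    by (simp add: fun_eq_iff algebra_simps sum_subtractf)
  moreover have "nrm (\<lambda>z. (g z - (\<Sum>i<n. c i * f i z * h i z)) + (\<Sum>i<n. c i * (f i z * (h i z - kern (v i) z))))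
    \<le> nrm (\<lambda>z. g z - (\<Sum>i<n. c i * f i z * h i z)) + nrm (\<lambda>z. \<Sum>i<n. c i * (f i z * (h i z - kern (v i) z)))"
    by (intro nrm_triangle sH H_sum tH) auto
  ultimately have "nrm (\<lambda>z. g z - ?p z) < e" using le s by simp
  then show "\<exists>p\<in>I. nrm (\<lambda>z. g z - p z) < e" using pI by (rule bexI)
next
  assume g: "g \<in> H" and app: "\<forall>e>0. \<exists>p\<in>I. nrm (\<lambda>z. g z - p z) < e"
  have "\<exists>(n::nat) c f h. (\<forall>i<n. f i \<in> I \<and> h i \<in> H) \<and> nrm (\<lambda>z. g z - (\<Sum>i<n. c i * f i z * h i z)) < e" if "e > 0" for e
  proof -
    obtain p where p: "p \<in> I" "nrm (\<lambda>z. g z - p z) < e" using app \<open>e > 0\<close> by blast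
    have "(\<lambda>z. g z - (\<Sum>i<(1::nat). 1 * p z * one z)) = (\<lambda>z. g z - p z)"
      by (simp add: fun_eq_iff mult_one(1)[OF I_M[OF p(1)]])
    then have "(\<forall>i<(1::nat). p \<in> I \<and> one \<in> H) \<and> nrm (\<lambda>z. g z - (\<Sum>i<(1::nat). 1 * p z * one z)) < e" using p by simp
    then show ?thesis by (intro exI[of _ 1] exI[of _ "\<lambda>_. 1"] exI[of _ "\<lambda>_. p"] exI[of _ "\<lambda>_. one"])
  qed
  with g show "g \<in> N" unfolding aH_closed_span_def Hspace_rk Hnorm_rk by blast
qed

lemma N_H: "g \<in> N \<Longrightarrow> g \<in> H"
  by (simp add: N_iff)

lemma I_N: "f \<in> I \<Longrightarrow> f \<in> N"
proof -
  assume f: "f \<in> I"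
  have "\<exists>p\<in>I. nrm (\<lambda>z. f z - p z) < e" if "e > 0" for e
    using that f by (intro bexI[of _ f]) auto
  then show ?thesis using f by (auto simp: N_iff intro: M_subset_H I_M)
qed

lemma N_add:
  assumes "f \<in> N" "g \<in> N"
  shows "(\<lambda>z. f z + g z) \<in> N"
  unfolding N_iff
proof (intro conjI allI impI)
  show "(\<lambda>z. f z + g z) \<in> H" by (intro H_add N_H assms)
  fix e :: real assume "e > 0"
  then have "e / 2 > 0" by simp
  then obtain p r where p: "p \<in> I" "nrm (\<lambda>z. f z - p z) < e / 2" and r: "r \<in> I" "nrm (\<lambda>z. g z - r z) < e / 2"
    using assms unfolding N_iff by blast
  have "nrm (\<lambda>z. (f z - p z) + (g z - r z)) \<le> nrm (\<lambda>z. f z - p z) + nrm (\<lambda>z. g z - r z)"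
    by (intro nrm_triangle H_diff N_H assms I_N p r)
  then have "nrm (\<lambda>z. f z + g z - (p z + r z)) < e" using p r by (simp add: algebra_simps)
  then show "\<exists>p\<in>I. nrm (\<lambda>z. f z + g z - p z) < e" using I_add[OF p(1) r(1)] by (rule bexI)
qed

lemma N_mult:
  assumes "\<phi> \<in> M" "g \<in> N"
  shows "(\<lambda>z. \<phi> z * g z) \<in> N"
  unfolding N_iff
proof (intro conjI allI impI)
  show "(\<lambda>z. \<phi> z * g z) \<in> H" by (intro M_H N_H assms)
  fix e :: real assume e: "e > 0"
  have m: "mnorm \<phi> \<ge> 0" by (rule mnorm_nonneg[OF assms(1)])
  have "e / (mnorm \<phi> + 1) > 0" using e m by simp
  then obtain p where p: "p \<in> I" "nrm (\<lambda>z. g z - p z) < e / (mnorm \<phi> + 1)"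
    using assms(2) unfolding N_iff by blast
  have dH: "(\<lambda>z. g z - p z) \<in> H" by (intro H_diff N_H assms I_N p)
  have "nrm (\<lambda>z. \<phi> z * (g z - p z)) \<le> mnorm \<phi> * nrm (\<lambda>z. g z - p z)" by (intro nrm_mult_le assms dH)
  also have "\<dots> \<le> (mnorm \<phi> + 1) * nrm (\<lambda>z. g z - p z)" using nrm_nonneg[OF dH] by (intro mult_right_mono) auto
  also have "\<dots> < (mnorm \<phi> + 1) * (e / (mnorm \<phi> + 1))" using p(2) m by (intro mult_strict_left_mono) auto
  also have "\<dots> = e" using m by simp
  finally have "nrm (\<lambda>z. \<phi> z * g z - \<phi> z * p z) < e" by (simp add: right_diff_distrib)
  then show "\<exists>p\<in>I. nrm (\<lambda>z. \<phi> z * g z - p z) < e" using I_mult[OF p(1) assms(1)] by (rule bexI)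
qed

lemma N_cmult: "g \<in> N \<Longrightarrow> (\<lambda>z. c * g z) \<in> N"
proof -
  assume g: "g \<in> N"
  have "(\<lambda>z. (c * one z) * g z) \<in> N" by (intro N_mult M_cmult one_M g)
  moreover have "(\<lambda>z. (c * one z) * g z) = (\<lambda>z. c * g z)"
    using H_off[OF N_H[OF g]] by (auto simp: one_def fun_eq_iff)
  ultimately show ?thesis by simp
qed

lemma N_diff: "f \<in> N \<Longrightarrow> g \<in> N \<Longrightarrow> (\<lambda>z. f z - g z) \<in> N"
  using N_add[OF _ N_cmult, of f g "-1"] by simp

lemma N_sum: "(\<And>i. i \<in> A \<Longrightarrow> f i \<in> N) \<Longrightarrow> (\<lambda>z. \<Sum>i\<in>A. f i z) \<in> N"
  by (induction A rule: infinite_finite_induct) (simp_all add: N_add I_N I_zero)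

lemma N_closed:
  assumes g: "g \<in> H" and app: "\<And>e. e > 0 \<Longrightarrow> \<exists>n\<in>N. nrm (\<lambda>z. g z - n z) < e"
  shows "g \<in> N"
  unfolding N_iff
proof (intro conjI allI impI g)
  fix e :: real assume "e > 0"
  then have e: "e / 2 > 0" by simp
  obtain n where n: "n \<in> N" "nrm (\<lambda>z. g z - n z) < e / 2" using app[OF e] by blast
  obtain p where p: "p \<in> I" "nrm (\<lambda>z. n z - p z) < e / 2" using n(1) e unfolding N_iff by blast
  have "nrm (\<lambda>z. (g z - n z) + (n z - p z)) \<le> nrm (\<lambda>z. g z - n z) + nrm (\<lambda>z. n z - p z)"
    by (intro nrm_triangle H_diff g N_H n I_N p)
  then have "nrm (\<lambda>z. g z - p z) < e" using n p by simp
  then show "\<exists>p\<in>I. nrm (\<lambda>z. g z - p z) < e" using p(1) by blast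
qed

text \<open>Here the roles are exchanged: \<open>h\<close> is any vector and \<open>f\<close> is a
  multiplier. Approximating \<open>h\<close> by a kernel combination, which is a multiplier, reduces
  the claim to \<open>N_mult\<close>.\<close>

lemma N_mult_H:
  assumes fM: "f \<in> M" and f: "f \<in> N" and h: "h \<in> H"
  shows "(\<lambda>z. f z * h z) \<in> N"
proof (rule N_closed)
  show "(\<lambda>z. f z * h z) \<in> H" by (intro M_H fM h)
  fix e :: real assume e: "e > 0"
  have m: "mnorm f \<ge> 0" by (rule mnorm_nonneg[OF fM])
  have "e / (mnorm f + 1) > 0" using e m by simp
  then obtain v where v: "v \<in> V" "nrm (\<lambda>z. h z - kern v z) < e / (mnorm f + 1)" by (rule kern_dense[OF h])
  have dH: "(\<lambda>z. h z - kern v z) \<in> H" by (intro H_diff h kern_H v)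
  have "nrm (\<lambda>z. f z * (h z - kern v z)) \<le> mnorm f * nrm (\<lambda>z. h z - kern v z)" by (intro nrm_mult_le fM dH)
  also have "\<dots> \<le> (mnorm f + 1) * nrm (\<lambda>z. h z - kern v z)" using nrm_nonneg[OF dH] by (intro mult_right_mono) auto
  also have "\<dots> < (mnorm f + 1) * (e / (mnorm f + 1))" using v(2) m by (intro mult_strict_left_mono) auto
  also have "\<dots> = e" using m by simp
  finally have "nrm (\<lambda>z. f z * h z - kern v z * f z) < e" by (simp add: right_diff_distrib mult.commute)
  then show "\<exists>n\<in>N. nrm (\<lambda>z. f z * h z - n z) < e" using N_mult[OF kern_M[OF v(1)] f] by (rule bexI)
qed

section \<open>The quotient space and its compressions\<close>

abbreviation "L \<equiv> Hquot a I"

lemma L_iff: "h \<in> L \<longleftrightarrow> h \<in> H \<and> (\<forall>g\<in>N. inn h g = 0)"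
  by (simp add: Hquot_def Hspace_rk Hinner_rk)

lemma L_H: "h \<in> L \<Longrightarrow> h \<in> H"
  by (simp add: L_iff)

lemma L_diff: "f \<in> L \<Longrightarrow> g \<in> L \<Longrightarrow> (\<lambda>z. f z - g z) \<in> L"
  by (auto simp: L_iff inn_diff_left N_H H_diff)

lemma L_cmult: "f \<in> L \<Longrightarrow> (\<lambda>z. c * f z) \<in> L"
  by (auto simp: L_iff inn_cmult_left N_H H_cmult)

lemma L_sum: "(\<And>i. i \<in> A \<Longrightarrow> f i \<in> L) \<Longrightarrow> (\<lambda>z. \<Sum>i\<in>A. f i z) \<in> L"
  by (auto simp: L_iff inn_sum_left N_H H_sum)

lemma L_N_zero: "f \<in> L \<Longrightarrow> f \<in> N \<Longrightarrow> f = (\<lambda>z. 0)"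
proof -
  assume f: "f \<in> L" "f \<in> N"
  then have "inn f f = 0" by (simp add: L_iff)
  then have "nrm f = 0" using inn_self[OF L_H[OF f(1)]] by simp
  then show ?thesis by (rule nrm_eq_0[OF L_H[OF f(1)]])
qed

text \<open>\<open>projQ\<close> is a definite description, so uniqueness is needed besides the
  orthogonal decomposition: the difference of two candidates lies in \<open>L\<close> and is
  orthogonal to \<open>L\<close>.\<close>

lemma projQ:
  assumes h: "h \<in> H"
  shows "projQ a I h \<in> L" "(\<lambda>z. h z - projQ a I h z) \<in> N"
proof -
  obtain n where n: "n \<in> N" "\<And>q. q \<in> N \<Longrightarrow> inn (\<lambda>z. h z - n z) q = 0"
    by (rule orthogonal_decomposition[of N h])
      (use N_H I_N[OF I_zero] N_add N_cmult N_closed h in \<open>auto\<close>)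
  let ?p = "\<lambda>z. h z - n z"
  have pL: "?p \<in> L" unfolding L_iff using n by (auto intro: H_diff h N_H)
  have "projQ a I h = ?p" unfolding projQ_def Hinner_rk
  proof (rule the_equality)
    have "inn (\<lambda>z. h z - ?p z) q = 0" if q: "q \<in> L" for q
      using inn_cnj[OF L_H[OF q] N_H[OF n(1)]] q n(1) by (simp add: L_iff)
    with pL show "?p \<in> L \<and> (\<forall>q\<in>L. inn (\<lambda>z. h z - ?p z) q = 0)" by blast
    fix p' assume p': "p' \<in> L \<and> (\<forall>q\<in>L. inn (\<lambda>z. h z - p' z) q = 0)"
    let ?d = "\<lambda>z. ?p z - p' z"
    have p'H: "p' \<in> H" using p' L_H by blast
    have dL: "?d \<in> L" by (intro L_diff pL) (use p' in blast)
    have "inn (\<lambda>z. (h z - p' z) - (h z - ?p z)) ?d = inn (\<lambda>z. h z - p' z) ?d - inn (\<lambda>z. h z - ?p z) ?d"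
      by (rule inn_diff_left[OF H_diff[OF h p'H] H_diff[OF h L_H[OF pL]] L_H[OF dL]])
    also have "\<dots> = 0" using p' dL \<open>\<And>q. q \<in> L \<Longrightarrow> inn (\<lambda>z. h z - ?p z) q = 0\<close> by simp
    also have "(\<lambda>z. (h z - p' z) - (h z - ?p z)) = ?d" by (simp add: fun_eq_iff)
    finally have "inn ?d ?d = 0" .
    then have "nrm ?d = 0" using inn_self[OF L_H[OF dL]] by simp
    from nrm_eq_0[OF L_H[OF dL] this] show "p' = ?p" by (simp add: fun_eq_iff)
  qed
  then show "projQ a I h \<in> L" "(\<lambda>z. h z - projQ a I h z) \<in> N" using pL n(1) by simp_all
qed

text \<open>Both directions of the theorem compare \<open>\<Sum> (u\<^sub>j(Z) - z\<^sub>j) g\<^sub>j(Z) h\<close> with \<open>\<Sum> (u\<^sub>j - z\<^sub>j) g\<^sub>j h\<close> modulo \<open>[I H]\<close>.\<close>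
lemma compress_sum:
  fixes z :: "nat \<Rightarrow> complex"
  assumes u: "\<And>j. j < s \<Longrightarrow> u j \<in> M" and g: "\<And>j. j < s \<Longrightarrow> g j \<in> M" and h: "h \<in> H"
  defines "T \<equiv> \<lambda>w. \<Sum>j<s. compress a I (u j) (compress a I (g j) h) w - z j * compress a I (g j) h w"
  shows "T \<in> L" "(\<lambda>w. (\<Sum>j<s. (u j w - z j * one w) * g j w) * h w - T w) \<in> N"
proof -
  define k1 where "k1 j = compress a I (g j) h" for j
  define r where "r j = compress a I (u j) (k1 j)" for j
  have gh: "(\<lambda>w. g j w * h w) \<in> H" if "j < s" for j by (intro M_H g h that)
  have k1: "k1 j \<in> L" "(\<lambda>w. g j w * h w - k1 j w) \<in> N" if "j < s" for j
    unfolding k1_def compress_def by (rule projQ[OF gh[OF that]])+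
  have uk: "(\<lambda>w. u j w * k1 j w) \<in> H" if "j < s" for j by (intro M_H u L_H k1 that)
  have r: "r j \<in> L" "(\<lambda>w. u j w * k1 j w - r j w) \<in> N" if "j < s" for j
    unfolding r_def compress_def[of a I "u j"] by (rule projQ[OF uk[OF that]])+
  have T: "T = (\<lambda>w. \<Sum>j<s. r j w - z j * k1 j w)" by (simp add: T_def r_def k1_def)
  show "T \<in> L" unfolding T by (intro L_sum L_diff L_cmult r k1) auto
  have "(\<lambda>w. \<Sum>j<s. (u j w * (g j w * h w - k1 j w) + (u j w * k1 j w - r j w)) - z j * (g j w * h w - k1 j w)) \<in> N"
    by (intro N_sum N_diff N_add N_cmult N_mult u k1 r) auto
  moreover have "(\<lambda>w. \<Sum>j<s. (u j w * (g j w * h w - k1 j w) + (u j w * k1 j w - r j w)) - z j * (g j w * h w - k1 j w))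
    = (\<lambda>w. (\<Sum>j<s. (u j w - z j * one w) * g j w) * h w - T w)"
  proof
    fix w
    have e1: "(u j w - z j * one w) * g j w * h w = (u j w - z j) * g j w * h w" for j
      using H_off[OF h, of w] by (cases "w \<in> Bd") auto
    have "(\<Sum>j<s. (u j w - z j * one w) * g j w) * h w - T w = (\<Sum>j<s. (u j w - z j) * g j w * h w - (r j w - z j * k1 j w))"
      unfolding T by (simp add: sum_distrib_right sum_subtractf e1)
    also have "\<dots> = (\<Sum>j<s. (u j w * (g j w * h w - k1 j w) + (u j w * k1 j w - r j w)) - z j * (g j w * h w - k1 j w))"
      by (intro sum.cong refl) (simp add: algebra_simps)
    finally show "(\<Sum>j<s. (u j w * (g j w * h w - k1 j w) + (u j w * k1 j w - r j w)) - z j * (g j w * h w - k1 j w))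
      = (\<Sum>j<s. (u j w - z j * one w) * g j w) * h w - T w" by simp
  qed
  ultimately show "(\<lambda>w. (\<Sum>j<s. (u j w - z j * one w) * g j w) * h w - T w) \<in> N" by simp
qed

text \<open>Elements of \<open>Balg\<close> are compressions of multipliers, so a solution of the
  operator equation is a choice of the \<open>g j\<close>. The operator identity on \<open>L\<close>
  and membership of one function in \<open>N\<close> are linked through the vector
  \<open>one\<close>, which is cyclic for the multipliers.\<close>

lemma not_in_joint_spec_iff:
  fixes s :: nat
  assumes u: "\<And>j. j < s \<Longrightarrow> u j \<in> M"
  shows "z \<notin> joint_spec a I s (\<lambda>j. compress a I (u j)) \<longleftrightarrow>
    (\<exists>g. (\<forall>j<s. g j \<in> M) \<and> (\<lambda>w. one w - (\<Sum>j<s. (u j w - z j * one w) * g j w)) \<in> N)" (is "?L = ?R")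
proof
  assume ?L
  then obtain B where B: "\<forall>j<s. B j \<in> Balg a I"
    "\<forall>h\<in>L. (\<lambda>w. \<Sum>j<s. compress a I (u j) (B j h) w - z j * B j h w) = h"
    by (auto simp: joint_spec_def)
  have "\<forall>j<s. \<exists>g\<in>M. B j = compress a I g" using B(1) by (auto simp: Balg_def Mult_rk)
  then obtain g where g: "\<And>j. j < s \<Longrightarrow> g j \<in> M" "\<And>j. j < s \<Longrightarrow> B j = compress a I (g j)" by metis
  let ?S = "\<lambda>w. \<Sum>j<s. (u j w - z j * one w) * g j w"
  have SM: "?S \<in> M" by (intro M_sum M_mult M_diff M_cmult u g one_M) auto
  let ?f = "\<lambda>w. one w - ?S w"
  have fM: "?f \<in> M" by (intro M_diff one_M SM)
  have fL: "(\<lambda>w. ?f w * h w) \<in> N" if h: "h \<in> L" for h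
  proof -
    have "(\<lambda>w. \<Sum>j<s. compress a I (u j) (compress a I (g j) h) w - z j * compress a I (g j) h w) = h"
      using B(2) h g(2) by simp
    then have eq: "(\<Sum>j<s. compress a I (u j) (compress a I (g j) h) w - z j * compress a I (g j) h w) = h w" for w
      by (rule fun_cong)
    have "(\<lambda>w. ?S w * h w - h w) \<in> N"
      using compress_sum(2)[of s u g h z, OF u g(1) L_H[OF h]] by (simp only: eq)
    from N_cmult[OF this, of "-1"] have "(\<lambda>w. h w - ?S w * h w) \<in> N" by simp
    moreover have "(\<lambda>w. h w - ?S w * h w) = (\<lambda>w. ?f w * h w)"
      using mult_one(2)[OF L_H[OF h]] by (simp add: fun_eq_iff left_diff_distrib mult.commute[of "one _"])
    ultimately show ?thesis by simp
  qed
  \<comment> \<open>The operator identity gives \<open>?f h\<close> in \<open>N\<close> only for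
    \<open>h\<close> in \<open>L\<close>. The vector \<open>one\<close> is split into its projection
    to \<open>L\<close>, covered by this, and a part in \<open>N\<close>, which absorbs
    multipliers.\<close>
  have "(\<lambda>w. ?f w * projQ a I one w + ?f w * (one w - projQ a I one w)) \<in> N"
    by (intro N_add fL N_mult fM projQ one_H)
  moreover have "(\<lambda>w. ?f w * projQ a I one w + ?f w * (one w - projQ a I one w)) = ?f"
    using mult_one(1)[OF fM] by (simp add: fun_eq_iff distrib_left[symmetric])
  ultimately show ?R using g(1) by (intro exI[of _ g]) simp
next
  assume ?R
  then obtain g where g: "\<And>j. j < s \<Longrightarrow> g j \<in> M" and N: "(\<lambda>w. one w - (\<Sum>j<s. (u j w - z j * one w) * g j w)) \<in> N" by blast
  let ?S = "\<lambda>w. \<Sum>j<s. (u j w - z j * one w) * g j w"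
  have SM: "?S \<in> M" by (intro M_sum M_mult M_diff M_cmult u g one_M) auto
  let ?f = "\<lambda>w. one w - ?S w"
  have fM: "?f \<in> M" by (intro M_diff one_M SM)
  have "(\<lambda>w. \<Sum>j<s. compress a I (u j) (compress a I (g j) h) w - z j * compress a I (g j) h w) = h" if h: "h \<in> L" for h
  proof -
    define T where "T = (\<lambda>w. \<Sum>j<s. compress a I (u j) (compress a I (g j) h) w - z j * compress a I (g j) h w)"
    have T: "T \<in> L" "(\<lambda>w. ?S w * h w - T w) \<in> N"
      unfolding T_def by (rule compress_sum[of s u g h z, OF u g L_H[OF h]]; assumption)+
    have fh: "(\<lambda>w. ?f w * h w) \<in> N" by (rule N_mult_H[OF fM N L_H[OF h]])
    have "(\<lambda>w. ?f w * h w + (?S w * h w - T w)) \<in> N" by (intro N_add fh T)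
    moreover have "(\<lambda>w. ?f w * h w + (?S w * h w - T w)) = (\<lambda>w. h w - T w)"
      using mult_one(2)[OF L_H[OF h]] by (simp add: fun_eq_iff left_diff_distrib mult.commute[of "one _"])
    ultimately have "(\<lambda>w. h w - T w) \<in> N" by simp
    \<comment> \<open>\<open>h\<close> and \<open>T\<close> agree modulo \<open>N\<close> and both
      lie in its orthogonal complement, so they are equal.\<close>
    from L_N_zero[OF L_diff[OF h T(1)] this] show ?thesis unfolding T_def[symmetric] by (simp add: fun_eq_iff)
  qed
  then show ?L
    unfolding joint_spec_def using g
    by (auto simp: Balg_def Mult_rk intro!: exI[of _ "\<lambda>j. compress a I (g j)"])
qed

text \<open>\<open>N\<close> absorbs multipliers, so not only \<open>f\<close> but every product of
  \<open>f\<close> with a multiplier is a norm limit of elements of \<open>I\<close>; this is the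
  density that \<open>weak_star_approximation\<close> requires.\<close>

lemma N_mult_in_I:
  assumes closed: "wstar_closed a I" and f: "f \<in> M" "f \<in> N"
  shows "f \<in> I"
proof -
  have "\<exists>g\<in>I. \<forall>i<m. cmod (wstar_fun a (X i) (Y i) g - wstar_fun a (X i) (Y i) f) < e"
    if XY: "\<forall>i<m. wstar_pair a (X i) (Y i)" and e: "e > 0" for m :: nat and X Y and e :: real
    unfolding wstar_fun_def Hinner_rk
  proof (rule weak_star_approximation)
    show "I \<subseteq> M" using I_M by blast
    show "(\<lambda>z. h z * g z) \<in> I" if "g \<in> I" "h \<in> M" for g h by (rule I_mult[OF that])
    show "\<exists>g\<in>I. nrm (\<lambda>z. f z * h z - g z) < e" if "h \<in> M" "e > 0" for h e
      using N_mult[OF that(1) f(2)] that(2) unfolding N_iff by (simp add: mult.commute)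
  qed (use XY f e in \<open>auto simp: wstar_pair_def Hspace_rk Hnorm_rk\<close>)
  then show ?thesis using closed f(1) unfolding wstar_closed_def Mult_rk by blast
qed

text \<open>Otherwise the ideal generated by \<open>f\<close> and the \<open>u j - z j\<close> is
  proper, hence is annihilated by a character. The corona property approximates this character by a
  point evaluation at which all generators are small, against the lower bound
  \<open>d\<close>.\<close>

lemma corona_ideal:
  fixes s :: nat
  assumes cor: "corona a TYPE('d)" and u: "\<And>j. j < s \<Longrightarrow> u j \<in> M" and f: "f \<in> M"
    and d: "d > 0" "\<And>w. w \<in> Bd \<Longrightarrow> d \<le> cmod (f w) + (\<Sum>j<s. cmod (u j w - z j))"
  obtains g G where "g \<in> M" "\<And>j. j < s \<Longrightarrow> G j \<in> M"
    "one = (\<lambda>w. g w * f w + (\<Sum>j<s. G j w * (u j w - z j * one w)))"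
proof -
  let ?c = "\<lambda>g G w. g w * f w + (\<Sum>j<s. G j w * (u j w - z j * one w))"
  define J where "J = {?c g G | g G. g \<in> M \<and> (\<forall>j<s. G j \<in> M)}"
  have JI: "?c g G \<in> J" if "g \<in> M" "\<And>j. j < s \<Longrightarrow> G j \<in> M" for g G unfolding J_def using that by blast
  have uM: "(\<lambda>w. u j w - z j * one w) \<in> M" if "j < s" for j by (intro M_diff M_cmult one_M u that)
  have "one \<in> J"
  proof (rule ccontr)
    assume one: "one \<notin> J"
    have "mideal J" unfolding mideal_def
    proof (intro conjI ballI)
      show "J \<subseteq> M" unfolding J_def using f uM by (auto intro!: M_add M_mult M_sum)
      show "(\<lambda>z. 0) \<in> J" using JI[of "\<lambda>z. 0" "\<lambda>j z. 0"] by simp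
    next
      fix x y assume "x \<in> J" "y \<in> J"
      then obtain g G g' G' where *: "x = ?c g G" "y = ?c g' G'" "g \<in> M" "g' \<in> M" "\<forall>j<s. G j \<in> M" "\<forall>j<s. G' j \<in> M"
        unfolding J_def by blast
      have "?c (\<lambda>w. g w + g' w) (\<lambda>j w. G j w + G' j w) \<in> J" using * by (intro JI) (auto intro!: M_add)
      moreover have "?c (\<lambda>w. g w + g' w) (\<lambda>j w. G j w + G' j w) = (\<lambda>w. x w + y w)"
        unfolding *(1,2) by (simp add: fun_eq_iff distrib_right sum.distrib)
      ultimately show "(\<lambda>w. x w + y w) \<in> J" by simp
    next
      fix x h assume "x \<in> J" and h: "h \<in> M"
      then obtain g G where *: "x = ?c g G" "g \<in> M" "\<forall>j<s. G j \<in> M" unfolding J_def by blast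
      have "?c (\<lambda>w. h w * g w) (\<lambda>j w. h w * G j w) \<in> J" using * h by (intro JI) (auto intro!: M_mult)
      moreover have "?c (\<lambda>w. h w * g w) (\<lambda>j w. h w * G j w) = (\<lambda>w. h w * x w)"
        unfolding *(1) by (simp add: fun_eq_iff distrib_left sum_distrib_left mult.assoc)
      ultimately show "(\<lambda>w. h w * x w) \<in> J" by simp
    qed
    from character_exists[OF this one] obtain chr where chr: "chr one = 1" "\<And>f. f \<in> J \<Longrightarrow> chr f = 0"
      "\<And>f g c. f \<in> M \<Longrightarrow> g \<in> M \<Longrightarrow> chr (\<lambda>z. c * f z + g z) = c * chr f + chr g"
      "\<And>f g. f \<in> M \<Longrightarrow> g \<in> M \<Longrightarrow> chr (\<lambda>z. f z * g z) = chr f * chr g" by blast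
    have ic: "is_character a chr" unfolding is_character_def Mult_rk
      using chr(1,3,4) one_M by (auto intro!: bexI[of _ one])
    have fJ: "f \<in> J"
    proof -
      have "?c one (\<lambda>j z. 0) = f" using mult_one(1)[OF f] by (simp add: fun_eq_iff mult.commute)
      then show ?thesis using JI[of one "\<lambda>j z. 0"] by simp
    qed
    have uJ: "(\<lambda>w. u j w - z j * one w) \<in> J" if j: "j < s" for j
    proof -
      have "?c (\<lambda>z. 0) (\<lambda>i. if i = j then one else (\<lambda>z. 0)) w = u j w - z j * one w" for w
      proof -
        have "(\<Sum>i<s. (if i = j then one else (\<lambda>z. 0)) w * (u i w - z i * one w)) = (\<Sum>i<s. if i = j then one w * (u j w - z j * one w) else 0)"
          by (intro sum.cong refl) auto
        moreover have "one w * (u j w - z j * one w) = u j w - z j * one w"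
          by (subst mult.commute) (rule mult_one(1)[OF uM[OF j]])
        ultimately show ?thesis using j by simp
      qed
      then show ?thesis using JI[of "\<lambda>z. 0" "\<lambda>i. if i = j then one else (\<lambda>z. 0)"] by simp
    qed
    define F where "F = insert f ((\<lambda>j w. u j w - z j * one w) ` {..<s})"
    \<comment> \<open>There are \<open>s + 1\<close> generators, and their moduli at the point
      \<open>w\<close> must add up to less than \<open>d\<close>.\<close>
    define e where "e = d / (real s + 1)"
    have e: "e > 0" "(real s + 1) * e = d" using d(1) by (simp_all add: e_def)
    have "finite F \<and> F \<subseteq> Mult a \<and> e > 0" using f uM e by (auto simp: F_def Mult_rk)
    then obtain w where w: "w \<in> Bd" "\<forall>\<phi>\<in>F. cmod (\<phi> w - chr \<phi>) < e"
      using cor ic unfolding corona_def by blast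
    have 1: "cmod (f w) < e" using w(2) chr(2)[OF fJ] by (simp add: F_def)
    have 2: "cmod (u j w - z j) < e" if "j < s" for j
    proof -
      have "(\<lambda>w. u j w - z j * one w) \<in> F" using that by (simp add: F_def)
      from bspec[OF w(2) this] show ?thesis using w(1) chr(2)[OF uJ[OF that]] by simp
    qed
    have "cmod (f w) + (\<Sum>j<s. cmod (u j w - z j)) < e + (\<Sum>j<s. e)"
      using 1 2 by (intro add_less_le_mono sum_mono less_imp_le) auto
    also have "\<dots> = d" using e(2) by (simp add: algebra_simps)
    finally show False using d(2)[OF w(1)] by simp
  qed
  then obtain g G where "one = ?c g G" "g \<in> M" "\<forall>j<s. G j \<in> M" unfolding J_def by blast
  then show ?thesis using that by blast
qed

lemma not_in_joint_spec_iff_bounded_below: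
  fixes s :: nat
  assumes closed: "wstar_closed a I" and cor: "corona a TYPE('d)" and u: "\<And>j. j < s \<Longrightarrow> u j \<in> M"
  shows "z \<notin> joint_spec a I s (\<lambda>j. compress a I (u j)) \<longleftrightarrow>
    (\<exists>f\<in>I. \<exists>d>0. \<forall>w\<in>Bd. d \<le> cmod (f w) + (\<Sum>j<s. cmod (u j w - z j)))"
proof
  assume "z \<notin> joint_spec a I s (\<lambda>j. compress a I (u j))"
  then obtain g where "\<forall>j<s. g j \<in> M" and N: "(\<lambda>w. one w - (\<Sum>j<s. (u j w - z j * one w) * g j w)) \<in> N"
    using not_in_joint_spec_iff[of s u z, OF u] by auto
  then have g: "g j \<in> M" if "j < s" for j using that by blast
  let ?f = "\<lambda>w. one w - (\<Sum>j<s. (u j w - z j * one w) * g j w)"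
  have fM: "?f \<in> M" by (intro M_diff one_M M_sum M_mult M_cmult u g) auto
  have fI: "?f \<in> I" by (rule N_mult_in_I[OF closed fM N])
  \<comment> \<open>\<open>C\<close> bounds every \<open>|g j|\<close>, and the summand
    \<open>1\<close> makes it at least the coefficient of \<open>|?f w|\<close> in the identity at
    \<open>w\<close>; dividing by \<open>C\<close> gives the lower bound
    \<open>1 / C\<close>.\<close>
  define C where "C = 1 + (\<Sum>j<s. mnorm (g j))"
  have mg: "mnorm (g j) \<ge> 0" if "j < s" for j by (rule mnorm_nonneg[OF g[OF that]])
  have C: "C \<ge> 1" unfolding C_def using sum_nonneg[of "{..<s}" "\<lambda>j. mnorm (g j)"] mg by simp
  have "1 / C \<le> cmod (?f w) + (\<Sum>j<s. cmod (u j w - z j))" if w: "w \<in> Bd" for w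
  proof -
    have "?f w + (\<Sum>j<s. (u j w - z j) * g j w) = 1" using w by simp
    then have "1 \<le> cmod (?f w) + cmod (\<Sum>j<s. (u j w - z j) * g j w)"
      using norm_triangle_ineq[of "?f w" "\<Sum>j<s. (u j w - z j) * g j w"] by (simp only: norm_one)
    also have "cmod (\<Sum>j<s. (u j w - z j) * g j w) \<le> (\<Sum>j<s. cmod (u j w - z j) * C)"
    proof (rule order_trans[OF norm_sum sum_mono])
      fix j assume "j \<in> {..<s}"
      then have j: "j < s" by simp
      have "cmod (g j w) \<le> mnorm (g j)" by (rule cmod_le_mnorm[OF g[OF j] w])
      also have "\<dots> \<le> (\<Sum>j<s. mnorm (g j))" by (rule member_le_sum) (use j mg in auto)
      finally have "cmod (g j w) \<le> C" by (simp add: C_def)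
      then show "cmod ((u j w - z j) * g j w) \<le> cmod (u j w - z j) * C"
        by (simp add: norm_mult mult_left_mono)
    qed
    also have "cmod (?f w) \<le> cmod (?f w) * C" using C mult_left_mono[of 1 C "cmod (?f w)"] by simp
    finally have "1 \<le> (cmod (?f w) + (\<Sum>j<s. cmod (u j w - z j))) * C"
      by (simp add: distrib_right sum_distrib_right)
    then show ?thesis using C by (simp add: field_simps)
  qed
  then show "\<exists>f\<in>I. \<exists>d>0. \<forall>w\<in>Bd. d \<le> cmod (f w) + (\<Sum>j<s. cmod (u j w - z j))"
    using fI C by (intro bexI[of _ ?f] exI[of _ "1 / C"]) auto
next
  assume "\<exists>f\<in>I. \<exists>d>0. \<forall>w\<in>Bd. d \<le> cmod (f w) + (\<Sum>j<s. cmod (u j w - z j))"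
  then obtain f d where f: "f \<in> I" and d: "d > 0" "\<And>w. w \<in> Bd \<Longrightarrow> d \<le> cmod (f w) + (\<Sum>j<s. cmod (u j w - z j))" by blast
  obtain g G where g: "g \<in> M" "\<And>j. j < s \<Longrightarrow> G j \<in> M"
    "one = (\<lambda>w. g w * f w + (\<Sum>j<s. G j w * (u j w - z j * one w)))"
    by (rule corona_ideal[of s u f d z, OF cor u I_M[OF f] d]) (assumption | rule that)+
  have swap: "(\<Sum>j<s. (u j w - z j * one w) * G j w) = (\<Sum>j<s. G j w * (u j w - z j * one w))" for w
    by (simp add: mult.commute)
  have "one w - (\<Sum>j<s. (u j w - z j * one w) * G j w) = g w * f w" for w
    unfolding swap diff_eq_eq by (rule fun_cong[OF g(3)])
  then have "(\<lambda>w. one w - (\<Sum>j<s. (u j w - z j * one w) * G j w)) \<in> N"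
    using I_N[OF I_mult[OF f g(1)]] by simp
  then show "z \<notin> joint_spec a I s (\<lambda>j. compress a I (u j))"
    using g(2) by (intro iffD2[OF not_in_joint_spec_iff[of s u z, OF u]] exI[of _ G] conjI) auto
qed

end

theorem theorem3p13:
  fixes a :: "nat \<Rightarrow> real"
    and I :: "(complex^'d::finite \<Rightarrow> complex) set"
    and s :: nat
    and u :: "nat \<Rightarrow> complex^'d \<Rightarrow> complex"
    and z :: "nat \<Rightarrow> complex"
  assumes "regular_ui_cnp a TYPE('d)"
    and "corona a TYPE('d)"
    and "wstar_closed_ideal a I"
    and "s \<ge> 1"
    and "\<forall>j<s. u j \<in> Mult a"
  shows "z \<in> joint_spec a I s (\<lambda>j. compress a I (u j)) \<longleftrightarrow>
         (SUP f\<in>I. INF w\<in>Bd. ereal (cmod (f w) + (\<Sum>j<s. cmod (u j w - z j)))) = 0"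
proof -
  interpret pick_space "Bd :: (complex^'d) set" "ui_kernel a"
    by (rule ui_kernel_pick_space[OF assms(1)])
  interpret ui_ideal a I
    by unfold_locales (use assms(3) in \<open>simp add: wstar_closed_ideal_def\<close>)
  have closed: "wstar_closed a I" using assms(3) by (simp add: wstar_closed_ideal_def)
  have u: "u j \<in> M" if "j < s" for j using assms(5) that by (simp add: Mult_rk)
  let ?v = "\<lambda>f w. cmod (f w) + (\<Sum>j<s. cmod (u j w - z j))"
  let ?S = "SUP f\<in>I. INF w\<in>Bd. ereal (?v f w)"
  have nonneg: "0 \<le> (INF w\<in>Bd. ereal (?v f w))" for f
    by (rule INF_greatest) (simp add: sum_nonneg)
  have "(\<exists>f\<in>I. \<exists>d>0. \<forall>w\<in>Bd. d \<le> ?v f w) \<longleftrightarrow> ?S \<noteq> 0"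
  proof
    assume "\<exists>f\<in>I. \<exists>d>0. \<forall>w\<in>Bd. d \<le> ?v f w"
    then obtain f d where f: "f \<in> I" and d: "d > 0" "\<And>w. w \<in> Bd \<Longrightarrow> d \<le> ?v f w" by blast
    have "ereal d \<le> (INF w\<in>Bd. ereal (?v f w))" by (rule INF_greatest) (simp add: d(2))
    also have "\<dots> \<le> ?S" by (rule SUP_upper[OF f])
    finally have "ereal d \<le> ?S" .
    then show "?S \<noteq> 0" using d(1) by auto
  next
    assume ne: "?S \<noteq> 0"
    \<comment> \<open>The zero function belongs to \<open>I\<close>, so the supremum is over a
      nonempty set and a nonzero value must be positive.\<close>
    have "0 \<le> ?S" by (rule SUP_upper2[OF I_zero nonneg])
    then have "0 < ?S" using ne by simp
    then obtain f where f: "f \<in> I" "0 < (INF w\<in>Bd. ereal (?v f w))" by (auto simp: less_SUP_iff)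
    \<comment> \<open>A real \<open>d\<close> is inserted below the infimum, which is only known as
      an extended real.\<close>
    from ereal_dense2[OF f(2)] obtain d where d: "0 < ereal d" "ereal d < (INF w\<in>Bd. ereal (?v f w))" by auto
    have "d \<le> ?v f w" if "w \<in> Bd" for w
    proof -
      have "ereal d \<le> ereal (?v f w)" using d(2) INF_lower[OF that, of "\<lambda>w. ereal (?v f w)"] by (meson less_imp_le less_le_trans)
      then show ?thesis by simp
    qed
    then show "\<exists>f\<in>I. \<exists>d>0. \<forall>w\<in>Bd. d \<le> ?v f w" using f(1) d(1) by auto
  qed
  then show ?thesis using not_in_joint_spec_iff_bounded_below[of s u z, OF closed assms(2) u] by blast
qed

end
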